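(* Let $(G,H,\mathcal L)$ be a cut-and-project scheme with $G,H$ locally compact second countable abelian groups, and let $W\subseteq H$ be measurable and relatively compact with $m_H(W)>0$. Let $\widetilde X'=\widetilde X/\pi^{\widetilde X}(\mathcal H_W^{Haar})$ with induced $G$-action $\widetilde T'$ and (normalised) Haar measure $m_{\widetilde X'}$. Then $(\mathcal M_W^G,Q_W^G,S)$ is measure-theoretically isomorphic to $(\widetilde X',m_{\widetilde X'},\widetilde T')$.
   Context: Setting. $G,H$ are locally compact second countable abelian groups with Haar measures $m_G,m_H$. $\mathcal L\subseteq G\times H$ is a co-compact lattice (discrete co-compact subgroup) such that the canonical projection $\pi^G:G\times H\to G$ is injective on $\mathcal L$ and the image of $\mathcal L$ under the canonical projection $\pi^H:G\times H\to H$ is dense in $H$; $(G,H,\mathcal L)$ is called a cut-and-project scheme. Measurable means Borel measurable. Torus. $\widetilde X=(G\times H)/\mathcal L$ is a compact abelian group with normalised Haar measure $m_{\widetilde X}$, $\pi^{\widetilde X}:G\times H\to\widetilde X$ is the quotient map, and $\widetilde T$ is the $G$-action $\widetilde T_g\tilde x=(g,0)+\tilde x$. Extended hull. For $\tilde x=x+\mathcal L\in\widetilde X$ put $\nu_W(\tilde x)=\sum_{y\in(x+\mathcal L)\cap(G\times W)}\delta_y$ (a measure on $G\times H$) and $\nu_W^G(\tilde x)=\pi^G_*(\nu_W(\tilde x))$ (its push-forward to $G$). $\mathcal M_W^G$ is the closure of $\nu_W^G(\widetilde X)$ in the vague topology on the space of regular Borel measures on $G$; it carries the $G$-action $(S_g\nu)(A)=\nu(A-g)$.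 The Mirsky measure on $\mathcal M_W^G$ is $Q_W^G=m_{\widetilde X}\circ(\nu_W^G)^{-1}$ (the map $\nu_W^G$ is Borel measurable). Haar periods. $H_W^{Haar}=\{h\in H:m_H((h+W)\triangle W)=0\}$ is the group of Haar periods of $W$ (a compact subgroup of $H$ when $m_H(W)>0$), and $\mathcal H_W^{Haar}=\{0\}\times H_W^{Haar}\subseteq G\times H$. Measure-theoretic isomorphism of two probability-preserving $G$-systems means a bimeasurable, measure-preserving, $G$-equivariant bijection between invariant measurable subsets of full measure. *)

theory Defs
  imports "HOL-Probability.Probability_Measure" "HOL-Algebra.Coset"
begin

section \<open>Quotient topology and Borel measures on abstract topological spaces\<close>

definition quotient_topology :: "'a topology \<Rightarrow> ('a \<Rightarrow> 'b) \<Rightarrow> 'b topology" where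
  "quotient_topology T f =
     topology (\<lambda>U. U \<subseteq> f ` topspace T \<and> openin T {x \<in> topspace T. f x \<in> U})"

lemma openin_quotient_topology:
  "openin (quotient_topology T f) U \<longleftrightarrow>
     U \<subseteq> f ` topspace T \<and> openin T {x \<in> topspace T. f x \<in> U}"
proof -
  have "istopology (\<lambda>U. U \<subseteq> f ` topspace T \<and> openin T {x \<in> topspace T. f x \<in> U})"
    unfolding istopology_def
  proof (intro conjI allI impI)
    fix S S'
    assume "S \<subseteq> f ` topspace T \<and> openin T {x \<in> topspace T. f x \<in> S}"
      and "S' \<subseteq> f ` topspace T \<and> openin T {x \<in> topspace T. f x \<in> S'}"
    moreover have "{x \<in> topspace T. f x \<in> S \<inter> S'} =
        {x \<in> topspace T. f x \<in> S} \<inter> {x \<in> topspace T. f x \<in> S'}" by blast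
    ultimately show "S \<inter> S' \<subseteq> f ` topspace T" "openin T {x \<in> topspace T. f x \<in> S \<inter> S'}"
      by auto
  next
    fix \<K>
    assume *: "\<forall>K\<in>\<K>. K \<subseteq> f ` topspace T \<and> openin T {x \<in> topspace T. f x \<in> K}"
    have "{x \<in> topspace T. f x \<in> \<Union>\<K>} = (\<Union>K\<in>\<K>. {x \<in> topspace T. f x \<in> K})" by blast
    with * show "\<Union>\<K> \<subseteq> f ` topspace T" "openin T {x \<in> topspace T. f x \<in> \<Union>\<K>}"
      by auto
  qed
  then show ?thesis
    by (simp add: quotient_topology_def topology_inverse')
qed

lemma topspace_quotient_topology [simp]: "topspace (quotient_topology T f) = f ` topspace T"
proof -
  have "{x \<in> topspace T. f x \<in> f ` topspace T} = topspace T" by blast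
  then have "openin (quotient_topology T f) (f ` topspace T)"
    by (simp add: openin_quotient_topology)
  then show ?thesis
    by (meson openin_quotient_topology openin_subset openin_topspace subset_antisym)
qed

lemma quotient_map_quotient_topology: "quotient_map T (quotient_topology T f) f"
  by (simp add: quotient_map_def openin_quotient_topology)

definition borel_of :: "'a topology \<Rightarrow> 'a measure" where
  "borel_of T = sigma (topspace T) {U. openin T U}"

lemma borel_of_euclidean: "borel_of euclidean = borel"
  by (simp add: borel_of_def borel_def)

definition regular_borel_measure :: "'a topology \<Rightarrow> 'a measure \<Rightarrow> bool" where
  "regular_borel_measure T m \<longleftrightarrow>
     sets m = sets (borel_of T) \<and>
     (\<forall>K. compactin T K \<longrightarrow> emeasure m K < \<infinity>) \<and>
     (\<forall>A\<in>sets m. emeasure m A = (INF U\<in>{U. openin T U \<and> A \<subseteq> U}. emeasure m U)) \<and>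
     (\<forall>U. openin T U \<longrightarrow> emeasure m U = (SUP K\<in>{K. compactin T K \<and> K \<subseteq> U}. emeasure m K))"

section \<open>Haar measures\<close>

text \<open>The group \<open>K\<close> is written multiplicatively (as always in \<open>HOL-Algebra\<close>) and carries the
  topology \<open>T\<close>.\<close>

definition haar_measure :: "('a, 'b) monoid_scheme \<Rightarrow> 'a topology \<Rightarrow> 'a measure \<Rightarrow> bool" where
  "haar_measure K T m \<longleftrightarrow>
     regular_borel_measure T m \<and>
     emeasure m (topspace T) \<noteq> 0 \<and>
     (\<forall>a\<in>carrier K. \<forall>A\<in>sets m. emeasure m ((\<lambda>x. a \<otimes>\<^bsub>K\<^esub> x) ` A) = emeasure m A)"

definition normalised_haar_measure ::
    "('a, 'b) monoid_scheme \<Rightarrow> 'a topology \<Rightarrow> 'a measure \<Rightarrow> bool" where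
  "normalised_haar_measure K T m \<longleftrightarrow> haar_measure K T m \<and> emeasure m (topspace T) = 1"

section \<open>Cut-and-project schemes and their tori\<close>

definition additive_group :: "'a::ab_group_add monoid" where
  "additive_group = \<lparr>carrier = UNIV, mult = (+), one = 0\<rparr>"

definition torus :: "('g::ab_group_add \<times> 'h::ab_group_add) set \<Rightarrow> ('g \<times> 'h) set monoid" where
  "torus L = additive_group Mod L"

definition torus_proj ::
    "('g::ab_group_add \<times> 'h::ab_group_add) set \<Rightarrow> 'g \<times> 'h \<Rightarrow> ('g \<times> 'h) set" where
  "torus_proj L x = L #>\<^bsub>additive_group\<^esub> x"

definition torus_topology ::
    "('g::topological_ab_group_add \<times> 'h::topological_ab_group_add) set \<Rightarrow> ('g \<times> 'h) set topology"
  where "torus_topology L = quotient_topology euclidean (torus_proj L)"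

text \<open>\<open>torus_action g X\<close> is the coset \<open>(g, 0) + X\<close>.\<close>

definition torus_action :: "'g \<Rightarrow> ('g::ab_group_add \<times> 'h::ab_group_add) set \<Rightarrow> ('g \<times> 'h) set" where
  "torus_action g X = (\<lambda>p. (g, 0) + p) ` X"

definition cut_and_project_scheme ::
    "('g::topological_ab_group_add \<times> 'h::topological_ab_group_add) set \<Rightarrow> bool" where
  "cut_and_project_scheme L \<longleftrightarrow>
     locally_compact_space (euclidean :: 'g topology) \<and>
     locally_compact_space (euclidean :: 'h topology) \<and>
     subgroup L additive_group \<and> discrete L \<and> compact_space (torus_topology L) \<and>
     inj_on fst L \<and> closure (snd ` L) = UNIV"

section \<open>The extended hull and its Mirsky measure\<close>

text \<open>The Borel measure \<open>\<Sum>y\<in>S. \<delta>\<^sub>y\<close>, as the push-forward of the counting measure on \<open>S\<close>.\<close>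

definition dirac_comb :: "'a::topological_space set \<Rightarrow> 'a measure" where
  "dirac_comb S = distr (count_space S) borel (\<lambda>y. y)"

lemma emeasure_dirac_comb:
  assumes "A \<in> sets borel"
  shows "emeasure (dirac_comb S) A = (\<integral>\<^sup>+ y. indicator A y \<partial>count_space S)"
proof -
  have "indicator A y = (indicator (A \<inter> S) y :: ennreal)" if "y \<in> space (count_space S)" for y
    using that by (simp add: indicator_def)
  then have "(\<integral>\<^sup>+ y. indicator A y \<partial>count_space S)
      = (\<integral>\<^sup>+ y. indicator (A \<inter> S) y \<partial>count_space S)"
    by (rule nn_integral_cong)
  also have "\<dots> = emeasure (count_space S) (A \<inter> S)"
    by (rule nn_integral_indicator) simp
  finally show ?thesis
    using assms by (simp add: dirac_comb_def emeasure_distr)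
qed

text \<open>A point of the torus is itself the coset \<open>x + L\<close>, as a subset of the product group.\<close>

definition nu ::
    "'h set \<Rightarrow> ('g::topological_space \<times> 'h::topological_space) set \<Rightarrow> ('g \<times> 'h) measure" where
  "nu W X = dirac_comb (X \<inter> (UNIV \<times> W))"

definition nuG ::
    "'h set \<Rightarrow> ('g::topological_space \<times> 'h::topological_space) set \<Rightarrow> 'g measure" where
  "nuG W X = distr (nu W X) borel fst"

definition compactly_supported :: "('a::topological_space \<Rightarrow> real) set" where
  "compactly_supported = {\<phi>. continuous_on UNIV \<phi> \<and> compact (closure {x. \<phi> x \<noteq> 0})}"

text \<open>The coarsest topology on the regular Borel measures that makes all maps
  \<open>m \<mapsto> \<integral>\<phi> dm\<close>, for \<open>\<phi>\<close> continuous with compact support, continuous.\<close>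

definition vague_topology :: "'a::topological_space measure topology" where
  "vague_topology =
     topology_generated_by
       {{m. regular_borel_measure euclidean m \<and> (\<integral>x. \<phi> x \<partial>m) \<in> U} | \<phi> U.
          \<phi> \<in> compactly_supported \<and> open U}"

definition extended_hull ::
    "('g::topological_ab_group_add \<times> 'h::topological_ab_group_add) set \<Rightarrow> 'h set \<Rightarrow> 'g measure set"
  where "extended_hull L W = vague_topology closure_of (nuG W ` carrier (torus L))"

definition hull_topology ::
    "('g::topological_ab_group_add \<times> 'h::topological_ab_group_add) set \<Rightarrow> 'h set \<Rightarrow> 'g measure topology"
  where "hull_topology L W = subtopology vague_topology (extended_hull L W)"

text \<open>\<open>emeasure (translate g m) A\<close> is \<open>emeasure m (A - g)\<close>.\<close>

definition translate :: "'g \<Rightarrow> 'g::topological_ab_group_add measure \<Rightarrow> 'g measure" where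
  "translate g m = distr m borel (\<lambda>x. g + x)"

definition mirsky_measure ::
    "('g::topological_ab_group_add \<times> 'h::topological_ab_group_add) set \<Rightarrow> 'h set \<Rightarrow>
     ('g \<times> 'h) set measure \<Rightarrow> 'g measure measure" where
  "mirsky_measure L W mX = distr mX (borel_of (hull_topology L W)) (nuG W)"

section \<open>Haar periods and the quotient torus\<close>

definition haar_periods :: "'h::ab_group_add measure \<Rightarrow> 'h set \<Rightarrow> 'h set" where
  "haar_periods mH W = {h. emeasure mH (sym_diff ((\<lambda>w. h + w) ` W) W) = 0}"

definition torus_periods ::
    "('g::ab_group_add \<times> 'h::ab_group_add) set \<Rightarrow> 'h measure \<Rightarrow> 'h set \<Rightarrow> ('g \<times> 'h) set set" where
  "torus_periods L mH W = torus_proj L ` ({0} \<times> haar_periods mH W)"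

definition quotient_torus ::
    "('g::ab_group_add \<times> 'h::ab_group_add) set \<Rightarrow> 'h measure \<Rightarrow> 'h set \<Rightarrow>
     ('g \<times> 'h) set set monoid" where
  "quotient_torus L mH W = torus L Mod torus_periods L mH W"

definition quotient_torus_topology ::
    "('g::topological_ab_group_add \<times> 'h::topological_ab_group_add) set \<Rightarrow> 'h measure \<Rightarrow> 'h set \<Rightarrow>
     ('g \<times> 'h) set set topology" where
  "quotient_torus_topology L mH W =
     quotient_topology (torus_topology L) (\<lambda>X. torus_periods L mH W #>\<^bsub>torus L\<^esub> X)"

text \<open>The induced action sends the class of \<open>X\<close> to the class of \<open>torus_action g X\<close>; on a class,
  regarded as a set of points of the torus, this is the image.\<close>

definition quotient_torus_action ::
    "'g \<Rightarrow> ('g::ab_group_add \<times> 'h::ab_group_add) set set \<Rightarrow> ('g \<times> 'h) set set" where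
  "quotient_torus_action g C = torus_action g ` C"

section \<open>Probability-preserving systems and isomorphism\<close>

definition pp_system :: "'a measure \<Rightarrow> ('g::ab_group_add \<Rightarrow> 'a \<Rightarrow> 'a) \<Rightarrow> bool" where
  "pp_system M T \<longleftrightarrow>
     prob_space M \<and>
     (\<forall>g. T g \<in> M \<rightarrow>\<^sub>M M \<and> distr M M (T g) = M) \<and>
     (\<forall>x\<in>space M. T 0 x = x \<and> (\<forall>g h. T (g + h) x = T g (T h x)))"

definition isomorphic_systems ::
    "'a measure \<Rightarrow> ('g::ab_group_add \<Rightarrow> 'a \<Rightarrow> 'a) \<Rightarrow> 'b measure \<Rightarrow> ('g \<Rightarrow> 'b \<Rightarrow> 'b) \<Rightarrow> bool" where
  "isomorphic_systems M S N T \<longleftrightarrow>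
     pp_system M S \<and> pp_system N T \<and>
     (\<exists>A\<in>sets M. \<exists>B\<in>sets N. \<exists>\<phi>.
        emeasure M A = 1 \<and> (\<forall>g. S g ` A = A) \<and>
        emeasure N B = 1 \<and> (\<forall>g. T g ` B = B) \<and>
        bij_betw \<phi> A B \<and>
        \<phi> \<in> restrict_space M A \<rightarrow>\<^sub>M restrict_space N B \<and>
        inv_into A \<phi> \<in> restrict_space N B \<rightarrow>\<^sub>M restrict_space M A \<and>
        distr (restrict_space M A) (restrict_space N B) \<phi> = restrict_space N B \<and>
        (\<forall>g. \<forall>x\<in>A. \<phi> (S g x) = T g (\<phi> x)))"

end

theory Submission
  imports Defs
begin

text \<open>The map \<open>nuG W\<close> sends a coset \<open>X\<close> of \<open>L\<close> to the comb of the first coordinates of those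
points of \<open>X\<close> whose second coordinate lies in the window \<open>W\<close>. It intertwines the two
actions, and the Mirsky measure is its image measure. Everything therefore rests on one
fact: off a null set, \<open>nuG W X = nuG W Z\<close> holds exactly when \<open>Z = (0, d) + X\<close> for a Haar
period \<open>d\<close> of \<open>W\<close>. Then \<open>nuG W X\<close> corresponds to the class of \<open>X\<close> in the quotient torus.

Equal combs give a period. The first projection is injective on \<open>L\<close>, so a point of \<open>X\<close> is
determined by its first coordinate. If \<open>nuG W X = nuG W Z\<close> has an atom, then \<open>Z = (0, d) + X\<close>, and
\<open>t \<in> W \<longleftrightarrow> d + t \<in> W\<close> for every second coordinate \<open>t\<close> of a point of \<open>X\<close>. For almost every
\<open>X\<close> these second coordinates are distributed in \<open>H\<close> according to Haar measure, and this forces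
\<open>d\<close> to be a period. Two facts make this precise. Summing a function over a coset
(\<open>periodise\<close>) and integrating over the torus gives a multiple of Haar measure in the second
coordinate (\<open>mean_tensor\<close>, uniqueness of Haar measure). And \<open>snd ` L\<close> is dense, hence the
\<open>G\<close>-orbits in the torus are dense, hence suitable convex combinations of \<open>G\<close>-translates of a
continuous function converge uniformly to its integral (\<open>convex_average_near_integral\<close>). By
approximation in \<open>L\<^sup>1\<close> the averages also converge almost everywhere, along a subsequence, for
the discontinuous functions attached to \<open>W\<close> and to compact subsets of it (\<open>generic_AE\<close>,
\<open>generic_injective\<close>).

A period gives equal combs. \<open>W\<close> coincides up to a null set with a set \<open>W'\<close> that is literally
invariant under its Haar periods (\<open>periodic_version\<close>), and almost every coset has no point
over the null set on which \<open>W\<close> and \<open>W'\<close> differ (\<open>AE_misses_null\<close>).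

The correspondence is Borel in both directions. The map \<open>nuG W\<close> need not be continuous, but it is
continuous on large compact sets, and these can be chosen so that their union is a
\<open>G\<close>-invariant set of full measure (\<open>sigma_compact_core\<close>). Compact pieces have closed images
both in the hull, because the vague topology is Hausdorff, and in the quotient torus, because
the group of periods is compact; so preimages of open sets under the bijection and under its
inverse are differences of countable unions of closed sets. Finally the image of the Haar
measure of the torus is the Haar measure of the quotient (\<open>distr_qproj\<close>).\<close>

section \<open>Locally compact second countable spaces\<close>

instance prod :: (topological_monoid_add, topological_monoid_add) topological_monoid_add
proof
  fix a b :: "'a \<times> 'b"
  have 1: "(fst \<longlongrightarrow> a) (nhds a \<times>\<^sub>F nhds b)" by (rule filterlim_fst)
  have 2: "(snd \<longlongrightarrow> b) (nhds a \<times>\<^sub>F nhds b)" by (rule filterlim_snd)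
  show "LIM x nhds a \<times>\<^sub>F nhds b. fst x + snd x :> nhds (a + b)"
    unfolding plus_prod_def
    by (rule tendsto_Pair[OF tendsto_add[OF tendsto_fst[OF 1] tendsto_fst[OF 2]] tendsto_add[OF tendsto_snd[OF 1] tendsto_snd[OF 2]]])
qed

instance prod :: (topological_group_add, topological_group_add) topological_group_add
proof
  fix a :: "'a \<times> 'b"
  have 1: "((\<lambda>x. x) \<longlongrightarrow> a) (nhds a)" by (rule filterlim_ident)
  have 2: "((\<lambda>x. (- fst x, - snd x)) \<longlongrightarrow> (- fst a, - snd a)) (nhds a)"
    by (rule tendsto_Pair[OF tendsto_minus[OF tendsto_fst[OF 1]] tendsto_minus[OF tendsto_snd[OF 1]]])
  have 3: "(uminus :: 'a \<times> 'b \<Rightarrow> _) = (\<lambda>x. (- fst x, - snd x))"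
    by (rule ext) (rule uminus_prod_def)
  have 4: "- a = (- fst a, - snd a)" by (rule uminus_prod_def)
  show "(uminus \<longlongrightarrow> - a) (nhds a)" by (subst 3, subst 4, rule 2)
qed

instance prod :: (topological_ab_group_add, topological_ab_group_add) topological_ab_group_add ..

lemma Hausdorff_euclidean: "Hausdorff_space (euclidean :: 'a::t2_space topology)"
proof -
  have "\<exists>U V. open U \<and> open V \<and> x \<in> U \<and> y \<in> V \<and> disjnt U V" if "x \<noteq> y" for x y :: 'a
    using hausdorff[OF that] unfolding disjnt_def .
  then show ?thesis unfolding Hausdorff_space_def by (simp add: open_openin[symmetric])
qed

lemma closure_UN_finite:
  "finite F \<Longrightarrow> closure (\<Union>x\<in>F. V x) = (\<Union>x\<in>F. closure (V x))"
  by (induction F rule: finite_induct) auto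

lemma second_countable_euclidean: "second_countable (euclidean :: 'a::second_countable_topology topology)"
proof -
  obtain B :: "'a set set" where B: "countable B" "topological_basis B" using ex_countable_basis by blast
  have "\<exists>V\<in>B. x \<in> V \<and> V \<subseteq> U" if "open U" "x \<in> U" for U x
    using topological_basisE[OF B(2) that] by metis
  then show ?thesis
    unfolding second_countable_def using B topological_basis_open[OF B(2)]
    by (intro exI[of _ B]) (simp add: open_openin[symmetric])
qed

text \<open>Bundles local compactness with regularity, which Hausdorff spaces gain from it, into the
form in which neighbourhoods are shrunk below.\<close>

lemma lc_nbhd:
  fixes U :: "'a::t2_space set"
  assumes "locally_compact_space (euclidean :: 'a topology)" "open U" "x \<in> U"
  obtains V where "open V" "x \<in> V" "compact (closure V)" "closure V \<subseteq> U"
proof -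
  have reg: "regular_space (euclidean :: 'a topology)"
    using assms(1) Hausdorff_euclidean locally_compact_Hausdorff_imp_regular_space by blast
  then have "neighbourhood_base_of (\<lambda>T. compactin euclidean T \<and> closedin euclidean T) (euclidean :: 'a topology)"
    using assms(1) locally_compact_space_neighbourhood_base_closedin by blast
  then obtain V C where "open V" "compact C" "closed C" "x \<in> V" "V \<subseteq> C" "C \<subseteq> U"
    using assms(2,3) unfolding neighbourhood_base_of open_openin[symmetric] closed_closedin[symmetric] compactin_euclidean_iff
    by metis
  moreover then have "closure V \<subseteq> C" by (simp add: closure_minimal)
  moreover then have "compact (closure V)"
    using \<open>compact C\<close> compact_Int_closed[of C "closure V"] by (simp add: inf.absorb2)
  ultimately show ?thesis using that by blast
qed

lemma lc_between:
  fixes U :: "'a::t2_space set"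
  assumes lc: "locally_compact_space (euclidean :: 'a topology)" and "open U" "compact K" "K \<subseteq> U"
  obtains V where "open V" "K \<subseteq> V" "compact (closure V)" "closure V \<subseteq> U"
proof -
  have "\<exists>V. open V \<and> x \<in> V \<and> compact (closure V) \<and> closure V \<subseteq> U" if "x \<in> K" for x
    using lc_nbhd[OF lc \<open>open U\<close>] that \<open>K \<subseteq> U\<close> by (metis subsetD)
  then obtain V where V: "\<And>x. x \<in> K \<Longrightarrow> open (V x) \<and> x \<in> V x \<and> compact (closure (V x)) \<and> closure (V x) \<subseteq> U"
    by metis
  then obtain F where F: "F \<subseteq> K" "finite F" "K \<subseteq> (\<Union>x\<in>F. V x)"
    using compactE_image[OF \<open>compact K\<close>, of K V] by (metis UN_I subsetI)
  define O' where "O' = (\<Union>x\<in>F. V x)"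
  have cl: "closure O' = (\<Union>x\<in>F. closure (V x))"
    unfolding O'_def using F(2) by (rule closure_UN_finite)
  show ?thesis
  proof (rule that[of O'])
    show "open O'" using V F unfolding O'_def by blast
    show "compact (closure O')" unfolding cl using V F by (intro compact_UN) auto
    show "closure O' \<subseteq> U" unfolding cl using V F by blast
  qed (use F O'_def in auto)
qed

lemma lc_Urysohn:
  fixes U :: "'a::{t2_space,second_countable_topology} set"
  assumes lc: "locally_compact_space (euclidean :: 'a topology)" and "open U" "compact K" "K \<subseteq> U"
  obtains f :: "'a \<Rightarrow> real" where "continuous_on UNIV f" "\<And>x. 0 \<le> f x" "\<And>x. f x \<le> 1"
    "\<And>x. x \<in> K \<Longrightarrow> f x = 1" "compact (closure {x. f x \<noteq> 0})" "closure {x. f x \<noteq> 0} \<subseteq> U"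
proof -
  obtain V where V: "open V" "K \<subseteq> V" "compact (closure V)" "closure V \<subseteq> U"
    using lc_between[OF assms] .
  have reg: "regular_space (euclidean :: 'a topology)"
    using assms(1) Hausdorff_euclidean locally_compact_Hausdorff_imp_regular_space by blast
  have "normal_space (euclidean :: 'a topology)"
    by (rule regular_Lindelof_imp_normal_space[OF reg second_countable_imp_Lindelof_space[OF second_countable_euclidean]])
  then have *: "\<And>S T. closedin euclidean S \<Longrightarrow> closedin euclidean T \<Longrightarrow> disjnt S T
           \<Longrightarrow> \<exists>f. continuous_map (euclidean :: 'a topology) euclideanreal f \<and> f ` S \<subseteq> {0} \<and> f ` T \<subseteq> {1}"
    unfolding normal_space_iff_Urysohn_alt by simp
  have "closed (- V)" "closed K" "disjnt (- V) K"
    using V \<open>compact K\<close> compact_imp_closed by (auto simp: disjnt_def)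
  from *[OF this(1,2)[unfolded closed_closedin] this(3)]
  obtain f :: "'a \<Rightarrow> real" where f: "continuous_map euclidean euclideanreal f" "f ` (- V) \<subseteq> {0}" "f ` K \<subseteq> {1}"
    by (elim exE conjE)
  have cf: "continuous_on UNIV f" using f(1) by simp
  \<comment> \<open>Truncation to the unit interval keeps the values 0 and 1.\<close>
  define h where "h x = min 1 (max 0 (f x))" for x
  have sub: "{x. h x \<noteq> 0} \<subseteq> V" unfolding h_def using f(2) by auto
  have clsub: "closure {x. h x \<noteq> 0} \<subseteq> closure V" using sub by (rule closure_mono)
  show ?thesis
  proof (rule that[of h])
    show "continuous_on UNIV h" unfolding h_def using cf by (intro continuous_intros)
    show "h x = 1" if "x \<in> K" for x
    proof -
      have "f x = 1" using f(3) that by blast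
      then show ?thesis by (simp add: h_def)
    qed
    show "closure {x. h x \<noteq> 0} \<subseteq> U" using clsub V(4) by (rule subset_trans)
    show "compact (closure {x. h x \<noteq> 0})"
      using V(3) clsub compact_Int_closed[of "closure V" "closure {x. h x \<noteq> 0}"] by (simp add: inf.absorb2)
  qed (simp_all add: h_def)
qed

lemma lc_exhaustion:
  assumes lc: "locally_compact_space (euclidean :: ('a::{t2_space,second_countable_topology}) topology)"
  obtains Q :: "nat \<Rightarrow> ('a::{t2_space,second_countable_topology}) set" where "\<And>n. open (Q n)" "\<And>n. compact (closure (Q n))" "incseq Q"
    "\<And>K. compact K \<Longrightarrow> \<exists>n. K \<subseteq> Q n"
proof -
  obtain B :: "'a set set" where B: "countable B" "topological_basis B" using ex_countable_basis by blast
  \<comment> \<open>The empty set is added so that the family is nonempty and can be enumerated.\<close>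
  define B' where "B' = insert {} {b\<in>B. compact (closure b)}"
  have "countable B'" "B' \<noteq> {}" using B(1) by (auto simp: B'_def)
  define b where "b = from_nat_into B'"
  have b: "b n \<in> B'" for n unfolding b_def using \<open>B' \<noteq> {}\<close> by (rule from_nat_into)
  have rng: "range b = B'" unfolding b_def using \<open>B' \<noteq> {}\<close> \<open>countable B'\<close> by (rule range_from_nat_into)
  have ob: "open (b n)" "compact (closure (b n))" for n
    using b[of n] B(2) by (auto simp: B'_def topological_basis_open)
  define Q where "Q n = (\<Union>i\<le>n. b i)" for n
  have inc: "incseq Q" by (rule incseq_SucI) (auto simp: Q_def atMost_Suc)
  show ?thesis
  proof (rule that[of Q])
    show "open (Q n)" for n using ob by (auto simp: Q_def)
    have cl: "closure (Q n) = (\<Union>i\<le>n. closure (b i))" for n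
      unfolding Q_def by (rule closure_UN_finite) simp
    show "compact (closure (Q n))" for n
      unfolding cl using ob by (intro compact_UN) auto
    show "incseq Q" by fact
    fix K :: "'a set" assume K: "compact K"
    have "K \<subseteq> (\<Union>n. Q n)"
    proof
      fix x :: 'a
      obtain V where V: "open V" "x \<in> V" "compact (closure V)" "closure V \<subseteq> UNIV"
        by (rule lc_nbhd[OF lc open_UNIV UNIV_I])
      then obtain c where c: "c \<in> B" "x \<in> c" "c \<subseteq> V" using B(2) topological_basisE by metis
      then have "closure c \<subseteq> closure V" by (simp add: closure_mono)
      then have "compact (closure c)" using V(3) compact_Int_closed[of "closure V" "closure c"] by (simp add: inf.absorb2)
      then have "c \<in> range b" using c by (simp add: B'_def rng)
      then show "x \<in> (\<Union>n. Q n)" using c by (auto simp: Q_def)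
    qed
    then obtain N where N: "finite N" "K \<subseteq> (\<Union>n\<in>N. Q n)"
      using compactE_image[OF K, of UNIV Q] \<open>\<And>n. open (Q n)\<close> by (metis UNIV_I)
    have "Q n \<subseteq> Q (Max N)" if "n \<in> N" for n using incseqD[OF inc Max_ge[OF N(1) that]] .
    then show "\<exists>n. K \<subseteq> Q n" using N(2) by blast
  qed
qed

text \<open>One Urysohn function for each pair of finite unions of basic open sets suffices: between a
compact set and an open neighbourhood there is always room for two such unions.\<close>

lemma countable_urysohn_family:
  assumes lc: "locally_compact_space (euclidean :: ('a::{t2_space,second_countable_topology}) topology)"
  obtains E :: "(('a::{t2_space,second_countable_topology}) \<Rightarrow> real) set" where "countable E"
    "\<And>e x. e \<in> E \<Longrightarrow> 0 \<le> e x" "\<And>e x. e \<in> E \<Longrightarrow> e x \<le> 1" "E \<subseteq> compactly_supported"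
    "\<And>K U. compact K \<Longrightarrow> open U \<Longrightarrow> K \<subseteq> U \<Longrightarrow> \<exists>e\<in>E. (\<forall>x\<in>K. e x = 1) \<and> (\<forall>x. x \<notin> U \<longrightarrow> e x = 0)"
proof -
  obtain B :: "'a set set" where B: "countable B" "topological_basis B" using ex_countable_basis by blast
  define O' where "O' = Union ` {F. finite F \<and> F \<subseteq> B}"
  have cO: "countable O'" unfolding O'_def using B(1) by (intro countable_image countable_Collect_finite_subset)
  have opn: "open V" if "V \<in> O'" for V using that topological_basis_open[OF B(2)] unfolding O'_def by blast
  have ins: "\<exists>V\<in>O'. K \<subseteq> V \<and> compact (closure V) \<and> closure V \<subseteq> U" if K: "compact K" "open U" "K \<subseteq> U" for K U :: "'a set"
  proof -
    obtain V where V: "open V" "K \<subseteq> V" "compact (closure V)" "closure V \<subseteq> U"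
      using lc_between[OF lc K(2,1,3)] .
    obtain F where F: "F \<subseteq> B" "V = \<Union>F" using V(1) B(2) unfolding topological_basis_def by metis
    obtain F' where F': "F' \<subseteq> F" "finite F'" "K \<subseteq> \<Union>F'"
      using compactE[OF K(1), of F] V(2) F topological_basis_open[OF B(2)] by (metis subsetD)
    have "\<Union>F' \<in> O'" using F F' by (auto simp: O'_def)
    moreover have sub: "closure (\<Union>F') \<subseteq> closure V" using F F' by (intro closure_mono) auto
    moreover then have "compact (closure (\<Union>F'))" using V(3) compact_Int_closed[of "closure V" "closure (\<Union>F')"] by (simp add: inf.absorb2)
    ultimately show ?thesis using F' V(4) by blast
  qed
  define P where "P = {(U,V)\<in>O' \<times> O'. compact (closure U) \<and> closure U \<subseteq> V}"
  have cP: "countable P" unfolding P_def using cO by (intro countable_subset[OF _ countable_SIGMA[of O' "\<lambda>_. O'"]]) auto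
  define good where "good e p \<longleftrightarrow> continuous_on UNIV e \<and> (\<forall>x. 0 \<le> e x) \<and> (\<forall>x. e x \<le> 1) \<and> (\<forall>x\<in>fst p. e x = 1) \<and>
    compact (closure {x. e x \<noteq> 0}) \<and> closure {x. e x \<noteq> 0} \<subseteq> snd p" for e :: "'a \<Rightarrow> real" and p
  have "\<exists>e. good e p" if "p \<in> P" for p
  proof -
    have *: "open (snd p)" "compact (closure (fst p))" "closure (fst p) \<subseteq> snd p" using that opn by (auto simp: P_def)
    obtain f :: "'a \<Rightarrow> real" where "continuous_on UNIV f" "\<And>x. 0 \<le> f x" "\<And>x. f x \<le> 1"
    "\<And>x. x \<in> closure (fst p) \<Longrightarrow> f x = 1" "compact (closure {x. f x \<noteq> 0})" "closure {x. f x \<noteq> 0} \<subseteq> snd p"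
      using lc_Urysohn[OF lc *] by blast
    then show ?thesis using closure_subset[of "fst p"] unfolding good_def by (intro exI[of _ f]) blast
  qed
  then obtain e where e: "\<And>p. p \<in> P \<Longrightarrow> good (e p) p" by metis
  show ?thesis
  proof (rule that[of "e ` P"])
    show "countable (e ` P)" using cP by simp
    show "e ` P \<subseteq> compactly_supported" using e by (auto simp: good_def compactly_supported_def)
    fix K U :: "'a set" assume KU: "compact K" "open U" "K \<subseteq> U"
    \<comment> \<open>Two finite unions of basic sets are inserted between \<open>K\<close> and \<open>U\<close>.\<close>
    obtain V1 where V1: "V1 \<in> O'" "K \<subseteq> V1" "compact (closure V1)" "closure V1 \<subseteq> U" using ins[OF KU] by blast
    obtain V2 where V2: "V2 \<in> O'" "closure V1 \<subseteq> V2" "closure V2 \<subseteq> U" using ins[OF V1(3) KU(2) V1(4)] by blast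
    have p: "(V1,V2) \<in> P" using V1 V2 by (auto simp: P_def)
    have "{x. e (V1,V2) x \<noteq> 0} \<subseteq> V2" using e[OF p] closure_subset[of "{x. e (V1,V2) x \<noteq> 0}"] unfolding good_def by auto
    then have "e (V1,V2) x = 0" if "x \<notin> U" for x using V2(3) closure_subset[of V2] that by blast
    moreover have "\<forall>x\<in>K. e (V1,V2) x = 1" using e[OF p] V1(2) by (auto simp: good_def)
    ultimately show "\<exists>e\<in>e ` P. (\<forall>x\<in>K. e x = 1) \<and> (\<forall>x. x \<notin> U \<longrightarrow> e x = 0)" using p by blast
  qed (use e in \<open>auto simp: good_def\<close>)
qed

lemma compactly_supported_closed_superset:
  fixes f :: "'a::t2_space \<Rightarrow> real"
  assumes "continuous_on UNIV f" "compact K" "\<And>x. x \<notin> K \<Longrightarrow> f x = 0"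
  shows "f \<in> compactly_supported"
proof -
  have "closure {x. f x \<noteq> 0} \<subseteq> K" using assms by (intro closure_minimal compact_imp_closed) auto
  then show ?thesis using assms(1,2) compact_Int_closed[of K "closure {x. f x \<noteq> 0}"]
    by (simp add: compactly_supported_def inf.absorb2)
qed

lemma compactly_supportedD:
  fixes f :: "'a::t2_space \<Rightarrow> real"
  assumes "f \<in> compactly_supported"
  shows "continuous_on UNIV f" "compact (closure {x. f x \<noteq> 0})" "x \<notin> closure {x. f x \<noteq> 0} \<Longrightarrow> f x = 0"
  using assms closure_subset[of "{x. f x \<noteq> 0}"] by (auto simp: compactly_supported_def)

lemma compactly_supported_bounded:
  fixes f :: "'a::t2_space \<Rightarrow> real"
  assumes "f \<in> compactly_supported"
  obtains B where "B > 0" "\<And>x. \<bar>f x\<bar> \<le> B"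
proof -
  let ?K = "closure {x. f x \<noteq> 0}"
  have "compact (f ` ?K)"
    by (rule compact_continuous_image[OF continuous_on_subset[OF compactly_supportedD(1)[OF assms] subset_UNIV] compactly_supportedD(2)[OF assms]])
  then obtain B where "\<And>y. y \<in> f ` ?K \<Longrightarrow> norm y \<le> B" using compact_imp_bounded[of "f ` ?K"] unfolding bounded_iff by blast
  then have B: "\<And>x. x \<in> ?K \<Longrightarrow> \<bar>f x\<bar> \<le> B" by force
  have "\<bar>f x\<bar> \<le> max 1 B" for x using B[of x] compactly_supportedD(3)[OF assms, of x] by (cases "x \<in> ?K") auto
  then show ?thesis using that[of "max 1 B"] by auto
qed

text \<open>A value \<open>c\<close> is recovered up to \<open>d\<close> by counting the levels \<open>k * d\<close> below it. The weights \<open>e k\<close> may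
be anything between 0 and 1 as long as they are 1 when \<open>c\<close> is above the next level and 0 when
\<open>c\<close> is below the level, which leaves at most one undecided layer. For a function \<open>c\<close> the
weights will be Urysohn functions.\<close>

lemma layer_cake_approx:
  fixes c d S :: real and e :: "nat \<Rightarrow> real"
  assumes e: "\<And>k. 0 \<le> e k" "\<And>k. e k \<le> 1" "\<And>k. (real k + 1) * d \<le> c \<Longrightarrow> e k = 1" "\<And>k. c \<le> real k * d \<Longrightarrow> e k = 0"
    and d: "d > 0" "c \<le> real n * d"
  shows "\<bar>max c 0 - d * (\<Sum>k<n. e k)\<bar> \<le> d" "c \<le> 0 \<Longrightarrow> (\<Sum>k<n. e k) = 0"
proof -
  define s where "s m = (\<Sum>k<m. e k)" for m
  have s_eq: "s m = real m" if "real m * d \<le> c" for m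
  proof -
    have "e k = 1" if "k < m" for k
    proof (rule e(3))
      have "(real k + 1) * d \<le> real m * d" using that d by (intro mult_right_mono) auto
      then show "(real k + 1) * d \<le> c" using \<open>real m * d \<le> c\<close> by simp
    qed
    then show ?thesis by (simp add: s_def)
  qed
  have s_le: "s m \<le> real m" for m using e(2) sum_mono[of "{..<m}" e "\<lambda>_. 1"] by (simp add: s_def)
  have up: "d * s m \<le> max c 0 + d" for m
  proof (induction m)
    case 0 then show ?case using d by (simp add: s_def)
  next
    case (Suc m)
    show ?case
    proof (cases "c \<le> real m * d")
      case True then show ?thesis using Suc e(4) by (simp add: s_def)
    next
      case False
      have "d * s (Suc m) \<le> d * real (Suc m)" using s_le[of "Suc m"] d by (intro mult_left_mono) auto
      then show ?thesis using False by (simp add: algebra_simps)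
    qed
  qed
  \<comment> \<open>The partial sums do not decrease, so the bound reached at the last full level persists.\<close>
  have lo: "min c (real m * d) - d \<le> d * s m" for m
  proof (induction m)
    case 0 then show ?case using d by (simp add: s_def)
  next
    case (Suc m)
    show ?case
    proof (cases "real (Suc m) * d \<le> c")
      case True then show ?thesis using s_eq[OF True] d by (simp add: algebra_simps)
    next
      case F: False
      have mono: "d * s m \<le> d * s (Suc m)" using d e(1) by (simp add: s_def)
      show ?thesis
      proof (cases "real m * d \<le> c")
        case True
        have "c < d * real m + d" using F by (simp add: algebra_simps)
        moreover have "d * real m \<le> d * s (Suc m)" using mono unfolding s_eq[OF True] .
        ultimately show ?thesis by linarith
      next
        case False
        then show ?thesis using Suc mono by linarith
      qed
    qed
  qed
  have z: "s n = 0" if "c \<le> 0"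
  proof -
    have "e k = 0" for k
    proof (rule e(4))
      have "0 \<le> real k * d" using d by simp
      then show "c \<le> real k * d" using that by linarith
    qed
    then show ?thesis by (simp add: s_def)
  qed
  then show "c \<le> 0 \<Longrightarrow> (\<Sum>k<n. e k) = 0" by (simp add: s_def)
  show "\<bar>max c 0 - d * (\<Sum>k<n. e k)\<bar> \<le> d"
    using up[of n] lo[of n] z d unfolding s_def[symmetric] by (cases "c \<le> 0") (auto simp: abs_le_iff)
qed

text \<open>Uniform approximation alone would not control integrals against measures of infinite mass.
The error is therefore dominated by a multiple of one function \<open>u\<close> that depends on \<open>c\<close> only,
so the integral of \<open>u\<close> bounds all errors at once. This is what reduces statements about
all compactly supported functions to countably many, both for the vague topology and for
generic points of the torus.\<close>

lemma compactly_supported_dense: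
  assumes lc: "locally_compact_space (euclidean :: ('a::{t2_space,second_countable_topology}) topology)"
  obtains D :: "(('a::{t2_space,second_countable_topology}) \<Rightarrow> real) set" where "countable D" "D \<subseteq> compactly_supported" "D \<noteq> {}"
    "\<And>c. c \<in> compactly_supported \<Longrightarrow> \<exists>u\<in>D. (\<forall>x. 0 \<le> u x) \<and> (\<forall>e>0. \<exists>d\<in>D. \<forall>x. \<bar>c x - d x\<bar> \<le> e * u x)"
proof -
  obtain E :: "('a \<Rightarrow> real) set" where E: "countable E"
    "\<And>e x. e \<in> E \<Longrightarrow> 0 \<le> e x" "\<And>e x. e \<in> E \<Longrightarrow> e x \<le> 1" "E \<subseteq> compactly_supported"
    "\<And>K U. compact K \<Longrightarrow> open U \<Longrightarrow> K \<subseteq> U \<Longrightarrow> \<exists>e\<in>E. (\<forall>x\<in>K. e x = 1) \<and> (\<forall>x. x \<notin> U \<longrightarrow> e x = 0)"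
    using countable_urysohn_family[OF lc] by blast
  \<comment> \<open>Finite sums of Urysohn functions with one rational factor, one sum for each of the positive
    and the negative part.\<close>
  define mk where "mk = (\<lambda>(r::real, l1, l2) (x::'a). r * (\<Sum>e\<leftarrow>l1. e x) - r * (\<Sum>e\<leftarrow>l2. e x))"
  define D where "D = mk ` (\<rat> \<times> lists E \<times> lists E)"
  have layers: "\<exists>l\<in>lists E. \<forall>x. \<bar>max (c x) 0 - d * (\<Sum>e\<leftarrow>l. e x)\<bar> \<le> d \<and> (c x \<le> 0 \<longrightarrow> (\<Sum>e\<leftarrow>l. e x) = 0)"
    if c: "c \<in> compactly_supported" and d: "d > 0" for c :: "'a \<Rightarrow> real" and d :: real
  proof -
    let ?K = "closure {x. c x \<noteq> 0}"
    have ct: "continuous_on UNIV c" using c by (simp add: compactly_supported_def)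
    have "\<exists>e\<in>E. (\<forall>x\<in>{x. (real k + 1) * d \<le> c x}. e x = 1) \<and> (\<forall>x. x \<notin> {x. real k * d < c x} \<longrightarrow> e x = 0)" for k
    proof (rule E(5))
      have cl: "closed {x. (real k + 1) * d \<le> c x}" using ct by (intro closed_Collect_le continuous_on_const)
      have "0 < (real k + 1) * d" using d by (simp add: add_nonneg_pos)
      then have "{x. (real k + 1) * d \<le> c x} \<subseteq> ?K" using closure_subset[of "{x. c x \<noteq> 0}"] by force
      then show "compact {x. (real k + 1) * d \<le> c x}"
        using compactly_supportedD(2)[OF c] cl compact_Int_closed[of ?K "{x. (real k + 1) * d \<le> c x}"] by (simp add: inf.absorb2)
      show "open {x. real k * d < c x}" using ct by (intro open_Collect_less continuous_on_const)
      show "{x. (real k + 1) * d \<le> c x} \<subseteq> {x. real k * d < c x}" using d by (auto simp: algebra_simps)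
    qed
    then obtain e where e: "\<And>k. e k \<in> E" "\<And>k x. (real k + 1) * d \<le> c x \<Longrightarrow> e k x = 1" "\<And>k x. c x \<le> real k * d \<Longrightarrow> e k x = 0"
      by (simp add: not_less) metis
    obtain B where B: "\<And>x. \<bar>c x\<bar> \<le> B" using compactly_supported_bounded[OF c] by blast
    obtain n where n: "B / d \<le> real n" using real_arch_simple by blast
    have n': "c x \<le> real n * d" for x using B[of x] n d by (simp add: pos_divide_le_eq)
    have "\<bar>max (c x) 0 - d * (\<Sum>e\<leftarrow>map e [0..<n]. e x)\<bar> \<le> d \<and> (c x \<le> 0 \<longrightarrow> (\<Sum>e\<leftarrow>map e [0..<n]. e x) = 0)" for x
    proof -
      have sum: "(\<Sum>e\<leftarrow>map e [0..<n]. e x) = (\<Sum>k<n. e k x)"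
        by (simp add: comp_def interv_sum_list_conv_sum_set_nat atLeast0LessThan)
      show ?thesis unfolding sum
        using layer_cake_approx[of "\<lambda>k. e k x" d "c x" n, OF E(2)[OF e(1)] E(3)[OF e(1)] e(2) e(3) d n'[of x]]
        by blast
    qed
    moreover have "map e [0..<n] \<in> lists E" using e(1) by auto
    ultimately show ?thesis by blast
  qed
  have 0: "[] \<in> lists E" by simp
  show ?thesis
  proof (rule that[of D])
    show "countable D" unfolding D_def using E(1) by (intro countable_image countable_SIGMA countable_rat countable_lists)
    show "D \<noteq> {}" unfolding D_def using Rats_0 by auto
    have sl: "(\<lambda>x. \<Sum>e\<leftarrow>l. e x) \<in> compactly_supported" if "l \<in> lists E" for l
      using that
    proof induction
      case Nil then show ?case by (simp add: compactly_supported_def continuous_on_const)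
    next
      case (Cons a l)
      have a: "a \<in> compactly_supported" using Cons E(4) by auto
      note ca = compactly_supportedD[OF a] and cl = compactly_supportedD[OF Cons.IH]
      show ?case
      proof (rule compactly_supported_closed_superset[OF _ compact_Un[OF ca(2) cl(2)]])
        show "continuous_on UNIV (\<lambda>x. \<Sum>e\<leftarrow>a # l. e x)" using continuous_on_add[OF ca(1) cl(1)] by simp
        show "(\<Sum>e\<leftarrow>a # l. e x) = 0" if "x \<notin> closure {x. a x \<noteq> 0} \<union> closure {x. (\<Sum>e\<leftarrow>l. e x) \<noteq> 0}" for x
          using ca(3)[of x] cl(3)[of x] that by simp
      qed
    qed
    show "D \<subseteq> compactly_supported"
    proof
      fix f assume "f \<in> D"
      then obtain r l1 l2 where f: "f = (\<lambda>x. r * (\<Sum>e\<leftarrow>l1. e x) - r * (\<Sum>e\<leftarrow>l2. e x))" and l: "l1 \<in> lists E" "l2 \<in> lists E"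
        by (auto simp: D_def mk_def)
      note c1 = compactly_supportedD[OF sl[OF l(1)]] and c2 = compactly_supportedD[OF sl[OF l(2)]]
      show "f \<in> compactly_supported" unfolding f
      proof (rule compactly_supported_closed_superset[OF _ compact_Un[OF c1(2) c2(2)]])
        show "continuous_on UNIV (\<lambda>x. r * (\<Sum>e\<leftarrow>l1. e x) - r * (\<Sum>e\<leftarrow>l2. e x))"
          by (rule continuous_on_diff[OF continuous_on_mult_left[OF c1(1)] continuous_on_mult_left[OF c2(1)]])
        show "r * (\<Sum>e\<leftarrow>l1. e x) - r * (\<Sum>e\<leftarrow>l2. e x) = 0"
          if "x \<notin> closure {x. (\<Sum>e\<leftarrow>l1. e x) \<noteq> 0} \<union> closure {x. (\<Sum>e\<leftarrow>l2. e x) \<noteq> 0}" for x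
          using c1(3)[of x] c2(3)[of x] that by simp
      qed
    qed
    fix c :: "'a \<Rightarrow> real" assume c: "c \<in> compactly_supported"
    let ?K = "closure {x. c x \<noteq> 0}"
    \<comment> \<open>The dominating function is 1 on the support of \<open>c\<close>.\<close>
    obtain u where u: "u \<in> E" "\<forall>x\<in>?K. u x = 1"
      using E(5)[OF compactly_supportedD(2)[OF c] open_UNIV subset_UNIV] by blast
    have "mk (1, [u], []) \<in> D" unfolding D_def using u by (intro imageI) auto
    then have uD: "u \<in> D" by (simp add: mk_def)
    have c': "(\<lambda>x. - c x) \<in> compactly_supported" using c by (auto simp: compactly_supported_def intro: continuous_intros)
    have "\<exists>d\<in>D. \<forall>x. \<bar>c x - d x\<bar> \<le> e * u x" if "e > 0" for e
    proof -
      obtain r where r: "r \<in> \<rat>" "0 < r" "r < e" using Rats_dense_in_real[OF \<open>e > 0\<close>] by blast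
      obtain l1 where l1: "l1 \<in> lists E" "\<And>x. \<bar>max (c x) 0 - r * (\<Sum>e\<leftarrow>l1. e x)\<bar> \<le> r" "\<And>x. c x \<le> 0 \<Longrightarrow> (\<Sum>e\<leftarrow>l1. e x) = 0"
        using layers[OF c r(2)] by blast
      obtain l2 where l2: "l2 \<in> lists E" "\<And>x. \<bar>max (- c x) 0 - r * (\<Sum>e\<leftarrow>l2. e x)\<bar> \<le> r" "\<And>x. - c x \<le> 0 \<Longrightarrow> (\<Sum>e\<leftarrow>l2. e x) = 0"
        using layers[OF c' r(2)] by blast
      have "\<bar>c x - mk (r, l1, l2) x\<bar> \<le> e * u x" for x
      proof (cases "c x = 0")
        case True
        then show ?thesis using l1(3)[of x] l2(3)[of x] that E(2)[OF u(1)] by (simp add: mk_def)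
      next
        case False
        then have "u x = 1" using u(2) closure_subset[of "{x. c x \<noteq> 0}"] by blast
        then show ?thesis using l1(2)[of x] l2(2)[of x] l1(3)[of x] l2(3)[of x] r False
          by (cases "c x > 0") (auto simp: mk_def abs_le_iff)
      qed
      moreover have "mk (r, l1, l2) \<in> D" unfolding D_def using r l1(1) l2(1) by (intro imageI) auto
      ultimately show ?thesis by blast
    qed
    then show "\<exists>u\<in>D. (\<forall>x. 0 \<le> u x) \<and> (\<forall>e>0. \<exists>d\<in>D. \<forall>x. \<bar>c x - d x\<bar> \<le> e * u x)"
      using uD E(2)[OF u(1)] by blast
  qed
qed

section \<open>Borel sets and the vague topology\<close>

lemma space_borel_of [simp]: "space (borel_of T) = topspace T"
  unfolding borel_of_def by (rule space_measure_of) (auto dest: openin_subset)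

lemma sets_borel_of: "sets (borel_of T) = sigma_sets (topspace T) {U. openin T U}"
  unfolding borel_of_def by (rule sets_measure_of) (auto dest: openin_subset)

lemma openin_borel_of: "openin T U \<Longrightarrow> U \<in> sets (borel_of T)"
  by (auto simp: sets_borel_of)

lemma closedin_borel_of: "closedin T C \<Longrightarrow> C \<in> sets (borel_of T)"
  using sets.Diff[OF sets.top openin_borel_of[of T "topspace T - C"]] closedin_subset[of T C]
  by (simp add: closedin_def double_diff)

lemma measurable_borel_of:
  assumes "f \<in> space M \<rightarrow> topspace T" "\<And>U. openin T U \<Longrightarrow> f -` U \<inter> space M \<in> sets M"
  shows "f \<in> M \<rightarrow>\<^sub>M borel_of T"
  unfolding borel_of_def
  by (rule measurable_measure_of) (use assms in \<open>auto dest: openin_subset\<close>)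

lemma continuous_map_measurable:
  assumes "continuous_map S T f" "sets M = sets (borel_of S)"
  shows "f \<in> M \<rightarrow>\<^sub>M borel_of T"
proof (rule measurable_borel_of)
  have sp: "space M = topspace S" using sets_eq_imp_space_eq[OF assms(2)] by simp
  show "f \<in> space M \<rightarrow> topspace T" using assms(1) sp by (auto simp: continuous_map_def)
  fix U assume "openin T U"
  then have "openin S {x \<in> topspace S. f x \<in> U}" using assms(1) by (simp add: continuous_map_def)
  moreover have "{x \<in> topspace S. f x \<in> U} = f -` U \<inter> space M" using sp by auto
  ultimately show "f -` U \<inter> space M \<in> sets M" using openin_borel_of assms(2) by simp
qed

lemma regular_sets: "regular_borel_measure euclidean m \<Longrightarrow> sets m = sets borel"
  by (simp add: regular_borel_measure_def borel_of_euclidean)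

lemma regular_finite: "regular_borel_measure euclidean m \<Longrightarrow> compact K \<Longrightarrow> emeasure m K < \<infinity>"
  unfolding regular_borel_measure_def compactin_euclidean_iff by blast

lemma regular_outer: "regular_borel_measure euclidean m \<Longrightarrow> A \<in> sets borel \<Longrightarrow> emeasure m A = (INF U\<in>{U. open U \<and> A \<subseteq> U}. emeasure m U)"
  unfolding regular_borel_measure_def borel_of_euclidean open_openin[symmetric] by blast

lemma regular_inner: "regular_borel_measure euclidean m \<Longrightarrow> open U \<Longrightarrow> emeasure m U = (SUP K\<in>{K. compact K \<and> K \<subseteq> U}. emeasure m K)"
  unfolding regular_borel_measure_def compactin_euclidean_iff open_openin[symmetric] by blast

text \<open>The integrals that define the vague topology are therefore not default values.\<close>

lemma regular_integrable:
  fixes c :: "'a::t2_space \<Rightarrow> real"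
  assumes m: "regular_borel_measure euclidean m" and c: "c \<in> compactly_supported"
  shows "integrable m c"
proof -
  let ?K = "closure {x. c x \<noteq> 0}"
  note c' = compactly_supportedD[OF c]
  obtain B where B: "B > 0" "\<And>x. \<bar>c x\<bar> \<le> B" using compactly_supported_bounded[OF c] by blast
  have cm: "c \<in> borel_measurable m"
    using borel_measurable_continuous_onI[OF c'(1)] measurable_cong_sets[OF regular_sets[OF m] refl] by blast
  have K: "?K \<in> sets m" unfolding regular_sets[OF m] by (rule borel_closed) (rule closed_closure)
  show ?thesis
  proof (rule integrableI_bounded_set[OF K cm regular_finite[OF m c'(2)]])
    show "AE x\<in>?K in m. norm (c x) \<le> B" using B(2) by (intro always_eventually) simp
    show "AE x in m. x \<notin> ?K \<longrightarrow> c x = 0" using c'(3) by (intro always_eventually allI impI)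
  qed
qed

lemma topspace_vague: "topspace vague_topology = {m. regular_borel_measure euclidean m}"
proof -
  have 0: "(\<lambda>_. 0) \<in> compactly_supported" by (simp add: compactly_supported_def)
  let ?S = "\<lambda>(\<phi> :: 'a \<Rightarrow> real) U. {m :: 'a measure. regular_borel_measure euclidean m \<and> (\<integral>x. \<phi> x \<partial>m) \<in> U}"
  have top: "topspace vague_topology = \<Union> {?S \<phi> U | \<phi> U. \<phi> \<in> compactly_supported \<and> open U}"
    unfolding vague_topology_def by (rule topology_generated_by_topspace)
  have "?S (\<lambda>_. 0) UNIV \<in> {?S \<phi> U | \<phi> U. \<phi> \<in> compactly_supported \<and> open U}"
    by (intro CollectI exI[of _ "\<lambda>_. 0"] exI[of _ UNIV] conjI refl 0 open_UNIV)
  then have "?S (\<lambda>_. 0) UNIV \<subseteq> topspace vague_topology" unfolding top by (rule Union_upper)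
  moreover have "topspace vague_topology \<subseteq> {m :: 'a measure. regular_borel_measure euclidean m}"
    unfolding top by (rule Union_least) (elim CollectE exE conjE, simp add: subset_iff)
  ultimately show ?thesis by (intro equalityI) simp_all
qed

lemma continuous_map_vague_integral:
  assumes c: "c \<in> compactly_supported"
  shows "continuous_map vague_topology euclideanreal (\<lambda>m. \<integral>x. c x \<partial>m)"
proof -
  have "openin vague_topology {m \<in> topspace vague_topology. (\<integral>x. c x \<partial>m) \<in> U}" if "open U" for U
  proof -
    have "{m \<in> topspace vague_topology. (\<integral>x. c x \<partial>m) \<in> U} =
      {m. regular_borel_measure euclidean m \<and> (\<integral>x. c x \<partial>m) \<in> U}" unfolding topspace_vague by simp
    moreover have "\<dots> \<in> {{m. regular_borel_measure euclidean m \<and> (\<integral>x. \<phi> x \<partial>m) \<in> U} | \<phi> U.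
          \<phi> \<in> compactly_supported \<and> open U}" using c that by blast
    ultimately show ?thesis unfolding vague_topology_def by (simp only: topology_generated_by_Basis)
  qed
  then show ?thesis by (simp add: continuous_map_def)
qed

lemma continuous_map_into_vague:
  fixes f :: "'a \<Rightarrow> 'b::topological_space measure"
  assumes "\<And>x. x \<in> topspace T \<Longrightarrow> regular_borel_measure euclidean (f x)"
    and "\<And>c. c \<in> compactly_supported \<Longrightarrow> continuous_map T euclideanreal (\<lambda>x. \<integral>y. c y \<partial>f x)"
  shows "continuous_map T vague_topology f"
  unfolding vague_topology_def
proof (rule continuous_on_generated_topo)
  show "f ` topspace T \<subseteq> \<Union> {{m. regular_borel_measure euclidean m \<and> (\<integral>x. \<phi> x \<partial>m) \<in> U} | \<phi> U.
          \<phi> \<in> compactly_supported \<and> open U}"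
    using assms(1) unfolding topology_generated_by_topspace[symmetric] vague_topology_def[symmetric] topspace_vague by blast
  fix V :: "'b measure set" assume "V \<in> {{m. regular_borel_measure euclidean m \<and> (\<integral>x. \<phi> x \<partial>m) \<in> U} | \<phi> U.
          \<phi> \<in> compactly_supported \<and> open U}"
  then obtain \<phi> U where V: "V = {m. regular_borel_measure euclidean m \<and> (\<integral>x. \<phi> x \<partial>m) \<in> U}" "\<phi> \<in> compactly_supported" "open U"
    by blast
  have "f -` V \<inter> topspace T = {x \<in> topspace T. (\<integral>y. \<phi> y \<partial>f x) \<in> U}" using assms(1) V(1) by blast
  then show "openin T (f -` V \<inter> topspace T)"
    using assms(2)[OF V(2)] V(3) by (simp add: continuous_map_def)
qed

definition vague_base_set :: "(('a::topological_space \<Rightarrow> real) \<times> rat \<times> rat) \<Rightarrow> 'a measure set" where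
  "vague_base_set = (\<lambda>(d, a, b). {m. regular_borel_measure euclidean m \<and> of_rat a < (\<integral>x. d x \<partial>m) \<and> (\<integral>x. d x \<partial>m) < of_rat b})"

text \<open>Finite intersections of sets \<open>vague_base_set\<close> with functions from a countable family form
a base: to control the integral of \<open>c\<close> near a measure it suffices to control those of an
approximation \<open>d\<close> and of the function \<open>u\<close> that dominates the error.\<close>

lemma vague_countable_base:
  assumes lc: "locally_compact_space (euclidean :: ('a::{t2_space,second_countable_topology}) topology)"
  obtains D :: "(('a::{t2_space,second_countable_topology}) \<Rightarrow> real) set" where "countable D" "D \<subseteq> compactly_supported"
    "\<forall>U m. openin vague_topology U \<and> m \<in> U \<longrightarrow>
       (\<exists>F. finite F \<and> F \<subseteq> D \<times> UNIV \<times> UNIV \<and> (\<forall>p\<in>F. m \<in> vague_base_set p) \<and> {m. regular_borel_measure euclidean m} \<inter> (\<Inter>p\<in>F. vague_base_set p) \<subseteq> U)"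
proof -
  obtain D :: "('a \<Rightarrow> real) set" where D: "countable D" "D \<subseteq> compactly_supported" "D \<noteq> {}"
    "\<And>c. c \<in> compactly_supported \<Longrightarrow> \<exists>u\<in>D. (\<forall>x. 0 \<le> u x) \<and> (\<forall>e>0. \<exists>d\<in>D. \<forall>x. \<bar>c x - d x\<bar> \<le> e * u x)"
    using compactly_supported_dense[OF lc] by blast
  let ?R = "{m :: 'a measure. regular_borel_measure euclidean m}"
  let ?P = "\<lambda>U m F. finite F \<and> F \<subseteq> D \<times> UNIV \<times> UNIV \<and> (\<forall>p\<in>F. m \<in> vague_base_set p) \<and> ?R \<inter> (\<Inter>p\<in>F. vague_base_set p) \<subseteq> U"
  have "\<forall>m\<in>U. \<exists>F. ?P U m F" if "openin vague_topology U" for U :: "'a measure set"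
    using openin_topology_generated_by[OF that[unfolded vague_topology_def]]
  proof (induction rule: generate_topology_on.induct)
    case Empty then show ?case by simp
  next
    case (Int a b)
    show ?case
    proof
      fix m assume m: "m \<in> a \<inter> b"
      have "\<exists>F. ?P a m F" by (rule bspec[OF Int.IH(1)]) (use m in simp)
      then obtain F where F: "?P a m F" by (elim exE)
      have "\<exists>F. ?P b m F" by (rule bspec[OF Int.IH(2)]) (use m in simp)
      then obtain G where G: "?P b m G" by (elim exE)
      have "?R \<inter> (\<Inter>p\<in>F \<union> G. vague_base_set p) \<subseteq> ?R \<inter> (\<Inter>p\<in>F. vague_base_set p)"
           "?R \<inter> (\<Inter>p\<in>F \<union> G. vague_base_set p) \<subseteq> ?R \<inter> (\<Inter>p\<in>G. vague_base_set p)"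
        unfolding INT_Un by (simp_all add: le_infI2)
      then have "?R \<inter> (\<Inter>p\<in>F \<union> G. vague_base_set p) \<subseteq> a \<inter> b" using F G by (meson Int_greatest subset_trans)
      then have "?P (a \<inter> b) m (F \<union> G)" using F G by (simp add: ball_Un)
      then show "\<exists>F. ?P (a \<inter> b) m F" by (rule exI)
    qed
  next
    case (UN K)
    show ?case
    proof
      fix m assume "m \<in> \<Union>K"
      then obtain k where k: "k \<in> K" "m \<in> k" by (elim UnionE)
      have "\<exists>F. ?P k m F" by (rule bspec[OF UN.IH[OF k(1)] k(2)])
      then obtain F where F: "?P k m F" by (elim exE)
      have "k \<subseteq> \<Union>K" using k(1) by (rule Union_upper)
      then have "?P (\<Union>K) m F" using F by (meson subset_trans)
      then show "\<exists>F. ?P (\<Union>K) m F" by (rule exI)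
    qed
  next
    case (Basis s)
    then obtain c V where c: "c \<in> compactly_supported" and V: "open V"
      and s: "s = {m. regular_borel_measure euclidean m \<and> (\<integral>x. c x \<partial>m) \<in> V}" by blast
    show ?case
    proof
      fix m0 assume m0: "m0 \<in> s"
      then have r0: "regular_borel_measure euclidean m0" and "(\<integral>x. c x \<partial>m0) \<in> V" using s by auto
      then obtain h where h: "h > 0" "\<And>y. \<bar>y - (\<integral>x. c x \<partial>m0)\<bar> < h \<Longrightarrow> y \<in> V"
        using V unfolding open_dist dist_real_def by blast
      obtain u where u: "u \<in> D" "\<And>x. 0 \<le> u x" and ud: "\<And>e. e > 0 \<Longrightarrow> \<exists>d\<in>D. \<forall>x. \<bar>c x - d x\<bar> \<le> e * u x"
        using D(4)[OF c] by blast
      define C where "C = (\<integral>x. u x \<partial>m0)"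
      have C0: "C \<ge> 0" unfolding C_def using u(2) by simp
      \<comment> \<open>The bound \<open>b1\<close> keeps the integral of \<open>u\<close> below \<open>C + 1\<close> near \<open>m0\<close>; hence replacing \<open>c\<close> by \<open>d\<close>
        costs at most \<open>h / 4\<close> at \<open>m0\<close> and at every measure near it.\<close>
      define e where "e = h / 4 / (C + 1)"
      have e: "e > 0" unfolding e_def using h(1) C0 by (intro divide_pos_pos) linarith+
      obtain d where d: "d \<in> D" "\<And>x. \<bar>c x - d x\<bar> \<le> e * u x" using ud[OF e] by blast
      define I where "I = (\<integral>x. d x \<partial>m0)"
      obtain b1 where b1: "C < of_rat b1" "of_rat b1 < C + 1" using of_rat_dense[of C "C + 1"] by auto
      obtain a1 where a1: "C - 1 < of_rat a1" "of_rat a1 < C" using of_rat_dense[of "C - 1" C] by auto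
      obtain b2 where b2: "I < of_rat b2" "of_rat b2 < I + h/4" using of_rat_dense[of I "I + h/4"] h(1) by auto
      obtain a2 where a2: "I - h/4 < of_rat a2" "of_rat a2 < I" using of_rat_dense[of "I - h/4" I] h(1) by auto
      let ?F = "{(u, a1, b1), (d, a2, b2)}"
      have uC: "u \<in> compactly_supported" and dC: "d \<in> compactly_supported" using u(1) d(1) D(2) by auto
      have close: "\<bar>(\<integral>x. c x \<partial>m) - (\<integral>x. d x \<partial>m)\<bar> \<le> e * (\<integral>x. u x \<partial>m)" if m: "regular_borel_measure euclidean m" for m
      proof -
        note ii = regular_integrable[OF m c] regular_integrable[OF m dC] regular_integrable[OF m uC]
        have "\<bar>(\<integral>x. c x \<partial>m) - (\<integral>x. d x \<partial>m)\<bar> = \<bar>\<integral>x. c x - d x \<partial>m\<bar>" using ii by simp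
        also have "\<dots> \<le> (\<integral>x. \<bar>c x - d x\<bar> \<partial>m)" by (rule integral_abs_bound)
        also have "\<dots> \<le> (\<integral>x. e * u x \<partial>m)" using ii d(2) by (intro integral_mono) auto
        finally show ?thesis by simp
      qed
      have "C + 1 \<noteq> 0" using C0 by linarith
      then have eC: "e * (C + 1) = h / 4" by (rule nonzero_eq_divide_eq[THEN iffD1, OF _ e_def])
      have eC': "e * C \<le> h / 4" using eC e by (simp add: algebra_simps)
      have "m \<in> s" if m: "regular_borel_measure euclidean m" "m \<in> vague_base_set (u, a1, b1)" "m \<in> vague_base_set (d, a2, b2)" for m
      proof -
        have 1: "(\<integral>x. u x \<partial>m) < C + 1" using m(2) b1 by (simp add: vague_base_set_def)
        have 2: "I - h/4 < (\<integral>x. d x \<partial>m)" "(\<integral>x. d x \<partial>m) < I + h/4" using m(3) a2 b2 by (auto simp: vague_base_set_def)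
        have 3: "e * (\<integral>x. u x \<partial>m) \<le> h / 4" unfolding eC[symmetric] using 1 e by simp
        have "\<bar>(\<integral>x. c x \<partial>m) - (\<integral>x. c x \<partial>m0)\<bar> < h"
          using close[OF m(1)] close[OF r0] 2 3 eC' h(1) unfolding C_def[symmetric] I_def[symmetric] by linarith
        then show ?thesis using h(2) m(1) s by blast
      qed
      moreover have "m0 \<in> vague_base_set (u, a1, b1)" "m0 \<in> vague_base_set (d, a2, b2)"
        using r0 a1 b1 a2 b2 by (auto simp: vague_base_set_def C_def I_def)
      ultimately have "?R \<inter> (\<Inter>p\<in>?F. vague_base_set p) \<subseteq> s" "\<forall>p\<in>?F. m0 \<in> vague_base_set p" by auto
      moreover have "finite ?F" "?F \<subseteq> D \<times> UNIV \<times> UNIV" using u(1) d(1) by simp_all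
      ultimately have "?P s m0 ?F" by (intro conjI)
      then show "\<exists>F. ?P s m0 F" by (rule exI)
    qed
  qed
  note base = this
  show ?thesis
  proof (rule that[OF D(1,2)], intro allI impI)
    fix U and m :: "'a measure" assume a: "openin vague_topology U \<and> m \<in> U"
    show "\<exists>F. ?P U m F" by (rule bspec[OF base[OF conjunct1[OF a]] conjunct2[OF a]])
  qed
qed

text \<open>The countable base is what makes this work: an open set is a countable union of
sets given by finitely many integrals.\<close>

lemma measurable_vague:
  fixes f :: "'b \<Rightarrow> ('a::{t2_space,second_countable_topology}) measure"
  assumes lc: "locally_compact_space (euclidean :: 'a topology)"
    and f: "\<And>x. x \<in> space M \<Longrightarrow> regular_borel_measure euclidean (f x)"
    and m: "\<And>c. c \<in> compactly_supported \<Longrightarrow> (\<lambda>x. \<integral>y. c y \<partial>f x) \<in> borel_measurable M"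
  shows "f \<in> M \<rightarrow>\<^sub>M borel_of vague_topology"
proof (rule measurable_borel_of)
  show "f \<in> space M \<rightarrow> topspace vague_topology" using f by (auto simp: topspace_vague)
  fix U :: "'a measure set" assume U: "openin vague_topology U"
  obtain D :: "('a \<Rightarrow> real) set" where D: "countable D" "D \<subseteq> compactly_supported"
    "\<forall>U m. openin vague_topology U \<and> m \<in> U \<longrightarrow>
       (\<exists>F. finite F \<and> F \<subseteq> D \<times> UNIV \<times> UNIV \<and> (\<forall>p\<in>F. m \<in> vague_base_set p) \<and> {m. regular_borel_measure euclidean m} \<inter> (\<Inter>p\<in>F. vague_base_set p) \<subseteq> U)"
    by (rule vague_countable_base[OF lc])
  let ?R = "{m :: 'a measure. regular_borel_measure euclidean m}"
  define \<F> where "\<F> = {F. (finite F \<and> F \<subseteq> D \<times> (UNIV :: rat set) \<times> (UNIV :: rat set)) \<and> ?R \<inter> (\<Inter>p\<in>F. vague_base_set p) \<subseteq> U}"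
  have "countable {F. finite F \<and> F \<subseteq> D \<times> (UNIV :: rat set) \<times> (UNIV :: rat set)}"
    using D(1) by (intro countable_Collect_finite_subset countable_SIGMA) auto
  then have cF: "countable \<F>" by (rule countable_subset[rotated]) (auto simp: \<F>_def)
  have Us: "U \<subseteq> ?R" using openin_subset[OF U] by (simp add: topspace_vague)
  have UF: "U = (\<Union>F\<in>\<F>. ?R \<inter> (\<Inter>p\<in>F. vague_base_set p))"
  proof
    show "U \<subseteq> (\<Union>F\<in>\<F>. ?R \<inter> (\<Inter>p\<in>F. vague_base_set p))"
    proof
      fix m assume m: "m \<in> U"
      then obtain F where "finite F \<and> F \<subseteq> D \<times> UNIV \<times> UNIV \<and> (\<forall>p\<in>F. m \<in> vague_base_set p) \<and> ?R \<inter> (\<Inter>p\<in>F. vague_base_set p) \<subseteq> U"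
        using D(3)[rule_format, OF conjI[OF U m]] by (elim exE)
      then have "F \<in> \<F>" "m \<in> (\<Inter>p\<in>F. vague_base_set p)" unfolding \<F>_def by simp_all
      then show "m \<in> (\<Union>F\<in>\<F>. ?R \<inter> (\<Inter>p\<in>F. vague_base_set p))" using m Us by blast
    qed
  qed (auto simp: \<F>_def)
  have base: "{x\<in>space M. f x \<in> vague_base_set p} \<in> sets M" if "p \<in> D \<times> UNIV \<times> UNIV" for p
  proof -
    obtain d a b where p: "p = (d, a, b)" by (cases p)
    have [measurable]: "(\<lambda>x. \<integral>y. d y \<partial>f x) \<in> borel_measurable M" using m that p D(2) by auto
    have "{x\<in>space M. f x \<in> vague_base_set p} = {x\<in>space M. of_rat a < (\<integral>y. d y \<partial>f x) \<and> (\<integral>y. d y \<partial>f x) < of_rat b}"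
      using f by (auto simp: vague_base_set_def p)
    then show ?thesis by simp
  qed
  have "f -` U \<inter> space M = (\<Union>F\<in>\<F>. {x\<in>space M. \<forall>p\<in>F. f x \<in> vague_base_set p})"
    using f by (subst UF) auto
  moreover have "{x\<in>space M. \<forall>p\<in>F. f x \<in> vague_base_set p} \<in> sets M" if "F \<in> \<F>" for F
    using that base by (intro sets.sets_Collect_finite_All) (auto simp: \<F>_def)
  ultimately show "f -` U \<inter> space M \<in> sets M" by (simp only:) (intro sets.countable_UN'[OF cF] image_subsetI)
qed

text \<open>Urysohn functions squeezed between a compact set and an open set compare the measures on
open sets, by inner regularity; open sets generate.\<close>

lemma regular_measure_eqI:
  fixes m m' :: "('a::{t2_space,second_countable_topology}) measure"
  assumes lc: "locally_compact_space (euclidean :: 'a topology)"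
    and m: "regular_borel_measure euclidean m" and m': "regular_borel_measure euclidean m'"
    and eq: "\<And>c. c \<in> compactly_supported \<Longrightarrow> (\<integral>x. c x \<partial>m) = (\<integral>x. c x \<partial>m')"
  shows "m = m'"
proof -
  have le: "emeasure m U \<le> emeasure m' U" if U: "open U"
    and m: "regular_borel_measure euclidean m" and m': "regular_borel_measure euclidean m'"
    and eq: "\<And>c. c \<in> compactly_supported \<Longrightarrow> (\<integral>x. c x \<partial>m) = (\<integral>x. c x \<partial>m')" for U and m m' :: "'a measure"
  proof -
    have "emeasure m K \<le> emeasure m' U" if K: "compact K" "K \<subseteq> U" for K
    proof -
      obtain f :: "'a \<Rightarrow> real" where f: "continuous_on UNIV f" "\<And>x. 0 \<le> f x" "\<And>x. f x \<le> 1"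
        "\<And>x. x \<in> K \<Longrightarrow> f x = 1" "compact (closure {x. f x \<noteq> 0})" "closure {x. f x \<noteq> 0} \<subseteq> U"
        using lc_Urysohn[OF lc U K] by blast
      have fc: "f \<in> compactly_supported" using f by (simp add: compactly_supported_def)
      note [measurable_cong] = regular_sets[OF m] regular_sets[OF m']
      have Km: "K \<in> sets m" "U \<in> sets m'" using borel_closed[OF compact_imp_closed[OF K(1)]] U by (simp_all add: regular_sets[OF m] regular_sets[OF m'])
      have f0: "f x = 0" if "x \<notin> U" for x using that f(6) closure_subset[of "{x. f x \<noteq> 0}"] by blast
      have "emeasure m K = (\<integral>\<^sup>+x. indicator K x \<partial>m)" using Km by simp
      also have "\<dots> \<le> (\<integral>\<^sup>+x. ennreal (f x) \<partial>m)" using f(4) by (intro nn_integral_mono) (simp add: indicator_def)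
      also have "\<dots> = ennreal (\<integral>x. f x \<partial>m)" using f(2) by (intro nn_integral_eq_integral regular_integrable[OF m fc]) simp
      also have "\<dots> = ennreal (\<integral>x. f x \<partial>m')" using eq[OF fc] by simp
      also have "\<dots> = (\<integral>\<^sup>+x. ennreal (f x) \<partial>m')" using f(2) by (intro nn_integral_eq_integral[symmetric] regular_integrable[OF m' fc]) simp
      also have "\<dots> \<le> (\<integral>\<^sup>+x. indicator U x \<partial>m')" using f(3) f0 by (intro nn_integral_mono) (simp add: indicator_def)
      also have "\<dots> = emeasure m' U" using Km by simp
      finally show ?thesis .
    qed
    moreover have "emeasure m U = (SUP K\<in>{K. compactin euclidean K \<and> K \<subseteq> U}. emeasure m K)"
      unfolding compactin_euclidean_iff by (rule regular_inner[OF m U])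
    ultimately show ?thesis by (auto intro!: SUP_least)
  qed
  obtain Q :: "nat \<Rightarrow> 'a set" where Q: "\<And>n. open (Q n)" "\<And>n. compact (closure (Q n))" "incseq Q"
    "\<And>K. compact K \<Longrightarrow> \<exists>n. K \<subseteq> Q n"
    using lc_exhaustion[OF lc] by blast
  show ?thesis
  proof (rule measure_eqI_generator_eq[where E="{U. open U}" and \<Omega>=UNIV and A=Q])
    show "Int_stable {U :: 'a set. open U}" by (auto simp: Int_stable_def)
    show "emeasure m X = emeasure m' X" if "X \<in> {U. open U}" for X
      using le[OF _ m m' eq] le[OF _ m' m eq[symmetric]] that by (intro antisym) auto
    show "sets m = sigma_sets UNIV {U. open U}" "sets m' = sigma_sets UNIV {U. open U}"
      using regular_sets[OF m] regular_sets[OF m'] by (simp_all add: borel_def)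
    show "range Q \<subseteq> {U. open U}" using Q(1) by blast
    show "(\<Union>i. Q i) = UNIV"
    proof -
      have "\<exists>n. x \<in> Q n" for x using Q(4)[of "{x}"] by simp
      then show ?thesis by blast
    qed
    show "emeasure m (Q i) \<noteq> \<infinity>" for i
    proof -
      have "emeasure m (Q i) \<le> emeasure m (closure (Q i))"
        by (intro emeasure_mono closure_subset) (simp add: regular_sets[OF m])
      also have "\<dots> < \<infinity>" by (rule regular_finite[OF m Q(2)])
      finally show ?thesis by simp
    qed
  qed auto
qed

lemma Hausdorff_vague:
  assumes lc: "locally_compact_space (euclidean :: ('a::{t2_space,second_countable_topology}) topology)"
  shows "Hausdorff_space (vague_topology :: 'a measure topology)"
  unfolding Hausdorff_space_def
proof (intro allI impI)
  fix m m' :: "'a measure" assume a: "m \<in> topspace vague_topology \<and> m' \<in> topspace vague_topology \<and> m \<noteq> m'"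
  then have r: "regular_borel_measure euclidean m" "regular_borel_measure euclidean m'" by (auto simp: topspace_vague)
  then obtain c :: "'a \<Rightarrow> real" where c: "c \<in> compactly_supported" "(\<integral>x. c x \<partial>m) \<noteq> (\<integral>x. c x \<partial>m')"
    using regular_measure_eqI[OF lc r] a by blast
  obtain U V where UV: "open U" "open V" "(\<integral>x. c x \<partial>m) \<in> U" "(\<integral>x. c x \<partial>m') \<in> V" "U \<inter> V = {}"
    using hausdorff[OF c(2)] by blast
  let ?S = "\<lambda>U. {m \<in> topspace vague_topology. (\<integral>x. c x \<partial>m) \<in> U}"
  have "openin vague_topology (?S U)" "openin vague_topology (?S V)"
    using continuous_map_vague_integral[OF c(1)] UV(1,2) by (simp_all add: continuous_map_def)
  moreover have "m \<in> ?S U" "m' \<in> ?S V" "disjnt (?S U) (?S V)" using a UV by (auto simp: disjnt_def)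
  ultimately show "\<exists>U V. openin vague_topology U \<and> openin vague_topology V \<and> m \<in> U \<and> m' \<in> V \<and> disjnt U V" by blast
qed

section \<open>Translation of measures\<close>

lemma vimage_translate:
  fixes g :: "'a::ab_group_add"
  shows "(\<lambda>x. g + x) -` A = (\<lambda>x. x - g) ` A"
proof
  show "(\<lambda>x. g + x) -` A \<subseteq> (\<lambda>x. x - g) ` A"
  proof
    fix x assume "x \<in> (\<lambda>x. g + x) -` A"
    then have "(g + x) - g \<in> (\<lambda>x. x - g) ` A" by blast
    then show "x \<in> (\<lambda>x. x - g) ` A" by simp
  qed
  show "(\<lambda>x. x - g) ` A \<subseteq> (\<lambda>x. g + x) -` A" by auto
qed

lemma image_translate:
  fixes g :: "'a::ab_group_add"
  shows "(\<lambda>x. g + x) ` A = (\<lambda>x. x - g) -` A"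
  using vimage_translate[of "- g" A] by (simp add: add.commute)

lemma open_translation_group:
  fixes g :: "'a::topological_ab_group_add"
  assumes "open S" shows "open ((\<lambda>x. g + x) ` S)" "open ((\<lambda>x. x - g) ` S)"
proof -
  show "open ((\<lambda>x. g + x) ` S)" unfolding image_translate using assms by (intro open_vimage continuous_intros)
  show "open ((\<lambda>x. x - g) ` S)" unfolding vimage_translate[symmetric] using assms by (intro open_vimage continuous_intros)
qed

lemma compact_translation_group:
  fixes g :: "'a::topological_ab_group_add"
  assumes "compact S" shows "compact ((\<lambda>x. g + x) ` S)" "compact ((\<lambda>x. x - g) ` S)"
proof -
  have c1: "continuous_on S (\<lambda>x. g + x)" by (intro continuous_intros)
  have c2: "continuous_on S (\<lambda>x. x - g)" by (intro continuous_intros)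
  show "compact ((\<lambda>x. g + x) ` S)" by (rule compact_continuous_image[OF c1 assms])
  show "compact ((\<lambda>x. x - g) ` S)" by (rule compact_continuous_image[OF c2 assms])
qed

lemma measurable_translate [measurable]: "(\<lambda>x. g + x) \<in> borel \<rightarrow>\<^sub>M (borel :: ('a::topological_ab_group_add) measure)"
  by (intro borel_measurable_continuous_onI continuous_intros)

lemma emeasure_translate:
  fixes m :: "'a::topological_ab_group_add measure"
  assumes "sets m = sets borel" "A \<in> sets borel"
  shows "emeasure (translate g m) A = emeasure m ((\<lambda>x. x - g) ` A)"
proof -
  have sp: "space m = UNIV" using sets_eq_imp_space_eq[OF assms(1)] by simp
  have [measurable]: "(\<lambda>x. g + x) \<in> m \<rightarrow>\<^sub>M borel" using measurable_translate measurable_cong_sets[OF assms(1) refl] by blast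
  show ?thesis unfolding translate_def
    by (subst emeasure_distr) (simp_all add: assms sp vimage_translate)
qed

text \<open>Translation by \<open>g\<close> is a homeomorphism, so it carries the families of compact and open sets in
the definition of regularity to each other.\<close>

lemma regular_translate:
  fixes m :: "'a::{topological_ab_group_add} measure"
  assumes m: "regular_borel_measure euclidean m"
  shows "regular_borel_measure euclidean (translate g m)"
proof -
  let ?h = "\<lambda>A. (\<lambda>x. x - g) ` A" and ?k = "\<lambda>A. (\<lambda>x. g + x) ` A"
  have hk: "?h (?k A) = A" "?k (?h A) = A" for A by (simp_all add: image_image)
  note em = emeasure_translate[OF regular_sets[OF m]]
  have opn: "U \<in> sets borel" if "open U" for U :: "'a set" using that by simp
  have bm: "?h A \<in> sets borel" if "A \<in> sets borel" for A
    using measurable_sets[OF measurable_translate[of g] that] by (simp add: vimage_translate)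
  have st: "sets (translate g m) = sets borel" by (simp add: translate_def)
  have out: "emeasure m A = (INF U\<in>{U. open U \<and> A \<subseteq> U}. emeasure m U)" if "A \<in> sets borel" for A
    by (rule regular_outer[OF m that])
  have inn: "emeasure m U = (SUP K\<in>{K. compact K \<and> K \<subseteq> U}. emeasure m K)" if "open U" for U
    by (rule regular_inner[OF m that])
  have fin: "emeasure m K < \<infinity>" if "compact K" for K
    by (rule regular_finite[OF m that])
  have "emeasure (translate g m) K < \<infinity>" if K: "compact K" for K
  proof -
    show ?thesis
    \<comment> \<open>In a group that is not Hausdorff a compact set may fail to be Borel; its measure is then 0.\<close>
    proof (cases "K \<in> sets borel")
      case True then show ?thesis unfolding em[OF True] by (intro fin compact_translation_group K)
    next
      case False then show ?thesis using emeasure_notin_sets[of K "translate g m"] st by simp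
    qed
  qed
  moreover have "emeasure (translate g m) A = (INF U\<in>{U. open U \<and> A \<subseteq> U}. emeasure (translate g m) U)" if A: "A \<in> sets borel" for A
  proof -
    have "?h ` {U. open U \<and> A \<subseteq> U} = {U. open U \<and> ?h A \<subseteq> U}"
    proof (intro equalityI subsetI)
      fix U assume "U \<in> {U. open U \<and> ?h A \<subseteq> U}"
      then have U: "open U" "?h A \<subseteq> U" by auto
      then have "A \<subseteq> ?k U" using image_mono[OF U(2), of "\<lambda>x. g + x"] hk(2) by simp
      then have "?k U \<in> {U. open U \<and> A \<subseteq> U}" using open_translation_group(1)[OF U(1)] by simp
      then have "?h (?k U) \<in> ?h ` {U. open U \<and> A \<subseteq> U}" by (rule imageI)
      then show "U \<in> ?h ` {U. open U \<and> A \<subseteq> U}" unfolding hk(1) .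
    qed (auto intro: open_translation_group)
    then have "emeasure m (?h A) = (INF U\<in>?h ` {U. open U \<and> A \<subseteq> U}. emeasure m U)" using out[OF bm[OF A]] by simp
    also have "\<dots> = (INF U\<in>{U. open U \<and> A \<subseteq> U}. emeasure m (?h U))" by (simp only: image_image)
    also have "\<dots> = (INF U\<in>{U. open U \<and> A \<subseteq> U}. emeasure (translate g m) U)" using em[OF opn] by (intro INF_cong) auto
    finally show ?thesis using em[OF A] by simp
  qed
  moreover have "emeasure (translate g m) U = (SUP K\<in>{K. compact K \<and> K \<subseteq> U}. emeasure (translate g m) K)" if U: "open U" for U
  proof (rule antisym)
    show "emeasure (translate g m) U \<le> (SUP K\<in>{K. compact K \<and> K \<subseteq> U}. emeasure (translate g m) K)"
      unfolding em[OF opn[OF U]] inn[OF open_translation_group(2)[OF U]]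
    proof (rule SUP_least)
      fix K assume "K \<in> {K. compact K \<and> K \<subseteq> ?h U}"
      then have K: "compact K" "K \<subseteq> ?h U" by auto
      show "emeasure m K \<le> (SUP K\<in>{K. compact K \<and> K \<subseteq> U}. emeasure (translate g m) K)"
      proof (cases "K \<in> sets borel")
        case True
        have s: "?k K \<subseteq> U" using image_mono[OF K(2), of "\<lambda>x. g + x"] hk(2) by simp
        have "?k K \<in> sets borel" using measurable_sets[OF measurable_translate[of "- g"] True] by (simp add: image_translate)
        then have "emeasure m K = emeasure (translate g m) (?k K)" using em hk(1) by simp
        then show ?thesis using s compact_translation_group(1)[OF K(1)] by (auto intro!: SUP_upper)
      next
        case False then show ?thesis using emeasure_notin_sets[of K m] regular_sets[OF m] by simp
      qed
    qed
    show "(SUP K\<in>{K. compact K \<and> K \<subseteq> U}. emeasure (translate g m) K) \<le> emeasure (translate g m) U"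
      using opn[OF U] st by (intro SUP_least emeasure_mono) auto
  qed
  ultimately show ?thesis unfolding regular_borel_measure_def borel_of_euclidean st compactin_euclidean_iff open_openin[symmetric] by blast
qed

lemma compactly_supported_translate:
  fixes c :: "'a::{topological_ab_group_add,t2_space} \<Rightarrow> real"
  assumes c: "c \<in> compactly_supported"
  shows "(\<lambda>x. c (g + x)) \<in> compactly_supported"
proof (rule compactly_supported_closed_superset)
  let ?K = "closure {x. c x \<noteq> 0}"
  show "continuous_on UNIV (\<lambda>x. c (g + x))"
    by (rule continuous_on_compose2[OF compactly_supportedD(1)[OF c]]) (auto intro!: continuous_intros)
  show "compact ((\<lambda>x. x - g) ` ?K)" by (rule compact_translation_group(2)[OF compactly_supportedD(2)[OF c]])
  fix x assume "x \<notin> (\<lambda>x. x - g) ` ?K"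
  then have "g + x \<notin> ?K" unfolding vimage_translate[symmetric] by simp
  then show "c (g + x) = 0" by (rule compactly_supportedD(3)[OF c])
qed

lemma integral_translate:
  fixes c :: "'a::topological_ab_group_add \<Rightarrow> real"
  assumes "sets m = sets borel" "continuous_on UNIV c"
  shows "(\<integral>x. c x \<partial>translate g m) = (\<integral>x. c (g + x) \<partial>m)"
  unfolding translate_def
proof (rule integral_distr)
  show "(\<lambda>x. g + x) \<in> m \<rightarrow>\<^sub>M borel" using measurable_translate measurable_cong_sets[OF assms(1) refl] by blast
  show "c \<in> borel_measurable borel" using assms(2) by (rule borel_measurable_continuous_onI)
qed

lemma continuous_map_translate:
  fixes g :: "'a::{topological_ab_group_add,t2_space}"
  shows "continuous_map vague_topology vague_topology (translate g)"
proof (rule continuous_map_into_vague)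
  show "regular_borel_measure euclidean (translate g m)" if "m \<in> topspace vague_topology" for m
    using that regular_translate by (simp add: topspace_vague)
  fix c :: "'a \<Rightarrow> real" assume c: "c \<in> compactly_supported"
  have "(\<integral>y. c y \<partial>translate g m) = (\<integral>y. c (g + y) \<partial>m)" if "m \<in> topspace vague_topology" for m
    using that regular_sets c by (intro integral_translate) (auto simp: topspace_vague compactly_supported_def)
  then show "continuous_map vague_topology euclideanreal (\<lambda>m. \<integral>y. c y \<partial>translate g m)"
    by (intro continuous_map_eq[OF continuous_map_vague_integral[OF compactly_supported_translate[OF c, of g]]]) simp
qed

lemma translate_0:
  assumes "sets m = sets borel" shows "translate 0 m = m"
  unfolding translate_def add_0_left by (rule distr_id2[OF assms[symmetric]])

lemma translate_add:
  fixes m :: "'a::topological_ab_group_add measure"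
  assumes "sets m = sets borel" shows "translate (g + h) m = translate g (translate h m)"
proof -
  have [measurable]: "(\<lambda>x. h + x) \<in> m \<rightarrow>\<^sub>M borel" using measurable_translate measurable_cong_sets[OF assms refl] by blast
  have eq: "(\<lambda>x. g + x) \<circ> (\<lambda>x. h + x) = (\<lambda>x. g + h + x)" by (simp add: fun_eq_iff add.assoc)
  show ?thesis unfolding translate_def
    by (subst distr_distr[OF measurable_translate]) (simp_all only: eq, measurable)
qed

section \<open>The torus\<close>

lemma lc_prod:
  assumes "locally_compact_space (euclidean :: ('a::t2_space) topology)" "locally_compact_space (euclidean :: ('b::t2_space) topology)"
  shows "locally_compact_space (euclidean :: ('a \<times> 'b) topology)"
  unfolding locally_compact_space_def
proof
  fix x :: "'a \<times> 'b"
  obtain U where U: "open U" "fst x \<in> U" "compact (closure U)" "closure U \<subseteq> UNIV"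
    by (rule lc_nbhd[OF assms(1) open_UNIV UNIV_I])
  obtain V where V: "open V" "snd x \<in> V" "compact (closure V)" "closure V \<subseteq> UNIV"
    by (rule lc_nbhd[OF assms(2) open_UNIV UNIV_I])
  have "open (U \<times> V)" "compact (closure U \<times> closure V)" "x \<in> U \<times> V" "U \<times> V \<subseteq> closure U \<times> closure V"
    using U V closure_subset[of U] closure_subset[of V] by (auto intro: open_Times compact_Times simp: mem_Times_iff)
  then show "\<exists>U K. openin euclidean U \<and> compactin euclidean K \<and> x \<in> U \<and> U \<subseteq> K"
    unfolding open_openin[symmetric] compactin_euclidean_iff by blast
qed

definition act :: "'a::plus \<Rightarrow> 'a set \<Rightarrow> 'a set" where
  "act t X = (\<lambda>p. t + p) ` X"

lemma torus_action_eq_act: "torus_action g = act (g, 0)"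
  by (simp add: torus_action_def act_def fun_eq_iff)

lemma act_0 [simp]: "act (0::'a::monoid_add) X = X" by (simp add: act_def)
lemma act_act: "act s (act t X) = act (s + t :: 'a::semigroup_add) X" by (simp add: act_def image_image add.assoc)

lemma comm_group_additive: "comm_group (additive_group :: 'a::ab_group_add monoid)"
proof (rule comm_groupI)
  fix x :: 'a
  show "\<exists>y\<in>carrier additive_group. y \<otimes>\<^bsub>additive_group\<^esub> x = \<one>\<^bsub>additive_group\<^esub>"
    by (intro bexI[of _ "- x"]) (simp_all add: additive_group_def)
qed (auto simp: additive_group_def ac_simps)

lemma inv_additive [simp]: "inv\<^bsub>additive_group\<^esub> x = - (x :: 'a::ab_group_add)"
  by (rule group.inv_equality[OF comm_group.axioms(2)[OF comm_group_additive]]) (simp_all add: additive_group_def)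

text \<open>The functions for which the sum over a coset of a lattice is finite and all integrals
below exist.\<close>

definition test_fun :: "('a::topological_space \<Rightarrow> real) \<Rightarrow> bool" where
  "test_fun F \<longleftrightarrow> F \<in> borel_measurable borel \<and> (\<exists>B. \<forall>y. \<bar>F y\<bar> \<le> B) \<and> (\<exists>K. compact K \<and> (\<forall>y. y \<notin> K \<longrightarrow> F y = 0))"

text \<open>The sum of \<open>F\<close> over the coset \<open>X\<close>. Leaving out the zeros makes it a finite sum
for a test function \<open>F\<close>.\<close>

definition periodise :: "('a \<Rightarrow> real) \<Rightarrow> 'a set \<Rightarrow> real" where
  "periodise F X = (\<Sum>y | y \<in> X \<and> F y \<noteq> 0. F y)"

locale torus_scheme =
  fixes L :: "('g::{topological_ab_group_add, second_countable_topology, t2_space} \<times>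
               'h::{topological_ab_group_add, second_countable_topology, t2_space}) set"
    and mX :: "('g \<times> 'h) set measure"
  assumes cps: "cut_and_project_scheme L"
    and mX: "normalised_haar_measure (torus L) (torus_topology L) mX"
begin

abbreviation q :: "'g \<times> 'h \<Rightarrow> ('g \<times> 'h) set" where "q \<equiv> torus_proj L"
abbreviation torus_set ("\<T>") where "\<T> \<equiv> carrier (torus L)"

lemma lcG: "locally_compact_space (euclidean :: 'g topology)"
  and lcH: "locally_compact_space (euclidean :: 'h topology)"
  and subgroup_L: "subgroup L additive_group"
  and discrete_L: "discrete L"
  and compact_torus: "compact_space (torus_topology L)"
  and inj_fst_L: "inj_on fst L"
  and dense_snd_L: "closure (snd ` L) = UNIV"
  using cps by (simp_all add: cut_and_project_scheme_def)

lemma lcGH: "locally_compact_space (euclidean :: ('g \<times> 'h) topology)"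
  by (rule lc_prod[OF lcG lcH])

lemma L_0: "0 \<in> L" and L_add: "x \<in> L \<Longrightarrow> y \<in> L \<Longrightarrow> x + y \<in> L"
  and L_uminus: "x \<in> L \<Longrightarrow> - x \<in> L"
proof -
  show "0 \<in> L" using subgroup.one_closed[OF subgroup_L] unfolding additive_group_def by simp
  show "x + y \<in> L" if "x \<in> L" "y \<in> L"
    using subgroup.m_closed[OF subgroup_L that] unfolding additive_group_def by simp
  show "- x \<in> L" if "x \<in> L"
    using subgroup.m_inv_closed[OF subgroup_L that] unfolding inv_additive .
qed

lemma L_diff: "x \<in> L \<Longrightarrow> y \<in> L \<Longrightarrow> x - y \<in> L"
  using L_add[OF _ L_uminus, of x y] by simp

lemma q_def: "q x = (\<lambda>l. l + x) ` L"
  unfolding torus_proj_def r_coset_def additive_group_def by auto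

lemma in_q: "y \<in> q x \<longleftrightarrow> y - x \<in> L"
proof
  show "y - x \<in> L" if a: "y \<in> q x"
  proof -
    obtain l where "y = l + x" "l \<in> L" using a unfolding q_def by (rule imageE)
    then show ?thesis by (simp only: add_diff_cancel_right')
  qed
  assume "y - x \<in> L"
  then have "(y - x) + x \<in> q x" unfolding q_def by (rule imageI)
  then show "y \<in> q x" by simp
qed

lemma q_eq: "q x = q y \<longleftrightarrow> y - x \<in> L"
proof
  assume "q x = q y"
  then show "y - x \<in> L" using in_q[of y y] in_q[of y x] L_0 by simp
next
  assume a: "y - x \<in> L"
  show "q x = q y"
  proof (intro equalityI subsetI)
    fix z assume "z \<in> q x"
    then have "(z - x) - (y - x) \<in> L" using a L_diff in_q by blast
    then show "z \<in> q y" by (simp add: in_q)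
  next
    fix z assume "z \<in> q y"
    then have "(z - y) + (y - x) \<in> L" using a L_add in_q by blast
    then show "z \<in> q x" by (simp add: in_q)
  qed
qed

lemma self_in_q: "x \<in> q x" by (simp add: in_q L_0)

lemma carrier_torus: "\<T> = range q"
  by (simp add: torus_def carrier_FactGroup torus_proj_def[abs_def]) (simp add: additive_group_def)

lemma q_in_torus [simp]: "q x \<in> \<T>" by (simp add: carrier_torus)

lemma torus_eq_q: assumes "X \<in> \<T>" "x \<in> X" shows "X = q x"
proof -
  obtain z where z: "X = q z" using assms(1) unfolding carrier_torus by (rule imageE)
  then have "x - z \<in> L" using assms(2) by (simp only: in_q)
  then show ?thesis unfolding z by (simp only: q_eq)
qed

lemma topspace_torus [simp]: "topspace (torus_topology L) = \<T>"
  by (simp add: torus_topology_def carrier_torus)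

lemma openin_torus: "openin (torus_topology L) U \<longleftrightarrow> U \<subseteq> \<T> \<and> open {x. q x \<in> U}"
  by (simp add: torus_topology_def openin_quotient_topology carrier_torus)

lemma closedin_torus: "closedin (torus_topology L) C \<longleftrightarrow> C \<subseteq> \<T> \<and> closed {x. q x \<in> C}"
proof -
  have "{x. q x \<in> \<T> - C} = - {x. q x \<in> C}" by auto
  then show ?thesis by (auto simp: closedin_def openin_torus closed_def)
qed

lemma act_q: "act t (q x) = q (t + x)"
  by (simp add: act_def q_def image_image ac_simps)

lemma act_torus [simp]: "X \<in> \<T> \<Longrightarrow> act t X \<in> \<T>"
  by (auto simp: carrier_torus act_q)

lemma torus_mult: "X \<in> \<T> \<Longrightarrow> q t \<otimes>\<^bsub>torus L\<^esub> X = act t X"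
proof -
  assume "X \<in> \<T>"
  then obtain x where x: "X = q x" by (auto simp: carrier_torus)
  have "normal L additive_group"
    using comm_group.normal_iff_subgroup[OF comm_group_additive] subgroup_L by blast
  from normal.rcos_sum[OF this, of t x]
  have "torus_proj L t <#>\<^bsub>additive_group\<^esub> torus_proj L x = torus_proj L (t + x)"
    unfolding torus_proj_def by (simp add: additive_group_def)
  then show ?thesis unfolding x act_q by (simp add: torus_def)
qed

text \<open>The saturation of an open set is a union of its translates.\<close>

lemma open_map_q:
  assumes "open U" shows "openin (torus_topology L) (q ` U)"
proof -
  have "{x. q x \<in> q ` U} = (\<Union>l\<in>L. (\<lambda>x. l + x) ` U)"
  proof (intro equalityI subsetI)
    fix x assume "x \<in> {x. q x \<in> q ` U}"
    then obtain u where "u \<in> U" "x - u \<in> L" by (auto simp: q_eq) (metis L_uminus minus_diff_eq)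
    then show "x \<in> (\<Union>l\<in>L. (\<lambda>x. l + x) ` U)" by (intro UN_I[of "x - u"]) (auto intro!: image_eqI[of _ _ u])
  next
    fix x assume "x \<in> (\<Union>l\<in>L. (\<lambda>x. l + x) ` U)"
    then obtain l u where "l \<in> L" "u \<in> U" "x = l + u" by auto
    then have "q x = q u" using L_uminus[of l] by (simp add: q_eq)
    then show "x \<in> {x. q x \<in> q ` U}" using \<open>u \<in> U\<close> by auto
  qed
  moreover have "open (\<Union>l\<in>L. (\<lambda>x. l + x) ` U)" using assms by (intro open_UN ballI open_translation_group)
  ultimately show ?thesis by (auto simp: openin_torus)
qed

text \<open>Discreteness at the single point 0, pulled back along subtraction. Translates of the
neighbourhood serve at all other points.\<close>

lemma injective_nbhd:
  obtains V where "open V" "0 \<in> V" "\<forall>x\<in>V. \<forall>y\<in>V. x - y \<in> L \<longrightarrow> x = y"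
proof -
  obtain T where T: "open T" "T \<inter> L = {0}" using discrete_L L_0 by (auto simp: discrete_def isolated_in_def)
  have c: "continuous_on UNIV (\<lambda>p :: ('g \<times> 'h) \<times> ('g \<times> 'h). fst p - snd p)" by (intro continuous_intros)
  have "open ((\<lambda>p. fst p - snd p) -` T)" by (rule open_vimage[OF T(1) c])
  moreover have "(0, 0) \<in> (\<lambda>p. fst p - snd p) -` T" using T(2) by auto
  ultimately obtain A B where AB: "open A" "open B" "(0,0) \<in> A \<times> B" "A \<times> B \<subseteq> (\<lambda>p. fst p - snd p) -` T"
    by (rule open_prod_elim)
  have "x = y" if "x \<in> A \<inter> B" "y \<in> A \<inter> B" "x - y \<in> L" for x y
  proof -
    have "(x, y) \<in> A \<times> B" using that by blast
    then have "x - y \<in> T" using AB(4) by auto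
    then have "x - y = 0" using T(2) that(3) by blast
    then show ?thesis by simp
  qed
  moreover have "open (A \<inter> B)" "0 \<in> A \<inter> B" using AB by auto
  ultimately show ?thesis using that by blast
qed

text \<open>A compact set is covered by finitely many translates of the neighbourhood on which distinct
points are incongruent modulo \<open>L\<close>; each translate contains at most one lattice point.\<close>

lemma finite_L_compact:
  assumes K: "compact K" shows "finite (L \<inter> K)"
proof -
  obtain V where V: "open V" "0 \<in> V" "\<forall>x\<in>V. \<forall>y\<in>V. x - y \<in> L \<longrightarrow> x = y"
    by (rule injective_nbhd)
  have "\<And>x. x \<in> K \<Longrightarrow> open ((\<lambda>v. x + v) ` V)" using V(1) by (intro open_translation_group)
  moreover have "K \<subseteq> (\<Union>x\<in>K. (\<lambda>v. x + v) ` V)" using V(2) by (force intro: image_eqI[of _ _ 0])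
  ultimately obtain C where C: "C \<subseteq> K" "finite C" "K \<subseteq> (\<Union>x\<in>C. (\<lambda>v. x + v) ` V)"
    by (rule compactE_image[OF K])
  have "finite (L \<inter> (\<lambda>v. x + v) ` V)" for x
  proof -
    have "u = w" if uw: "u \<in> L \<inter> (\<lambda>v. x + v) ` V" "w \<in> L \<inter> (\<lambda>v. x + v) ` V" for u w
    proof -
      obtain a b where ab: "a \<in> V" "b \<in> V" "u = x + a" "w = x + b" using uw by blast
      have "u - w \<in> L" using uw by (intro L_diff) auto
      then have "a - b \<in> L" using ab by simp
      then show ?thesis using V(3) ab by blast
    qed
    then have "L \<inter> (\<lambda>v. x + v) ` V = {} \<or> (\<exists>u. L \<inter> (\<lambda>v. x + v) ` V = {u})" by blast
    then show ?thesis by (elim disjE exE) simp_all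
  qed
  then have "finite (\<Union>x\<in>C. L \<inter> (\<lambda>v. x + v) ` V)" using C(2) by blast
  then show ?thesis by (rule finite_subset[rotated]) (use C(3) in blast)
qed

text \<open>Translates of an injective neighbourhood have open images in the torus, and by compactness
finitely many images suffice. All charts lie in one compact set \<open>C0\<close>.\<close>

lemma charts:
  obtains \<U> :: "('g \<times> 'h) set set" and C0 where "finite \<U>" "\<And>U. U \<in> \<U> \<Longrightarrow> open U" "\<And>U. U \<in> \<U> \<Longrightarrow> inj_on q U"
    "compact C0" "\<Union>\<U> \<subseteq> C0" "\<T> \<subseteq> q ` \<Union>\<U>"
proof -
  obtain V where V: "open V" "0 \<in> V" "\<forall>x\<in>V. \<forall>y\<in>V. x - y \<in> L \<longrightarrow> x = y"
    by (rule injective_nbhd)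
  have "\<exists>U. open U \<and> x \<in> U \<and> compact (closure U) \<and> inj_on q U" for x
  proof -
    have "open ((\<lambda>v. x + v) ` V)" "x \<in> (\<lambda>v. x + v) ` V"
      using V(1,2) by (auto intro: open_translation_group image_eqI[of _ _ 0])
    then obtain U where U: "open U" "x \<in> U" "compact (closure U)" "closure U \<subseteq> (\<lambda>v. x + v) ` V"
      by (rule lc_nbhd[OF lcGH])
    have "inj_on q U"
    proof (rule inj_onI)
      fix a b assume ab: "a \<in> U" "b \<in> U" "q a = q b"
      then obtain v w where vw: "v \<in> V" "w \<in> V" "a = x + v" "b = x + w" using U(4) closure_subset[of U] by blast
      then have "w - v \<in> L" using ab(3) by (simp add: q_eq)
      then have "w = v" using V(3) vw by blast
      then show "a = b" using vw by simp
    qed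
    then show ?thesis using U by blast
  qed
  then obtain U where U: "\<And>x. open (U x)" "\<And>x. x \<in> U x" "\<And>x. compact (closure (U x))" "\<And>x. inj_on q (U x)" by metis
  have "compactin (torus_topology L) \<T>" using compact_torus by (simp add: compact_space_def)
  moreover have "\<And>W. W \<in> range (\<lambda>x. q ` U x) \<Longrightarrow> openin (torus_topology L) W" using open_map_q U(1) by blast
  moreover have "\<T> \<subseteq> \<Union> (range (\<lambda>x. q ` U x))" using U(2) by (force simp: carrier_torus)
  ultimately obtain \<F> where F: "finite \<F>" "\<F> \<subseteq> range (\<lambda>x. q ` U x)" "\<T> \<subseteq> \<Union>\<F>"
    unfolding compactin_def by meson
  then obtain P where P: "finite P" "\<F> = (\<lambda>x. q ` U x) ` P" using finite_subset_image[OF F(1,2)] by blast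
  show ?thesis
  proof (rule that[of "U ` P" "\<Union>x\<in>P. closure (U x)"])
    show "compact (\<Union>x\<in>P. closure (U x))" using P(1) U(3) by (intro compact_UN) auto
    show "\<Union> (U ` P) \<subseteq> (\<Union>x\<in>P. closure (U x))" using closure_subset by blast
    show "\<T> \<subseteq> q ` \<Union> (U ` P)" using F(3) P(2) by blast
  qed (use P U in auto)
qed

definition "borel_torus = borel_of (torus_topology L)"

lemma space_borel_torus [simp]: "space borel_torus = \<T>" by (simp add: borel_torus_def)

lemma measurable_q: "q \<in> borel \<rightarrow>\<^sub>M borel_torus"
  unfolding borel_torus_def
  by (rule measurable_borel_of) (auto simp: openin_torus vimage_def)

text \<open>On a chart \<open>q\<close> is an open injection, so its images commute with the set operations that
generate the Borel sets.\<close>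

lemma chart_image_borel:
  assumes U: "open U" "inj_on q U" and A: "A \<in> sets borel"
  shows "q ` (A \<inter> U) \<in> sets borel_torus"
proof -
  have "A \<in> sigma_sets UNIV {S. open S}" using A by (simp add: borel_def)
  then show ?thesis
  proof induction
    case (Basic a)
    then have "open (a \<inter> U)" using U(1) by (intro open_Int) auto
    then show ?case unfolding borel_torus_def by (intro openin_borel_of open_map_q)
  next
    case Empty then show ?case by simp
  next
    case (Compl a)
    have "q ` ((UNIV - a) \<inter> U) = q ` U - q ` (a \<inter> U)" using U(2) by (auto simp: inj_on_def)
    moreover have "q ` U \<in> sets borel_torus" unfolding borel_torus_def by (intro openin_borel_of open_map_q U(1))
    ultimately show ?case using Compl.IH by simp
  next
    case (Union a)
    have "q ` (\<Union> (range a) \<inter> U) = (\<Union>i. q ` (a i \<inter> U))" by blast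
    moreover have "(\<Union>i. q ` (a i \<inter> U)) \<in> sets borel_torus"
      by (intro sets.countable_UN image_subsetI Union.IH)
    ultimately show ?case by (simp only:)
  qed
qed

text \<open>Choose in each coset the representative in the first chart that meets it. The section takes
values in a compact set, and it lets functions and sets in the torus be studied upstairs.\<close>

lemma borel_section:
  obtains s C0 where "s \<in> borel_torus \<rightarrow>\<^sub>M borel" "compact C0" "\<And>X. X \<in> \<T> \<Longrightarrow> s X \<in> X" "\<And>X. X \<in> \<T> \<Longrightarrow> s X \<in> C0"
proof -
  obtain \<U> :: "('g \<times> 'h) set set" and C0 where c: "finite \<U>" "\<And>U. U \<in> \<U> \<Longrightarrow> open U" "\<And>U. U \<in> \<U> \<Longrightarrow> inj_on q U"
    "compact C0" "\<Union>\<U> \<subseteq> C0" "\<T> \<subseteq> q ` \<Union>\<U>"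
    by (rule charts) (rule that, blast+)
  obtain n and U :: "nat \<Rightarrow> ('g \<times> 'h) set" where nU: "\<U> = U ` {i. i < n}"
    using finite_imp_nat_seg_image_inj_on[OF c(1)] by auto
  have Uo: "open (U i)" "inj_on q (U i)" "U i \<subseteq> C0" if "i < n" for i using c that nU by auto
  \<comment> \<open>The first chart that contains a representative.\<close>
  define idx where "idx X = (LEAST i. i < n \<and> X \<in> q ` U i)" for X
  define s where "s X = (THE y. y \<in> U (idx X) \<and> q y = X)" for X
  have idx: "idx X < n" "X \<in> q ` U (idx X)" if "X \<in> \<T>" for X
  proof -
    have "\<exists>i. i < n \<and> X \<in> q ` U i" using that c(6) nU by blast
    from LeastI_ex[OF this] show "idx X < n" "X \<in> q ` U (idx X)" by (simp_all add: idx_def)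
  qed
  have idx_min: "X \<notin> q ` U j" if "j < idx X" "X \<in> \<T>" for X j
    using not_less_Least[OF that(1)[unfolded idx_def]] idx(1)[OF that(2)] that(1) by auto
  have s: "s X \<in> U (idx X) \<and> q (s X) = X" if X: "X \<in> \<T>" for X
    unfolding s_def
  proof (rule theI')
    obtain y where y: "y \<in> U (idx X)" "q y = X" using idx(2)[OF X] by blast
    show "\<exists>!y. y \<in> U (idx X) \<and> q y = X"
    proof (rule ex1I[of _ y])
      fix z assume "z \<in> U (idx X) \<and> q z = X"
      then show "z = y" using y inj_onD[OF Uo(2)[OF idx(1)[OF X]]] by blast
    qed (use y in simp)
  qed
  have "s -` A \<inter> \<T> \<in> sets borel_torus" if A: "A \<in> sets borel" for A
  proof -
    have "s -` A \<inter> \<T> = (\<Union>i\<in>{..<n}. q ` (A \<inter> U i) - (\<Union>j\<in>{..<i}. q ` U j))"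
    proof (intro equalityI subsetI)
      fix X assume X: "X \<in> s -` A \<inter> \<T>"
      then have X': "X \<in> \<T>" by simp
      have "X \<in> q ` (A \<inter> U (idx X))" using s[OF X'] X by (intro image_eqI[of _ _ "s X"]) auto
      then show "X \<in> (\<Union>i\<in>{..<n}. q ` (A \<inter> U i) - (\<Union>j\<in>{..<i}. q ` U j))"
        using idx(1)[OF X'] idx_min[OF _ X'] by blast
    next
      fix X assume "X \<in> (\<Union>i\<in>{..<n}. q ` (A \<inter> U i) - (\<Union>j\<in>{..<i}. q ` U j))"
      then obtain i y where i: "i < n" "y \<in> A" "y \<in> U i" "X = q y" "\<And>j. j < i \<Longrightarrow> X \<notin> q ` U j" by auto
      then have X: "X \<in> \<T>" by simp
      have "idx X = i" unfolding idx_def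
      proof (rule Least_equality)
        show "i < n \<and> X \<in> q ` U i" using i by blast
        fix j assume "j < n \<and> X \<in> q ` U j" then show "i \<le> j" using i(5) by (meson not_le)
      qed
      then have "s X = y" using s[OF X] i inj_onD[OF Uo(2)[OF i(1)]] by auto
      then show "X \<in> s -` A \<inter> \<T>" using i(2) X by simp
    qed
    moreover have "q ` (A \<inter> U i) \<in> sets borel_torus" if "i < n" for i using chart_image_borel[OF Uo(1,2)[OF that] A] .
    moreover have "q ` U i \<in> sets borel_torus" if "i < n" for i
      unfolding borel_torus_def by (intro openin_borel_of open_map_q Uo(1) that)
    ultimately show ?thesis by (simp only:) (intro sets.finite_UN sets.Diff, auto)
  qed
  then have "s \<in> borel_torus \<rightarrow>\<^sub>M borel" by (intro measurableI) auto
  moreover have "s X \<in> X" if "X \<in> \<T>" for X using s[OF that] self_in_q by metis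
  moreover have "s X \<in> C0" if "X \<in> \<T>" for X using s[OF that] Uo(3)[OF idx(1)[OF that]] by blast
  ultimately show ?thesis using that c(4) by blast
qed

text \<open>Composing with the Borel section undoes the composition with \<open>q\<close>.\<close>

lemma measurable_via_q:
  assumes "(\<lambda>x. f (q x)) \<in> borel \<rightarrow>\<^sub>M N" shows "f \<in> borel_torus \<rightarrow>\<^sub>M N"
proof -
  obtain s C0 where s: "s \<in> borel_torus \<rightarrow>\<^sub>M borel" "compact C0" "\<And>X. X \<in> \<T> \<Longrightarrow> s X \<in> X" "\<And>X. X \<in> \<T> \<Longrightarrow> s X \<in> C0"
    by (rule borel_section) (rule that, blast+)
  have "(\<lambda>X. f (q (s X))) \<in> borel_torus \<rightarrow>\<^sub>M N" by (rule measurable_compose[OF s(1) assms])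
  moreover have "f (q (s X)) = f X" if "X \<in> space borel_torus" for X using torus_eq_q[OF _ s(3)] that by simp
  ultimately show ?thesis by (subst measurable_cong[of _ _ "\<lambda>X. f (q (s X))"]) auto
qed

section \<open>Periodisation\<close>

text \<open>The translations that can contribute to a periodisation at a point of \<open>C\<close> when the function
vanishes off \<open>K\<close>.\<close>

definition lattice_hits :: "('g \<times> 'h) set \<Rightarrow> ('g \<times> 'h) set \<Rightarrow> ('g \<times> 'h) set" where
  "lattice_hits C K = {l\<in>L. \<exists>x\<in>C. l + x \<in> K}"

lemma finite_lattice_hits:
  assumes "compact C" "compact K" shows "finite (lattice_hits C K)"
proof -
  have c: "continuous_on (K \<times> C) (\<lambda>p :: ('g \<times> 'h) \<times> ('g \<times> 'h). fst p - snd p)" by (intro continuous_intros)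
  have "compact ((\<lambda>p. fst p - snd p) ` (K \<times> C))" by (rule compact_continuous_image[OF c compact_Times[OF assms(2,1)]])
  then have "finite (L \<inter> (\<lambda>p. fst p - snd p) ` (K \<times> C))" by (rule finite_L_compact)
  moreover have "lattice_hits C K \<subseteq> L \<inter> (\<lambda>p. fst p - snd p) ` (K \<times> C)"
  proof
    fix l assume "l \<in> lattice_hits C K"
    then obtain x where x: "l \<in> L" "x \<in> C" "l + x \<in> K" by (auto simp: lattice_hits_def)
    then have "l \<in> (\<lambda>p. fst p - snd p) ` (K \<times> C)" by (intro image_eqI[of _ _ "(l + x, x)"]) auto
    then show "l \<in> L \<inter> (\<lambda>p. fst p - snd p) ` (K \<times> C)" using x(1) by blast
  qed
  ultimately show ?thesis by (rule finite_subset[rotated])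
qed

lemma finite_torus_Int:
  assumes X: "X \<in> \<T>" and K: "compact K" shows "finite (X \<inter> K)"
proof -
  obtain x where x: "X = q x" using X by (auto simp: carrier_torus)
  have "X \<inter> K \<subseteq> (\<lambda>l. l + x) ` lattice_hits {x} K" by (auto simp: x q_def lattice_hits_def)
  then show ?thesis using finite_lattice_hits[of "{x}" K] K by (meson compact_sing finite_imageI finite_subset)
qed

lemma periodise_eq:
  assumes "X \<in> \<T>" "compact K" "\<And>y. y \<notin> K \<Longrightarrow> F y = 0"
  shows "periodise F X = (\<Sum>y\<in>X \<inter> K. F y)"
  unfolding periodise_def
  by (rule sum.mono_neutral_left) (use finite_torus_Int[OF assms(1,2)] assms(3) in auto)

text \<open>The index set on the right is finite and is the same for all \<open>x \<in> C\<close>. Boundedness,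
measurability and continuity of \<open>periodise F\<close> all follow from this formula.\<close>

lemma periodise_lattice_sum:
  assumes "x \<in> C" "compact C" "compact K" "\<And>y. y \<notin> K \<Longrightarrow> F y = 0"
  shows "periodise F (q x) = (\<Sum>l\<in>lattice_hits C K. F (l + x))"
proof -
  have "periodise F (q x) = (\<Sum>y\<in>q x \<inter> K. F y)" by (rule periodise_eq) (use assms in auto)
  also have "\<dots> = (\<Sum>l\<in>(\<lambda>y. y - x) ` (q x \<inter> K). F (l + x))" by (subst sum.reindex) (auto simp: inj_on_def)
  also have "\<dots> = (\<Sum>l\<in>lattice_hits C K. F (l + x))"
  proof (rule sum.mono_neutral_left)
    show "finite (lattice_hits C K)" by (rule finite_lattice_hits[OF assms(2,3)])
    show "(\<lambda>y. y - x) ` (q x \<inter> K) \<subseteq> lattice_hits C K"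
    proof (rule image_subsetI)
      fix y assume y: "y \<in> q x \<inter> K"
      have "y - x \<in> L" "y - x + x \<in> K" using y in_q[of y x] by simp_all
      then show "y - x \<in> lattice_hits C K" unfolding lattice_hits_def using assms(1) by blast
    qed
    show "\<forall>l\<in>lattice_hits C K - (\<lambda>y. y - x) ` (q x \<inter> K). F (l + x) = 0"
    proof
      fix l assume l: "l \<in> lattice_hits C K - (\<lambda>y. y - x) ` (q x \<inter> K)"
      have "l + x \<in> q x" using l by (simp add: lattice_hits_def in_q)
      moreover have "l = (l + x) - x" by simp
      ultimately have "l + x \<notin> K" using l by blast
      then show "F (l + x) = 0" by (rule assms(4))
    qed
  qed
  finally show ?thesis .
qed

lemma test_funE:
  assumes "test_fun F"
  obtains B K where "F \<in> borel_measurable borel" "B \<ge> 0" "\<And>y. \<bar>F y\<bar> \<le> B" "compact K" "\<And>y. y \<notin> K \<Longrightarrow> F y = 0"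
proof -
  obtain B K where *: "F \<in> borel_measurable borel" "\<And>y. \<bar>F y\<bar> \<le> B" "compact K" "\<And>y. y \<notin> K \<Longrightarrow> F y = 0"
    using assms unfolding test_fun_def by blast
  have "B \<ge> 0" using *(2)[of undefined] by linarith
  then show ?thesis using that * by blast
qed

lemma periodise_measurable_bounded:
  assumes F: "test_fun F"
  shows "periodise F \<in> borel_measurable borel_torus" "\<exists>B. \<forall>X\<in>\<T>. \<bar>periodise F X\<bar> \<le> B"
proof -
  obtain B K where K: "F \<in> borel_measurable borel" "B \<ge> 0" "\<And>y. \<bar>F y\<bar> \<le> B" "compact K" "\<And>y. y \<notin> K \<Longrightarrow> F y = 0"
    by (rule test_funE[OF F]) (rule that, blast+)
  obtain s C0 where s: "s \<in> borel_torus \<rightarrow>\<^sub>M borel" "compact C0" "\<And>X. X \<in> \<T> \<Longrightarrow> s X \<in> X" "\<And>X. X \<in> \<T> \<Longrightarrow> s X \<in> C0"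
    by (rule borel_section) (rule that, blast+)
  have eq: "periodise F X = (\<Sum>l\<in>lattice_hits C0 K. F (l + s X))" if X: "X \<in> \<T>" for X
  proof -
    have "periodise F (q (s X)) = (\<Sum>l\<in>lattice_hits C0 K. F (l + s X))" by (rule periodise_lattice_sum[OF s(4)[OF X] s(2) K(4) K(5)])
    then show ?thesis unfolding torus_eq_q[OF X s(3)[OF X], symmetric] .
  qed
  note [measurable] = K(1) s(1)
  have [measurable]: "(\<lambda>x. l + x) \<in> borel \<rightarrow>\<^sub>M (borel :: ('g \<times> 'h) measure)" for l by (rule measurable_translate)
  have "(\<lambda>X. \<Sum>l\<in>lattice_hits C0 K. F (l + s X)) \<in> borel_measurable borel_torus" by measurable
  then show "periodise F \<in> borel_measurable borel_torus"
    by (subst measurable_cong[of _ _ "\<lambda>X. \<Sum>l\<in>lattice_hits C0 K. F (l + s X)"]) (auto simp: eq)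
  have "\<bar>periodise F X\<bar> \<le> real (card (lattice_hits C0 K)) * B" if X: "X \<in> \<T>" for X
  proof -
    have "\<bar>periodise F X\<bar> \<le> (\<Sum>l\<in>lattice_hits C0 K. \<bar>F (l + s X)\<bar>)" unfolding eq[OF X] by (rule sum_abs)
    also have "\<dots> \<le> real (card (lattice_hits C0 K)) * B" by (rule sum_bounded_above) (rule K(3))
    finally show ?thesis .
  qed
  then show "\<exists>B. \<forall>X\<in>\<T>. \<bar>periodise F X\<bar> \<le> B" by blast
qed

lemma test_fun_compactly_supported:
  fixes F :: "'a::t2_space \<Rightarrow> real"
  assumes "F \<in> compactly_supported" shows "test_fun F"
proof -
  obtain B where "B > 0" "\<And>x. \<bar>F x\<bar> \<le> B" by (rule compactly_supported_bounded[OF assms]) (rule that, blast+)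
  then show ?thesis unfolding test_fun_def
    using borel_measurable_continuous_onI[OF compactly_supportedD(1)[OF assms]] compactly_supportedD(2,3)[OF assms] by blast
qed

text \<open>Near each point the sum over the coset runs over one fixed finite set of translations.\<close>

lemma continuous_periodise:
  assumes F: "F \<in> compactly_supported"
  shows "continuous_on UNIV (\<lambda>x. periodise F (q x))"
proof (rule continuous_at_imp_continuous_on, rule ballI)
  fix x0 :: "'g \<times> 'h"
  let ?K = "closure {x. F x \<noteq> 0}"
  obtain N where N: "open N" "x0 \<in> N" "compact (closure N)" "closure N \<subseteq> UNIV"
    by (rule lc_nbhd[OF lcGH open_UNIV UNIV_I])
  have eq: "periodise F (q x) = (\<Sum>l\<in>lattice_hits (closure N) ?K. F (l + x))" if "x \<in> N" for x
    by (rule periodise_lattice_sum[OF _ N(3) compactly_supportedD(2)[OF F] compactly_supportedD(3)[OF F]]) (use that closure_subset[of N] in blast)+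
  have "continuous_on N (\<lambda>x. \<Sum>l\<in>lattice_hits (closure N) ?K. F (l + x))"
    by (intro continuous_on_sum continuous_on_compose2[OF compactly_supportedD(1)[OF F]] continuous_intros) auto
  then have "continuous_on N (\<lambda>x. periodise F (q x))" by (rule continuous_on_cong[THEN iffD2, rotated -1]) (auto simp: eq)
  then show "isCont (\<lambda>x. periodise F (q x)) x0" using N(1,2) continuous_on_eq_continuous_at by blast
qed

lemma periodise_add:
  assumes "test_fun F" "test_fun G" "X \<in> \<T>" shows "periodise (\<lambda>y. F y + G y) X = periodise F X + periodise G X"
proof -
  obtain B K where K: "F \<in> borel_measurable borel" "B \<ge> 0" "\<And>y. \<bar>F y\<bar> \<le> B" "compact K" "\<And>y. y \<notin> K \<Longrightarrow> F y = 0"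
    by (rule test_funE[OF assms(1)]) (rule that, blast+)
  obtain B' K' where K': "G \<in> borel_measurable borel" "B' \<ge> 0" "\<And>y. \<bar>G y\<bar> \<le> B'" "compact K'" "\<And>y. y \<notin> K' \<Longrightarrow> G y = 0"
    by (rule test_funE[OF assms(2)]) (rule that, blast+)
  have c: "compact (K \<union> K')" using K(4) K'(4) by (rule compact_Un)
  have 1: "periodise F X = (\<Sum>y\<in>X \<inter> (K \<union> K'). F y)" by (rule periodise_eq[OF assms(3) c]) (use K(5) in auto)
  have 2: "periodise G X = (\<Sum>y\<in>X \<inter> (K \<union> K'). G y)" by (rule periodise_eq[OF assms(3) c]) (use K'(5) in auto)
  have 3: "periodise (\<lambda>y. F y + G y) X = (\<Sum>y\<in>X \<inter> (K \<union> K'). F y + G y)" by (rule periodise_eq[OF assms(3) c]) (use K(5) K'(5) in auto)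
  show ?thesis unfolding 1 2 3 by (rule sum.distrib)
qed

lemma periodise_cmult: "periodise (\<lambda>y. a * F y) X = a * periodise F X"
  by (cases "a = 0") (simp_all add: periodise_def sum_distrib_left)

lemma test_fun_cmult: "test_fun F \<Longrightarrow> test_fun (\<lambda>y. a * F y)"
proof -
  assume F: "test_fun F"
  obtain B K where K: "F \<in> borel_measurable borel" "B \<ge> 0" "\<And>y. \<bar>F y\<bar> \<le> B" "compact K" "\<And>y. y \<notin> K \<Longrightarrow> F y = 0"
    using F unfolding test_fun_def by (metis abs_ge_zero order_trans)
  have "\<bar>a * F y\<bar> \<le> \<bar>a\<bar> * B" for y unfolding abs_mult by (rule mult_left_mono[OF K(3)]) simp
  moreover have "(\<lambda>y. a * F y) \<in> borel_measurable borel" using K(1) by simp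
  moreover have "a * F y = 0" if "y \<notin> K" for y using K(5)[OF that] by simp
  ultimately show ?thesis unfolding test_fun_def using K(4) by blast
qed

lemma test_fun_add: "test_fun F \<Longrightarrow> test_fun G \<Longrightarrow> test_fun (\<lambda>y. F y + G y)" for F G :: "'a::t2_space \<Rightarrow> real"
proof -
  assume F: "test_fun F" and G: "test_fun G"
  obtain B K where K: "F \<in> borel_measurable borel" "\<And>y. \<bar>F y\<bar> \<le> B" "compact K" "\<And>y. y \<notin> K \<Longrightarrow> F y = 0"
    using F unfolding test_fun_def by blast
  obtain B' K' where K': "G \<in> borel_measurable borel" "\<And>y. \<bar>G y\<bar> \<le> B'" "compact K'" "\<And>y. y \<notin> K' \<Longrightarrow> G y = 0"
    using G unfolding test_fun_def by blast
  have "\<bar>F y + G y\<bar> \<le> B + B'" for y using K(2)[of y] K'(2)[of y] by linarith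
  moreover have "(\<lambda>y. F y + G y) \<in> borel_measurable borel" using K(1) K'(1) by simp
  moreover have "F y + G y = 0" if "y \<notin> K \<union> K'" for y using K(4)[of y] K'(4)[of y] that by simp
  ultimately show ?thesis unfolding test_fun_def using compact_Un[OF K(3) K'(3)] by blast
qed

lemma periodise_diff:
  assumes "test_fun F" "test_fun G" "X \<in> \<T>" shows "periodise (\<lambda>y. F y - G y) X = periodise F X - periodise G X"
  using periodise_add[OF assms(1) test_fun_cmult[OF assms(2), of "-1"] assms(3)] periodise_cmult[of "-1" G X] by simp

lemma test_fun_diff: "test_fun F \<Longrightarrow> test_fun G \<Longrightarrow> test_fun (\<lambda>y. F y - G y)" for F G :: "'a::t2_space \<Rightarrow> real"
  using test_fun_add[of F "\<lambda>y. -1 * G y"] test_fun_cmult[of G "-1"] by simp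

lemma periodise_mono:
  assumes "test_fun F" "test_fun G" "X \<in> \<T>" "\<And>y. y \<in> X \<Longrightarrow> F y \<le> G y" shows "periodise F X \<le> periodise G X"
proof -
  have "0 \<le> periodise (\<lambda>y. G y - F y) X" unfolding periodise_def using assms(4) by (intro sum_nonneg) auto
  then show ?thesis using periodise_diff[OF assms(2,1,3)] by simp
qed

lemma periodise_act:
  fixes X :: "('g \<times> 'h) set"
  shows "periodise F (act t X) = periodise (\<lambda>y. F (t + y)) X"
proof -
  have eq: "{y \<in> act t X. F y \<noteq> 0} = (\<lambda>y. t + y) ` {y \<in> X. F (t + y) \<noteq> 0}" by (auto simp: act_def)
  have inj: "inj_on (\<lambda>y. t + y) A" for A :: "('g \<times> 'h) set" by (simp add: inj_on_def)
  show ?thesis unfolding periodise_def by (simp only: eq sum.reindex[OF inj] comp_def)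
qed

lemma test_fun_translate: "test_fun F \<Longrightarrow> test_fun (\<lambda>y. F (t + y))" for F :: "'a::{t2_space,topological_ab_group_add} \<Rightarrow> real"
proof -
  assume F: "test_fun F"
  obtain B K where K: "F \<in> borel_measurable borel" "\<And>y. \<bar>F y\<bar> \<le> B" "compact K" "\<And>y. y \<notin> K \<Longrightarrow> F y = 0"
    using F unfolding test_fun_def by blast
  have "(\<lambda>y. F (t + y)) \<in> borel_measurable borel" by (rule measurable_compose[OF measurable_translate K(1)])
  moreover have "F (t + y) = 0" if "y \<notin> (\<lambda>x. x - t) ` K" for y
    using that K(4)[of "t + y"] unfolding vimage_translate[symmetric] by simp
  ultimately show ?thesis unfolding test_fun_def using K(2) compact_translation_group(2)[OF K(3)] by blast
qed

text \<open>Lets one point of a coset be detected by the value of a periodisation.\<close>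

lemma periodise_ge_term:
  assumes F: "test_fun F" "\<And>y. 0 \<le> F y" and X: "X \<in> \<T>" "y \<in> X" shows "F y \<le> periodise F X"
proof -
  obtain B K where K: "F \<in> borel_measurable borel" "B \<ge> 0" "\<And>y. \<bar>F y\<bar> \<le> B" "compact K" "\<And>y. y \<notin> K \<Longrightarrow> F y = 0"
    by (rule test_funE[OF F(1)]) (rule that, blast+)
  show ?thesis
  proof (cases "y \<in> K")
    case True
    have "F y \<le> (\<Sum>y\<in>X \<inter> K. F y)" using True X by (intro member_le_sum F(2) finite_torus_Int[OF X(1) K(4)]) auto
    moreover have "periodise F X = (\<Sum>y\<in>X \<inter> K. F y)" by (rule periodise_eq[OF X(1) K(4)]) (rule K(5))
    ultimately show ?thesis by simp
  next
    case False
    then have "F y = 0" by (rule K(5))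
    then show ?thesis using F(2) by (simp add: periodise_def sum_nonneg)
  qed
qed

lemma periodise_nonneg: "(\<And>y. 0 \<le> F y) \<Longrightarrow> 0 \<le> periodise F X" by (simp add: periodise_def sum_nonneg)

section \<open>Haar measure on the torus\<close>

lemma haar_mX: "haar_measure (torus L) (torus_topology L) mX" and mX_1: "emeasure mX \<T> = 1"
  using mX by (simp_all add: normalised_haar_measure_def)

lemma sets_mX [measurable_cong]: "sets mX = sets borel_torus"
  using haar_mX by (simp add: haar_measure_def regular_borel_measure_def borel_torus_def)

lemma space_mX [simp]: "space mX = \<T>"
  using sets_eq_imp_space_eq[OF sets_mX] by simp

lemma prob_mX: "prob_space mX" by (rule prob_spaceI) (simp add: mX_1)

lemma measurable_act: "act t \<in> mX \<rightarrow>\<^sub>M mX"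
proof -
  have "(\<lambda>x. act t (q x)) \<in> borel \<rightarrow>\<^sub>M borel_torus"
    unfolding act_q by (rule measurable_compose[OF measurable_translate measurable_q])
  then have "act t \<in> borel_torus \<rightarrow>\<^sub>M borel_torus" by (rule measurable_via_q)
  then show ?thesis using measurable_cong_sets[OF sets_mX sets_mX] by blast
qed

text \<open>Haar measure on the torus is defined through the group operation of the quotient; here the
invariance is expressed by translations of \<open>G \<times> H\<close>.\<close>

lemma distr_act: "distr mX mX (act t) = mX"
proof (rule measure_eqI)
  fix A assume "A \<in> sets (distr mX mX (act t))"
  then have A: "A \<in> sets mX" by simp
  have sub: "A \<subseteq> \<T>" using sets.sets_into_space[OF A] by simp
  have eq: "act t -` A \<inter> \<T> = act (- t) ` A"
  proof (intro equalityI subsetI)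
    fix X assume "X \<in> act t -` A \<inter> \<T>"
    then have "act (- t) (act t X) \<in> act (- t) ` A" by blast
    then show "X \<in> act (- t) ` A" by (simp add: act_act)
  next
    fix X assume "X \<in> act (- t) ` A"
    then obtain Y where "Y \<in> A" "X = act (- t) Y" by blast
    then show "X \<in> act t -` A \<inter> \<T>" using sub by (auto simp: act_act)
  qed
  have "emeasure mX ((\<lambda>x. q (- t) \<otimes>\<^bsub>torus L\<^esub> x) ` A) = emeasure mX A"
    using haar_mX A by (simp add: haar_measure_def)
  moreover have "(\<lambda>x. q (- t) \<otimes>\<^bsub>torus L\<^esub> x) ` A = act (- t) ` A" using sub by (intro image_cong refl torus_mult) blast
  ultimately show "emeasure (distr mX mX (act t)) A = emeasure mX A"
    using A by (simp add: emeasure_distr[OF measurable_act] eq)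
qed simp

lemma integral_act:
  fixes f :: "_ \<Rightarrow> real"
  assumes "f \<in> borel_measurable mX" shows "(\<integral>X. f (act t X) \<partial>mX) = (\<integral>X. f X \<partial>mX)"
  using integral_distr[OF measurable_act[of t] assms] by (simp add: distr_act)

text \<open>The integral over a fundamental domain of the sum over \<open>L\<close>: as a functional of \<open>F\<close> it is
translation invariant, so it behaves as a Haar integral on \<open>G \<times> H\<close>.\<close>

definition torus_mean :: "('g \<times> 'h \<Rightarrow> real) \<Rightarrow> real" where "torus_mean F = (\<integral>X. periodise F X \<partial>mX)"

lemma integrable_bounded_torus:
  fixes f :: "_ \<Rightarrow> real"
  assumes "f \<in> borel_measurable borel_torus" "\<And>X. X \<in> \<T> \<Longrightarrow> \<bar>f X\<bar> \<le> B"
  shows "integrable mX f"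
proof -
  interpret prob_space mX by (rule prob_mX)
  show ?thesis using assms by (intro integrable_const_bound[where B=B]) (auto simp: measurable_cong_sets[OF sets_mX refl])
qed

lemma periodise_measurable: "test_fun F \<Longrightarrow> periodise F \<in> borel_measurable mX"
  using periodise_measurable_bounded(1) measurable_cong_sets[OF sets_mX refl] by blast

lemma periodise_integrable: "test_fun F \<Longrightarrow> integrable mX (periodise F)"
  using periodise_measurable_bounded[of F] integrable_bounded_torus by blast

lemma torus_mean_translate: "test_fun F \<Longrightarrow> torus_mean (\<lambda>y. F (t + y)) = torus_mean F"
  unfolding torus_mean_def periodise_act[symmetric] by (rule integral_act[OF periodise_measurable])

lemma torus_mean_mono: "test_fun F \<Longrightarrow> test_fun G \<Longrightarrow> (\<And>y. F y \<le> G y) \<Longrightarrow> torus_mean F \<le> torus_mean G"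
  unfolding torus_mean_def by (intro integral_mono periodise_integrable periodise_mono) auto

section \<open>The measures nuG\<close>

text \<open>The link between combs and the torus: integrals against \<open>nuG B X\<close> are values of a
periodisation at \<open>X\<close>.\<close>

lemma integral_nuG:
  assumes B: "B \<in> sets borel" and c: "c \<in> borel_measurable borel" "compact K" "\<And>x. x \<notin> K \<Longrightarrow> c x = 0"
    and cB: "compact (closure B)" and X: "X \<in> \<T>"
  shows "(\<integral>x. c x \<partial>nuG B X) = periodise (\<lambda>y. c (fst y) * indicator B (snd y)) X"
proof -
  let ?P = "X \<inter> (UNIV \<times> B)"
  have m1: "(\<lambda>y. y) \<in> count_space ?P \<rightarrow>\<^sub>M borel" by simp
  have m2: "fst \<in> (borel :: ('g \<times> 'h) measure) \<rightarrow>\<^sub>M borel" by (intro borel_measurable_continuous_onI continuous_on_fst continuous_on_id)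
  have m3: "fst \<in> nu B X \<rightarrow>\<^sub>M borel" unfolding nu_def dirac_comb_def using m2 by simp
  have m4: "(\<lambda>y. c (fst y)) \<in> borel_measurable (borel :: ('g \<times> 'h) measure)" by (rule measurable_compose[OF m2 c(1)])
  have "(\<integral>x. c x \<partial>nuG B X) = (\<integral>y. c (fst y) \<partial>nu B X)" unfolding nuG_def by (rule integral_distr[OF m3 c(1)])
  also have "\<dots> = (\<integral>y. c (fst y) \<partial>count_space ?P)" unfolding nu_def dirac_comb_def by (rule integral_distr[OF m1 m4])
  also have "\<dots> = (\<Sum>y | y \<in> ?P \<and> c (fst y) \<noteq> 0. c (fst y))"
  proof (rule lebesgue_integral_count_space_finite_support)
    have "fst y \<in> K" if "c (fst y) \<noteq> 0" for y :: "'g \<times> 'h" using c(3)[of "fst y"] that by blast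
    then have "{y \<in> ?P. c (fst y) \<noteq> 0} \<subseteq> X \<inter> (K \<times> closure B)" using closure_subset[of B] by (auto simp: mem_Times_iff)
    then show "finite {y \<in> ?P. c (fst y) \<noteq> 0}" using finite_torus_Int[OF X compact_Times[OF c(2) cB]] by (rule finite_subset)
  qed
  also have "\<dots> = (\<Sum>y | y \<in> ?P \<and> c (fst y) \<noteq> 0. c (fst y) * indicator B (snd y))"
    by (rule sum.cong) (auto simp: mem_Times_iff)
  also have "{y. y \<in> ?P \<and> c (fst y) \<noteq> 0} = {y \<in> X. c (fst y) * indicator B (snd y) \<noteq> 0}" by (auto simp: mem_Times_iff indicator_def)
  finally show ?thesis unfolding periodise_def .
qed

lemma emeasure_nuG:
  fixes B :: "'h set" and X :: "('g \<times> 'h) set"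
  assumes A: "A \<in> sets borel"
  shows "emeasure (nuG B X) A = emeasure (count_space (X \<inter> (UNIV \<times> B))) {y \<in> X \<inter> (UNIV \<times> B). fst y \<in> A}"
proof -
  let ?P = "X \<inter> (UNIV \<times> B)"
  have m1: "(\<lambda>y. y) \<in> count_space ?P \<rightarrow>\<^sub>M borel" by simp
  have m2: "fst \<in> (borel :: ('g \<times> 'h) measure) \<rightarrow>\<^sub>M borel" by (intro borel_measurable_continuous_onI continuous_on_fst continuous_on_id)
  have m3: "fst \<in> nu B X \<rightarrow>\<^sub>M borel" unfolding nu_def dirac_comb_def using m2 by simp
  have "emeasure (nuG B X) A = emeasure (nu B X) (fst -` A \<inter> space (nu B X))"
    unfolding nuG_def by (rule emeasure_distr[OF m3 A])
  also have "\<dots> = emeasure (nu B X) (fst -` A)" by (simp add: nu_def dirac_comb_def)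
  also have "\<dots> = emeasure (count_space ?P) ((\<lambda>y. y) -` (fst -` A) \<inter> space (count_space ?P))"
    unfolding nu_def dirac_comb_def using measurable_sets[OF m2 A] by (intro emeasure_distr[OF m1]) simp
  also have "(\<lambda>y. y) -` (fst -` A) \<inter> space (count_space ?P) = {y \<in> ?P. fst y \<in> A}" by auto
  finally show ?thesis .
qed

text \<open>A point off the set has a relatively compact neighbourhood, which meets the set in finitely
many points only.\<close>

lemma locally_finite_closed:
  fixes S :: "'a::t2_space set"
  assumes lc: "locally_compact_space (euclidean :: 'a topology)" and "\<And>K. compact K \<Longrightarrow> finite (S \<inter> K)"
  shows "closed S"
proof -
  have "\<exists>T. open T \<and> x \<in> T \<and> T \<subseteq> - S" if "x \<in> - S" for x
  proof -
    obtain V where V: "open V" "x \<in> V" "compact (closure V)" "closure V \<subseteq> UNIV"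
      by (rule lc_nbhd[OF lc open_UNIV UNIV_I])
    have "closed (S \<inter> closure V)" using assms(2)[OF V(3)] by (rule finite_imp_closed)
    then have "open (V - S \<inter> closure V)" using V(1) by (rule open_Diff[rotated])
    then show ?thesis using V(2) that closure_subset[of V] by (intro exI[of _ "V - S \<inter> closure V"]) auto
  qed
  note * = this
  have "open (- S)" by (rule open_subopen[THEN iffD2]) (rule ballI, rule *)
  then show ?thesis by (simp add: closed_def)
qed

text \<open>A locally finite counting measure is regular for a direct reason: the atoms outside a given
set form a closed set, whose complement is an optimal open superset, and finite sets of
atoms are the compact sets that approximate from within.\<close>

lemma regular_nuG:
  assumes cB: "compact (closure B)" and X: "X \<in> \<T>"
  shows "regular_borel_measure euclidean (nuG B X)"
proof -
  let ?P = "X \<inter> (UNIV \<times> B)"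
  let ?m = "nuG B X :: 'g measure"
  have st: "sets ?m = sets borel" by (simp add: nuG_def)
  have fin: "finite {y \<in> ?P. fst y \<in> K}" if "compact K" for K
  proof -
    have "{y \<in> ?P. fst y \<in> K} \<subseteq> X \<inter> (K \<times> closure B)" using closure_subset[of B] by (auto simp: mem_Times_iff)
    then show ?thesis using finite_torus_Int[OF X compact_Times[OF that cB]] by (rule finite_subset)
  qed
  have "emeasure ?m K < \<infinity>" if "compact K" for K
  proof -
    have bK: "K \<in> sets borel" by (rule borel_closed[OF compact_imp_closed[OF that]])
    have "{y \<in> ?P. fst y \<in> K} \<subseteq> ?P" by blast
    then have "emeasure ?m K = of_nat (card {y \<in> ?P. fst y \<in> K})"
      unfolding emeasure_nuG[OF bK] using fin[OF that] by (simp only: emeasure_count_space if_True)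
    then show ?thesis by (simp only:) (simp add: less_top[symmetric])
  qed
  moreover have "emeasure ?m A = (INF U\<in>{U. open U \<and> A \<subseteq> U}. emeasure ?m U)" if A: "A \<in> sets borel" for A
  proof (rule antisym)
    show "emeasure ?m A \<le> (INF U\<in>{U. open U \<and> A \<subseteq> U}. emeasure ?m U)"
      by (intro INF_greatest emeasure_mono) (auto simp: st)
    \<comment> \<open>The atoms outside \<open>A\<close>.\<close>
    define S where "S = fst ` {y \<in> ?P. fst y \<notin> A}"
    have "finite (S \<inter> K)" if "compact K" for K
    proof -
      have "S \<inter> K \<subseteq> fst ` {y \<in> ?P. fst y \<in> K}" by (auto simp: S_def)
      then show ?thesis using fin[OF that] by (meson finite_imageI finite_subset)
    qed
    then have "closed S" by (rule locally_finite_closed[OF lcG])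
    then have o: "open (- S)" "A \<subseteq> - S" by (auto simp: S_def)
    have "{y \<in> ?P. fst y \<in> - S} = {y \<in> ?P. fst y \<in> A}" by (auto simp: S_def)
    then have "emeasure ?m (- S) = emeasure ?m A" using A o(1) by (simp add: emeasure_nuG)
    then show "(INF U\<in>{U. open U \<and> A \<subseteq> U}. emeasure ?m U) \<le> emeasure ?m A"
      using o by (intro INF_lower2[of "- S"]) auto
  qed
  moreover have "emeasure ?m U = (SUP K\<in>{K. compact K \<and> K \<subseteq> U}. emeasure ?m K)" if U: "open U" for U
  proof (rule antisym)
    show "(SUP K\<in>{K. compact K \<and> K \<subseteq> U}. emeasure ?m K) \<le> emeasure ?m U"
      using U by (intro SUP_least emeasure_mono) (auto simp: st)
    let ?E = "{y \<in> ?P. fst y \<in> U}"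
    have low: "of_nat (card F) \<le> emeasure ?m (fst ` F)" if F: "F \<subseteq> ?E" "finite F" for F
    proof -
      have "fst ` F \<in> sets borel" using F(2) by (intro borel_closed finite_imp_closed finite_imageI)
      then have "emeasure ?m (fst ` F) = emeasure (count_space ?P) {y \<in> ?P. fst y \<in> fst ` F}" by (rule emeasure_nuG)
      moreover have "emeasure (count_space ?P) F \<le> emeasure (count_space ?P) {y \<in> ?P. fst y \<in> fst ` F}"
        using F by (intro emeasure_mono) auto
      moreover have "emeasure (count_space ?P) F = of_nat (card F)" using F by (subst emeasure_count_space) auto
      ultimately show ?thesis by simp
    qed
    have mem: "fst ` F \<in> {K. compact K \<and> K \<subseteq> U}" if "F \<subseteq> ?E" "finite F" for F
      using that by (auto intro: finite_imp_compact)
    show "emeasure ?m U \<le> (SUP K\<in>{K. compact K \<and> K \<subseteq> U}. emeasure ?m K)"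
    proof (cases "finite ?E")
      case True
      have bU: "U \<in> sets borel" using U by simp
      have "?E \<subseteq> ?P" by blast
      then have "emeasure ?m U = of_nat (card ?E)"
        unfolding emeasure_nuG[OF bU] using True by (simp only: emeasure_count_space if_True)
      then show ?thesis using low[OF subset_refl True] mem[OF subset_refl True] by (intro SUP_upper2[of "fst ` ?E"]) simp_all
    next
      case False
      have "(SUP K\<in>{K. compact K \<and> K \<subseteq> U}. emeasure ?m K) = top_class.top"
      proof (rule ennreal_SUP_eq_top)
        fix n :: nat
        obtain F where F: "finite F" "card F = n" "F \<subseteq> ?E" using infinite_arbitrarily_large[OF False] by blast
        then show "\<exists>K\<in>{K. compact K \<and> K \<subseteq> U}. of_nat n \<le> emeasure ?m K" using low[OF F(3,1)] mem[OF F(3,1)] by blast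
      qed
      then show ?thesis by (simp only: top_greatest)
    qed
  qed
  ultimately show ?thesis
    unfolding regular_borel_measure_def borel_of_euclidean st compactin_euclidean_iff open_openin[symmetric] by blast
qed

lemma nuG_act:
  assumes B: "B \<in> sets borel" "compact (closure B)" and X: "X \<in> \<T>"
  shows "nuG B (act (g, 0) X) = translate g (nuG B X)"
proof (rule regular_measure_eqI[OF lcG])
  show "regular_borel_measure euclidean (nuG B (act (g, 0) X))" by (rule regular_nuG[OF B(2) act_torus[OF X]])
  show "regular_borel_measure euclidean (translate g (nuG B X))" by (rule regular_translate[OF regular_nuG[OF B(2) X]])
  fix c :: "'g \<Rightarrow> real" assume c: "c \<in> compactly_supported"
  note c' = compactly_supportedD[OF c] and t' = compactly_supportedD[OF compactly_supported_translate[OF c, of g]]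
  have "(\<integral>x. c x \<partial>nuG B (act (g, 0) X)) = periodise (\<lambda>y. c (fst y) * indicator B (snd y)) (act (g, 0) X)"
    by (rule integral_nuG[OF B(1) borel_measurable_continuous_onI[OF c'(1)] c'(2) c'(3) B(2) act_torus[OF X]])
  also have "\<dots> = periodise (\<lambda>y. c (g + fst y) * indicator B (snd y)) X" by (simp add: periodise_act)
  also have "\<dots> = (\<integral>x. c (g + x) \<partial>nuG B X)"
    by (rule integral_nuG[OF B(1) borel_measurable_continuous_onI[OF t'(1)] t'(2) t'(3) B(2) X, symmetric])
  also have "\<dots> = (\<integral>x. c x \<partial>translate g (nuG B X))"
    by (rule integral_translate[symmetric, OF _ c'(1)]) (simp add: nuG_def)
  finally show "(\<integral>x. c x \<partial>nuG B (act (g, 0) X)) = (\<integral>x. c x \<partial>translate g (nuG B X))" .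
qed

end

text \<open>Its periodisation at \<open>X\<close> is the integral of \<open>c\<close> against \<open>nuG B X\<close>.\<close>

definition tensor :: "('a \<Rightarrow> real) \<Rightarrow> 'b set \<Rightarrow> 'a \<times> 'b \<Rightarrow> real" where
  "tensor c B y = c (fst y) * indicator B (snd y)"

text \<open>Windows are both Borel and relatively compact, so the two conditions travel together.\<close>

definition rel_compact :: "'a::topological_space set \<Rightarrow> bool" where
  "rel_compact B \<longleftrightarrow> B \<in> sets borel \<and> compact (closure B)"

lemma rel_compact_subset:
  assumes "rel_compact B" "A \<subseteq> B" "A \<in> sets borel" shows "rel_compact (A :: 'a::t2_space set)"
proof -
  have "closure A \<subseteq> closure B" using assms(2) by (rule closure_mono)
  then have "compact (closure A)"
    using assms(1) compact_Int_closed[of "closure B" "closure A"] by (simp add: rel_compact_def inf.absorb2)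
  then show ?thesis using assms(3) by (simp add: rel_compact_def)
qed

lemma rel_compact_compact: "compact K \<Longrightarrow> rel_compact (K :: 'a::t2_space set)"
  unfolding rel_compact_def using borel_closed[OF compact_imp_closed] compact_imp_closed[of K] by (simp add: closure_closed)

lemma rel_compact_Int: "rel_compact B \<Longrightarrow> A \<in> sets borel \<Longrightarrow> rel_compact (A \<inter> B :: 'a::t2_space set)"
  by (rule rel_compact_subset[of B]) (auto simp: rel_compact_def)

lemma rel_compact_Diff: "rel_compact B \<Longrightarrow> A \<in> sets borel \<Longrightarrow> rel_compact (B - A :: 'a::t2_space set)"
  by (rule rel_compact_subset[of B]) (auto simp: rel_compact_def)

lemma rel_compact_vimage_add:
  fixes B :: "'a::{t2_space,topological_ab_group_add} set"
  assumes "rel_compact B" shows "rel_compact ((\<lambda>x. h + x) -` B)"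
proof -
  have b: "B \<in> sets borel" "compact (closure B)" using assms by (auto simp: rel_compact_def)
  have "(\<lambda>x. h + x) -` B \<in> sets borel" using measurable_sets[OF measurable_translate[of h] b(1)] by simp
  moreover have "(\<lambda>x. h + x) -` B \<subseteq> (\<lambda>x. x - h) ` closure B"
    unfolding vimage_translate by (intro image_mono closure_subset)
  ultimately show ?thesis by (rule rel_compact_subset[OF rel_compact_compact[OF compact_translation_group(2)[OF b(2)]], rotated])
qed

lemma rel_compact_uminus:
  fixes B :: "'a::{t2_space,topological_ab_group_add} set"
  assumes "rel_compact B" shows "rel_compact (uminus ` B)"
proof -
  have b: "B \<in> sets borel" "compact (closure B)" using assms by (auto simp: rel_compact_def)
  have m: "(uminus :: 'a \<Rightarrow> 'a) \<in> borel \<rightarrow>\<^sub>M borel"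
    by (intro borel_measurable_continuous_onI continuous_on_minus continuous_on_id)
  have eq: "uminus ` B = uminus -` B" by (auto simp: image_iff) (metis minus_minus)
  have "uminus ` B \<in> sets borel" using measurable_sets[OF m b(1)] by (simp add: eq)
  moreover have c: "compact (uminus ` closure B)"
    by (rule compact_continuous_image[OF continuous_on_minus[OF continuous_on_id] b(2)])
  moreover have "uminus ` B \<subseteq> uminus ` closure B" by (intro image_mono closure_subset)
  ultimately show ?thesis by (intro rel_compact_subset[OF rel_compact_compact[OF c]])
qed

lemma test_fun_tensor:
  fixes c :: "'a::{second_countable_topology,t2_space} \<Rightarrow> real" and B :: "'b::{second_countable_topology,t2_space} set"
  assumes c: "test_fun c" and B: "rel_compact B" shows "test_fun (tensor c B)"
proof -
  obtain M K where K: "c \<in> borel_measurable borel" "\<And>y. \<bar>c y\<bar> \<le> M" "compact K" "\<And>y. y \<notin> K \<Longrightarrow> c y = 0"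
    using c unfolding test_fun_def by blast
  have b: "B \<in> sets borel" "compact (closure B)" using B by (auto simp: rel_compact_def)
  have m1: "fst \<in> (borel :: ('a \<times> 'b) measure) \<rightarrow>\<^sub>M borel" by (intro borel_measurable_continuous_onI continuous_on_fst continuous_on_id)
  have m2: "snd \<in> (borel :: ('a \<times> 'b) measure) \<rightarrow>\<^sub>M borel" by (intro borel_measurable_continuous_onI continuous_on_snd continuous_on_id)
  have i: "(indicator B :: 'b \<Rightarrow> real) \<in> borel_measurable borel" using b(1) by (rule borel_measurable_indicator)
  have "tensor c B \<in> borel_measurable borel" unfolding tensor_def[abs_def]
    by (rule borel_measurable_times[OF measurable_compose[OF m1 K(1)] measurable_compose[OF m2 i]])
  moreover have "\<bar>tensor c B y\<bar> \<le> M" for y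
    using K(2)[of "fst y"] abs_ge_zero[of "c (fst y)"] unfolding tensor_def by (cases "snd y \<in> B") auto
  moreover have "tensor c B y = 0" if "y \<notin> K \<times> closure B" for y
    using that K(4)[of "fst y"] closure_subset[of B] by (cases "fst y \<in> K") (auto simp: tensor_def mem_Times_iff indicator_def)
  ultimately show ?thesis unfolding test_fun_def using compact_Times[OF K(3) b(2)] by blast
qed

lemma test_fun_indicator: "rel_compact B \<Longrightarrow> test_fun (indicator B :: 'a::t2_space \<Rightarrow> real)"
proof -
  assume B: "rel_compact B"
  then have b: "B \<in> sets borel" "compact (closure B)" by (auto simp: rel_compact_def)
  have "indicator B y = (0::real)" if "y \<notin> closure B" for y using that closure_subset[of B] by (auto simp: indicator_def)
  moreover have "\<bar>indicator B y :: real\<bar> \<le> 1" for y by (simp add: indicator_def)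
  ultimately show ?thesis unfolding test_fun_def using borel_measurable_indicator[OF b(1)] b(2) by blast
qed

lemma test_fun_abs: "test_fun c \<Longrightarrow> test_fun (\<lambda>x. \<bar>c x\<bar>)"
  unfolding test_fun_def by (metis abs_abs abs_0 borel_measurable_abs)

locale haar_scheme = torus_scheme L mX
  for L :: "('g::{topological_ab_group_add, second_countable_topology, t2_space} \<times>
               'h::{topological_ab_group_add, second_countable_topology, t2_space}) set"
  and mX +
  fixes mH :: "'h measure" and W :: "'h set"
  assumes haar_H: "haar_measure additive_group euclidean mH"
    and W_borel: "W \<in> sets borel" and W_compact: "compact (closure W)" and W_pos: "emeasure mH W > 0"
begin

lemma regular_mH: "regular_borel_measure euclidean mH"
  using haar_H unfolding haar_measure_def by simp

lemma sets_mH [measurable_cong]: "sets mH = sets borel" by (rule regular_sets[OF regular_mH])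
lemma space_mH [simp]: "space mH = UNIV" using sets_eq_imp_space_eq[OF sets_mH] by simp

lemma rel_compact_W: "rel_compact W" using W_borel W_compact by (simp add: rel_compact_def)

lemma mH_translate: "A \<in> sets borel \<Longrightarrow> emeasure mH ((\<lambda>x. a + x) ` A) = emeasure mH A"
  using haar_H unfolding haar_measure_def by (simp add: additive_group_def sets_mH)

lemma mH_vimage: "A \<in> sets borel \<Longrightarrow> emeasure mH ((\<lambda>x. a + x) -` A) = emeasure mH A"
  using mH_translate[of A "- a"] vimage_translate[of a A] by simp

lemma mH_finite: assumes "rel_compact B" shows "emeasure mH B < \<infinity>"
proof -
  have "emeasure mH B \<le> emeasure mH (closure B)" by (intro emeasure_mono closure_subset) (simp add: sets_mH)
  also have "\<dots> < \<infinity>" using regular_finite[OF regular_mH] assms unfolding rel_compact_def by blast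
  finally show ?thesis .
qed

lemma fmeasurable_mH: "rel_compact B \<Longrightarrow> B \<in> fmeasurable mH"
  using mH_finite[of B] by (intro fmeasurableI) (auto simp: rel_compact_def sets_mH)

lemma emeasure_mH: "rel_compact B \<Longrightarrow> emeasure mH B = ennreal (measure mH B)"
  using mH_finite[of B] by (intro emeasure_eq_ennreal_measure) auto

lemma W_pos': "measure mH W > 0"
  using W_pos unfolding emeasure_mH[OF rel_compact_W] by simp

lemma sigma_finite_mH: "sigma_finite_measure mH"
proof -
  obtain Q :: "nat \<Rightarrow> 'h set" where Q: "\<And>n. open (Q n)" "\<And>n. compact (closure (Q n))" "incseq Q"
    "\<And>K. compact K \<Longrightarrow> \<exists>n. K \<subseteq> Q n"
    using lc_exhaustion[OF lcH] by blast
  show ?thesis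
  proof
    have "\<Union> (range Q) = UNIV"
    proof -
      have "\<exists>n. x \<in> Q n" for x using Q(4)[of "{x}"] by simp
      then show ?thesis by blast
    qed
    moreover have "\<forall>a\<in>range Q. emeasure mH a \<noteq> \<infinity>" using mH_finite Q(1,2) unfolding rel_compact_def by (auto simp: less_top)
    ultimately show "\<exists>A. countable A \<and> A \<subseteq> sets mH \<and> \<Union> A = space mH \<and> (\<forall>a\<in>A. emeasure mH a \<noteq> \<infinity>)"
      using Q(1) by (intro exI[of _ "range Q"]) (auto simp: sets_mH)
  qed
qed

text \<open>Tonelli's theorem for the torus and \<open>H\<close>. The set \<open>E\<close> couples the second coordinate of a
point of the coset with the variable \<open>h\<close>, and all its vertical sections have the same
measure \<open>e\<close>, so this measure factors out. The Borel section turns the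
sum over a coset into a finite sum that is jointly measurable.\<close>

lemma mean_Fubini:
  fixes e :: ennreal
  assumes c: "test_fun c" "\<And>x. 0 \<le> c x" and A: "rel_compact A" and E: "E \<in> sets (borel :: ('h \<times> 'h) measure)"
    and e: "\<And>t. emeasure mH {h. (t, h) \<in> E} = e"
  shows "(\<integral>\<^sup>+h. ennreal (torus_mean (\<lambda>y. tensor c A y * indicator E (snd y, h))) \<partial>mH) = ennreal (torus_mean (tensor c A)) * e"
proof -
  interpret P: prob_space mX by (rule prob_mX)
  interpret H: sigma_finite_measure mH by (rule sigma_finite_mH)
  interpret PS: pair_sigma_finite mH mX by unfold_locales
  obtain M K where K: "tensor c A \<in> borel_measurable borel" "M \<ge> 0" "\<And>y. \<bar>tensor c A y\<bar> \<le> M" "compact K" "\<And>y. y \<notin> K \<Longrightarrow> tensor c A y = 0"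
    by (rule test_funE[OF test_fun_tensor[OF c(1) A]]) (rule that, blast+)
  obtain s C0 where s: "s \<in> borel_torus \<rightarrow>\<^sub>M borel" "compact C0" "\<And>X. X \<in> \<T> \<Longrightarrow> s X \<in> X" "\<And>X. X \<in> \<T> \<Longrightarrow> s X \<in> C0"
    by (rule borel_section) (rule that, blast+)
  have s': "s \<in> mX \<rightarrow>\<^sub>M borel" using s(1) measurable_cong_sets[OF sets_mX refl] by blast
  define F where "F h y = tensor c A y * indicator E (snd y, h)" for h y
  have F0: "0 \<le> F h y" for h y using c(2) by (simp add: F_def tensor_def)
  have m1: "snd \<in> (borel :: ('g \<times> 'h) measure) \<rightarrow>\<^sub>M borel" by (intro borel_measurable_continuous_onI continuous_on_snd continuous_on_id)
  have iE: "(indicator E :: 'h \<times> 'h \<Rightarrow> real) \<in> borel_measurable (borel \<Otimes>\<^sub>M borel)"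
    using borel_measurable_indicator[OF E] by (simp add: borel_prod)
  have pm: "(\<lambda>y. (snd y, h)) \<in> (borel :: ('g \<times> 'h) measure) \<rightarrow>\<^sub>M borel \<Otimes>\<^sub>M borel" for h
    using m1 by (intro measurable_Pair) simp_all
  have F_test_fun: "test_fun (F h)" for h
  proof -
    have "F h \<in> borel_measurable borel" unfolding F_def[abs_def]
      by (rule borel_measurable_times[OF K(1) measurable_compose[OF pm iE]])
    moreover have "\<bar>F h y\<bar> \<le> M" for y using K(2) K(3)[of y] by (cases "(snd y, h) \<in> E") (simp_all add: F_def)
    moreover have "F h y = 0" if "y \<notin> K" for y using K(5)[OF that] by (simp add: F_def)
    ultimately show ?thesis unfolding test_fun_def using K(4) by blast
  qed
  have perF: "periodise (F h) X = (\<Sum>l\<in>lattice_hits C0 K. F h (l + s X))" if X: "X \<in> \<T>" for h X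
  proof -
    have "periodise (F h) (q (s X)) = (\<Sum>l\<in>lattice_hits C0 K. F h (l + s X))" by (rule periodise_lattice_sum[OF s(4)[OF X] s(2) K(4)]) (simp add: F_def K(5))
    then show ?thesis unfolding torus_eq_q[OF X s(3)[OF X], symmetric] .
  qed
  have perT: "periodise (tensor c A) X = (\<Sum>l\<in>lattice_hits C0 K. tensor c A (l + s X))" if X: "X \<in> \<T>" for X
  proof -
    have "periodise (tensor c A) (q (s X)) = (\<Sum>l\<in>lattice_hits C0 K. tensor c A (l + s X))" by (rule periodise_lattice_sum[OF s(4)[OF X] s(2) K(4)]) (rule K(5))
    then show ?thesis unfolding torus_eq_q[OF X s(3)[OF X], symmetric] .
  qed
  have ml: "(\<lambda>X. l + s X) \<in> mX \<rightarrow>\<^sub>M borel" for l by (rule measurable_compose[OF s' measurable_translate])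
  have t0: "0 \<le> tensor c A y" for y using c(2) by (simp add: tensor_def)
  have secE: "{h. (t, h) \<in> E} \<in> sets mH" for t
    using sets_Pair1[of E borel borel t] E by (simp add: borel_prod sets_mH vimage_def)
  have 1: "ennreal (torus_mean (F h)) = (\<integral>\<^sup>+X. ennreal (periodise (F h) X) \<partial>mX)" for h
    unfolding torus_mean_def by (rule nn_integral_eq_integral[symmetric, OF periodise_integrable[OF F_test_fun]])
      (use F0 in \<open>auto intro!: AE_I2 sum_nonneg simp: periodise_def\<close>)
  have "(\<integral>\<^sup>+h. ennreal (torus_mean (F h)) \<partial>mH) = (\<integral>\<^sup>+h. (\<integral>\<^sup>+X. (\<Sum>l\<in>lattice_hits C0 K. ennreal (F h (l + s X))) \<partial>mX) \<partial>mH)"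
    unfolding 1 by (intro nn_integral_cong) (simp add: perF sum_ennreal F0)
  also have "\<dots> = (\<integral>\<^sup>+X. (\<integral>\<^sup>+h. (\<Sum>l\<in>lattice_hits C0 K. ennreal (F h (l + s X))) \<partial>mH) \<partial>mX)"
  proof (rule PS.Fubini'[symmetric])
    have "(\<lambda>p. tensor c A (l + s (snd p)) * indicator E (snd (l + s (snd p)), fst p)) \<in> borel_measurable (mH \<Otimes>\<^sub>M mX)" for l
    proof -
      have a: "(\<lambda>p. l + s (snd p)) \<in> mH \<Otimes>\<^sub>M mX \<rightarrow>\<^sub>M borel" by (rule measurable_compose[OF measurable_snd ml])
      have b: "(\<lambda>p. (snd (l + s (snd p)), fst p)) \<in> mH \<Otimes>\<^sub>M mX \<rightarrow>\<^sub>M borel \<Otimes>\<^sub>M borel"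
        using measurable_fst[of mH mX] by (intro measurable_Pair measurable_compose[OF a m1]) (simp add: measurable_cong_sets[OF refl sets_mH])
      show ?thesis by (rule borel_measurable_times[OF measurable_compose[OF a K(1)] measurable_compose[OF b iE]])
    qed
    then show "(\<lambda>(h, X). \<Sum>l\<in>lattice_hits C0 K. ennreal (F h (l + s X))) \<in> borel_measurable (mH \<Otimes>\<^sub>M mX)"
      unfolding F_def case_prod_beta by (intro borel_measurable_sum measurable_compose[OF _ measurable_ennreal])
  qed
  also have "\<dots> = (\<integral>\<^sup>+X. ennreal (periodise (tensor c A) X) * e \<partial>mX)"
  proof (rule nn_integral_cong)
    fix X assume "X \<in> space mX"
    then have X: "X \<in> \<T>" by simp
    have "(\<integral>\<^sup>+h. (\<Sum>l\<in>lattice_hits C0 K. ennreal (F h (l + s X))) \<partial>mH) = (\<integral>\<^sup>+h. (\<Sum>l\<in>lattice_hits C0 K. ennreal (tensor c A (l + s X)) * indicator {h. (snd (l + s X), h) \<in> E} h) \<partial>mH)"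
      by (intro nn_integral_cong sum.cong refl) (simp add: F_def indicator_def)
    also have "\<dots> = (\<Sum>l\<in>lattice_hits C0 K. \<integral>\<^sup>+h. ennreal (tensor c A (l + s X)) * indicator {h. (snd (l + s X), h) \<in> E} h \<partial>mH)"
      using secE by (intro nn_integral_sum borel_measurable_times_ennreal borel_measurable_const borel_measurable_indicator)
    also have "\<dots> = (\<Sum>l\<in>lattice_hits C0 K. ennreal (tensor c A (l + s X)) * e)"
      using secE by (intro sum.cong refl) (simp add: nn_integral_cmult_indicator e)
    also have "\<dots> = ennreal (periodise (tensor c A) X) * e"
      unfolding perT[OF X] using t0 by (simp add: sum_distrib_right[symmetric] sum_ennreal)
    finally show "(\<integral>\<^sup>+h. (\<Sum>l\<in>lattice_hits C0 K. ennreal (F h (l + s X))) \<partial>mH) = ennreal (periodise (tensor c A) X) * e" .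
  qed
  also have "\<dots> = (\<integral>\<^sup>+X. ennreal (periodise (tensor c A) X) \<partial>mX) * e"
    using periodise_measurable[OF test_fun_tensor[OF c(1) A]] by (intro nn_integral_multc measurable_compose[OF _ measurable_ennreal])
  also have "(\<integral>\<^sup>+X. ennreal (periodise (tensor c A) X) \<partial>mX) = ennreal (torus_mean (tensor c A))"
    unfolding torus_mean_def by (rule nn_integral_eq_integral[OF periodise_integrable[OF test_fun_tensor[OF c(1) A]]])
      (use t0 in \<open>auto intro!: AE_I2 sum_nonneg simp: periodise_def\<close>)
  finally show ?thesis unfolding F_def .
qed

text \<open>The classical proof of uniqueness of Haar measure: both sides are the double integral of
\<open>c (fst y) * indicator N (snd y) * indicator J (snd y - h)\<close>. Integrating over \<open>h\<close> first gives the left side; shifting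
\<open>y\<close> by \<open>(0, h)\<close> beforehand gives the right side.\<close>

lemma mean_exchange:
  assumes c: "test_fun c" "\<And>x. 0 \<le> c x" and N: "rel_compact N" and J: "rel_compact J"
  shows "ennreal (torus_mean (tensor c N)) * emeasure mH (uminus ` J) = ennreal (torus_mean (tensor c J)) * emeasure mH N"
proof -
  have bN: "N \<in> sets borel" and bJ: "J \<in> sets borel" using N J by (auto simp: rel_compact_def)
  \<comment> \<open>The sections at \<open>t\<close> are the translates \<open>t - J\<close> and \<open>N - t\<close>.\<close>
  let ?E1 = "{p :: 'h \<times> 'h. fst p - snd p \<in> J}" and ?E2 = "{p :: 'h \<times> 'h. fst p + snd p \<in> N}"
  have m1: "(\<lambda>p :: 'h \<times> 'h. fst p - snd p) \<in> borel \<rightarrow>\<^sub>M borel"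
    by (intro borel_measurable_continuous_onI continuous_intros)
  have m2: "(\<lambda>p :: 'h \<times> 'h. fst p + snd p) \<in> borel \<rightarrow>\<^sub>M borel"
    by (intro borel_measurable_continuous_onI continuous_intros)
  have E: "?E1 \<in> sets borel" "?E2 \<in> sets borel"
    using measurable_sets[OF m1 bJ] measurable_sets[OF m2 bN] by (simp_all add: vimage_def)
  have e1: "emeasure mH {h. (t, h) \<in> ?E1} = emeasure mH (uminus ` J)" for t
  proof -
    have "{h. (t, h) \<in> ?E1} = (\<lambda>x. t + x) ` (uminus ` J)"
    proof (intro equalityI subsetI)
      fix h assume "h \<in> {h. (t, h) \<in> ?E1}"
      then have "t + - (t - h) \<in> (\<lambda>x. t + x) ` (uminus ` J)" by (intro imageI) simp
      then show "h \<in> (\<lambda>x. t + x) ` (uminus ` J)" by simp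
    qed auto
    then show ?thesis using mH_translate[of "uminus ` J" t] rel_compact_uminus[OF J] by (simp add: rel_compact_def)
  qed
  have e2: "emeasure mH {h. (t, h) \<in> ?E2} = emeasure mH N" for t
    using mH_vimage[OF bN, of t] by (simp add: vimage_def)
  \<comment> \<open>The shift by \<open>(0, h)\<close> exchanges the roles of the two sets.\<close>
  have "torus_mean (\<lambda>y. tensor c N y * indicator ?E1 (snd y, h)) = torus_mean (\<lambda>y. tensor c J y * indicator ?E2 (snd y, h))" for h
  proof -
    let ?F = "\<lambda>y :: 'g \<times> 'h. tensor c N y * indicator ?E1 (snd y, h)"
    have F: "?F = tensor c (N \<inter> (\<lambda>x. - h + x) -` J)" by (auto simp: tensor_def fun_eq_iff indicator_def)
    have "(\<lambda>x. - h + x) -` J \<in> sets borel" using rel_compact_vimage_add[OF J, of "- h"] unfolding rel_compact_def by blast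
    then have "rel_compact (N \<inter> (\<lambda>x. - h + x) -` J)" unfolding Int_commute[of N] by (rule rel_compact_Int[OF N])
    then have "test_fun ?F" unfolding F by (rule test_fun_tensor[OF c(1)])
    from torus_mean_translate[OF this, of "(0, h)"]
    have "torus_mean ?F = torus_mean (\<lambda>y. ?F ((0, h) + y))" by simp
    also have "(\<lambda>y. ?F ((0, h) + y)) = (\<lambda>y. tensor c J y * indicator ?E2 (snd y, h))"
      by (auto simp: tensor_def fun_eq_iff indicator_def add.commute)
    finally show ?thesis .
  qed
  then show ?thesis using mean_Fubini[OF c N E(1) e1] mean_Fubini[OF c J E(2) e2] by simp
qed

text \<open>The choice \<open>J = - W\<close> makes the reflected set equal to \<open>W\<close>, whose measure is positive and
finite; so proportionality follows without comparing Haar measure with its reflection.\<close>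

lemma mean_tensor:
  assumes c: "test_fun c" "\<And>x. 0 \<le> c x"
  obtains k where "k \<ge> 0" "\<forall>N. rel_compact N \<longrightarrow> torus_mean (tensor c N) = k * measure mH N"
proof -
  let ?J = "uminus ` W"
  have J: "rel_compact ?J" by (rule rel_compact_uminus[OF rel_compact_W])
  have JJ: "uminus ` ?J = W" by (simp add: image_image)
  have nn: "0 \<le> torus_mean (tensor c N)" for N
    unfolding torus_mean_def by (intro integral_nonneg_AE AE_I2) (auto simp: periodise_def tensor_def c(2) intro!: sum_nonneg)
  define k where "k = torus_mean (tensor c ?J) / measure mH W"
  have "torus_mean (tensor c N) = k * measure mH N" if N: "rel_compact N" for N
  proof -
    have "ennreal (torus_mean (tensor c N)) * ennreal (measure mH W) = ennreal (torus_mean (tensor c ?J)) * ennreal (measure mH N)"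
      using mean_exchange[OF c N J] unfolding JJ emeasure_mH[OF rel_compact_W] emeasure_mH[OF N] .
    then have "ennreal (torus_mean (tensor c N) * measure mH W) = ennreal (torus_mean (tensor c ?J) * measure mH N)"
      using nn by (simp add: ennreal_mult)
    then have "torus_mean (tensor c N) * measure mH W = torus_mean (tensor c ?J) * measure mH N" using nn by simp
    then show ?thesis using W_pos' by (simp add: k_def field_simps)
  qed
  then show ?thesis using that[of k] nn[of ?J] W_pos' by (simp add: k_def)
qed

text \<open>If all proportionality constants were zero, almost every coset would miss every one of
countably many relatively compact boxes that exhaust \<open>G \<times> H\<close>.\<close>

lemma mean_tensor_pos:
  obtains c k where "c \<in> compactly_supported" "\<forall>x. 0 \<le> c x" "k > 0" "\<forall>N. rel_compact N \<longrightarrow> torus_mean (tensor c N) = k * measure mH N"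
proof -
  obtain Q :: "nat \<Rightarrow> 'g set" where Q: "\<And>n. open (Q n)" "\<And>n. compact (closure (Q n))" "incseq Q"
    "\<And>K. compact K \<Longrightarrow> \<exists>n. K \<subseteq> Q n"
    using lc_exhaustion[OF lcG] by blast
  obtain R :: "nat \<Rightarrow> 'h set" where R: "\<And>n. open (R n)" "\<And>n. compact (closure (R n))" "incseq R"
    "\<And>K. compact K \<Longrightarrow> \<exists>n. K \<subseteq> R n"
    using lc_exhaustion[OF lcH] by blast
  have rQ: "rel_compact (Q n)" and rR: "rel_compact (R n)" for n using Q(1,2) R(1,2) by (simp_all add: rel_compact_def)
  let ?F = "\<lambda>n. tensor (indicator (Q n)) (R n) :: 'g \<times> 'h \<Rightarrow> real"
  have F: "test_fun (?F n)" for n by (intro test_fun_tensor test_fun_indicator rQ rR)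
  have F0: "0 \<le> ?F n y" for n y by (simp add: tensor_def)
  have "\<exists>n. torus_mean (?F n) \<noteq> 0"
  proof (rule ccontr)
    assume "\<not> (\<exists>n. torus_mean (?F n) \<noteq> 0)"
    then have z: "torus_mean (?F n) = 0" for n by simp
    have "AE X in mX. periodise (?F n) X = 0" for n
    proof -
      have "AE X in mX. 0 \<le> periodise (?F n) X" by (intro AE_I2) (auto simp: periodise_def intro!: sum_nonneg F0)
      from integral_nonneg_eq_0_iff_AE[OF periodise_integrable[OF F] this] z[of n]
      show ?thesis unfolding torus_mean_def by (rule iffD1)
    qed
    then have a: "AE X in mX. \<forall>n. periodise (?F n) X = 0" by (simp add: AE_all_countable)
    have b: "\<not> (\<forall>n. periodise (?F n) X = 0)" if X: "X \<in> \<T>" for X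
    proof -
      obtain x where x: "X = q x" using X by (auto simp: carrier_torus)
      obtain n1 where n1: "{fst x} \<subseteq> Q n1" using Q(4)[of "{fst x}"] by auto
      obtain n2 where n2: "{snd x} \<subseteq> R n2" using R(4)[of "{snd x}"] by auto
      define n where "n = max n1 n2"
      have "fst x \<in> Q n" "snd x \<in> R n"
        using n1 n2 incseqD[OF Q(3), of n1 n] incseqD[OF R(3), of n2 n] by (auto simp: n_def)
      then have y: "?F n x = 1" by (simp add: tensor_def)
      have "?F n x \<le> periodise (?F n) X" by (rule periodise_ge_term[OF F F0 X]) (simp add: x self_in_q)
      then show ?thesis using y by (intro notI) (metis not_one_le_zero)
    qed
    have "AE X in mX. False" using a by (rule AE_mp) (rule AE_I2, use b in simp)
    then show False using prob_space.AE_False[OF prob_mX] by simp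
  qed
  then obtain n where n: "torus_mean (?F n) \<noteq> 0" by blast
  obtain c :: "'g \<Rightarrow> real" where c: "continuous_on UNIV c" "\<And>x. 0 \<le> c x" "\<And>x. c x \<le> 1"
    "\<And>x. x \<in> closure (Q n) \<Longrightarrow> c x = 1" "compact (closure {x. c x \<noteq> 0})" "closure {x. c x \<noteq> 0} \<subseteq> UNIV"
    using lc_Urysohn[OF lcG open_UNIV Q(2)[of n] subset_UNIV] by blast
  have cc: "c \<in> compactly_supported" using c by (simp add: compactly_supported_def)
  obtain k where k: "k \<ge> 0" "\<forall>N. rel_compact N \<longrightarrow> torus_mean (tensor c N) = k * measure mH N"
    by (rule mean_tensor[OF test_fun_compactly_supported[OF cc] c(2)])
  have "0 \<le> torus_mean (?F n)" unfolding torus_mean_def by (intro integral_nonneg_AE AE_I2) (auto simp: periodise_def F0 intro!: sum_nonneg)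
  then have "0 < torus_mean (?F n)" using n by simp
  also have "\<dots> \<le> torus_mean (tensor c (R n))"
  proof (rule torus_mean_mono[OF F test_fun_tensor[OF test_fun_compactly_supported[OF cc] rR]])
    show "?F n y \<le> tensor c (R n) y" for y
      using c(2)[of "fst y"] c(4)[of "fst y"] closure_subset[of "Q n"] by (auto simp: tensor_def indicator_def)
  qed
  also have "\<dots> = k * measure mH (R n)" using k(2) rR by blast
  finally have "k \<noteq> 0" by auto
  then show ?thesis using that[of c k] cc c(2) k by simp
qed

text \<open>Outer regularity is available for all Borel sets, inner regularity for open sets only. The
compact set is obtained by removing from \<open>closure B\<close> an open set that is barely larger than
\<open>closure B - B\<close>.\<close>

lemma compact_open_sandwich:
  assumes B: "rel_compact B" and e: "e > (0::real)"
  obtains K U where "compact K" "open U" "K \<subseteq> B" "B \<subseteq> U" "rel_compact U" "measure mH (U - K) < e"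
proof -
  have outer: "\<exists>U. open U \<and> A \<subseteq> U \<and> rel_compact U \<and> measure mH (U - A) < e / 2" if A: "rel_compact A" for A
  proof -
    have bA: "A \<in> sets borel" and cA: "compact (closure A)" using A by (auto simp: rel_compact_def)
    obtain V where V: "open V" "closure A \<subseteq> V" "compact (closure V)" "closure V \<subseteq> UNIV"
      by (rule lc_between[OF lcH open_UNIV cA subset_UNIV])
    have "(INF U\<in>{U. open U \<and> A \<subseteq> U}. emeasure mH U) < emeasure mH A + ennreal (e / 2)"
    proof -
      have "ennreal (measure mH A) < ennreal (measure mH A + e / 2)"
        using e by (intro ennreal_lessI) (simp_all add: add_nonneg_pos)
      then show ?thesis
        unfolding regular_outer[OF regular_mH bA, symmetric] emeasure_mH[OF A] using e by simp
    qed
    then obtain U where U: "open U" "A \<subseteq> U" "emeasure mH U < emeasure mH A + ennreal (e / 2)"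
      by (auto simp: INF_less_iff)
    have rV: "rel_compact V" using V by (simp add: rel_compact_def)
    have o: "open (U \<inter> V)" "A \<subseteq> U \<inter> V" using U V closure_subset[of A] by auto
    have rUV: "rel_compact (U \<inter> V)" using rel_compact_Int[OF rV, of U] U(1) by simp
    have "emeasure mH (U \<inter> V) \<le> emeasure mH U" using U(1) by (intro emeasure_mono) (auto simp: sets_mH)
    then have "ennreal (measure mH (U \<inter> V)) < ennreal (measure mH A + e / 2)"
      using U(3) e unfolding emeasure_mH[OF rUV] emeasure_mH[OF A] by (simp add: ennreal_plus[symmetric] del: ennreal_plus)
    then have "measure mH (U \<inter> V) < measure mH A + e / 2" by (rule ennreal_less_iff[THEN iffD1, rotated]) simp
    moreover have "measure mH (U \<inter> V - A) = measure mH (U \<inter> V) - measure mH A"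
      using measurable_measure_Diff[OF fmeasurable_mH[OF rUV] _ o(2)] bA by (simp add: sets_mH)
    ultimately show ?thesis using o rUV by (intro exI[of _ "U \<inter> V"]) simp
  qed
  obtain U where U: "open U" "B \<subseteq> U" "rel_compact U" "measure mH (U - B) < e / 2" using outer[OF B] by blast
  have bB: "B \<in> sets borel" and cB: "compact (closure B)" using B by (auto simp: rel_compact_def)
  have rD: "rel_compact (closure B - B)" by (rule rel_compact_Diff[OF rel_compact_compact[OF cB] bB])
  obtain V where V: "open V" "closure B - B \<subseteq> V" "rel_compact V" "measure mH (V - (closure B - B)) < e / 2" using outer[OF rD] by blast
  \<comment> \<open>Removing a neighbourhood of \<open>closure B - B\<close> leaves a closed subset of \<open>B\<close>.\<close>
  define K where "K = closure B - V"
  have K: "compact K" "K \<subseteq> B" using cB V(1,2) by (auto simp: K_def compact_diff)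
  have rK: "rel_compact K" by (rule rel_compact_compact[OF K(1)])
  have bK: "K \<in> sets borel" and bU: "U \<in> sets borel" using rK U(1) by (auto simp: rel_compact_def)
  have f1: "rel_compact (U - B)" "rel_compact (V - (closure B - B))" using rel_compact_Diff[OF U(3) bB] rel_compact_Diff[OF V(3)] rD by (auto simp: rel_compact_def)
  have sub: "U - K \<subseteq> (U - B) \<union> (V - (closure B - B))" using closure_subset[of B] by (auto simp: K_def)
  have "measure mH (U - K) \<le> measure mH ((U - B) \<union> (V - (closure B - B)))"
    by (rule measure_mono_fmeasurable[OF sub]) (use bK bU fmeasurable_mH f1 in \<open>auto simp: sets_mH intro: fmeasurable.Un\<close>)
  also have "\<dots> \<le> measure mH (U - B) + measure mH (V - (closure B - B))"
    by (rule measure_Un_le) (use f1 in \<open>auto simp: rel_compact_def sets_mH\<close>)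
  also have "\<dots> < e" using U(4) V(4) by linarith
  finally have "measure mH (U - K) < e" .
  then show ?thesis using that[of K U] K U by blast
qed

end

section \<open>Averages along the G-action\<close>

text \<open>A triple \<open>(k, w, g)\<close> encodes the combination with weights \<open>w 0, \<dots>, w (k - 1)\<close> of the
translates by \<open>g 0, \<dots>, g (k - 1)\<close>.\<close>

definition avg :: "nat \<times> (nat \<Rightarrow> real) \<times> (nat \<Rightarrow> 'g::plus) \<Rightarrow> (('g \<times> 'h::{zero,plus}) set \<Rightarrow> real) \<Rightarrow> ('g \<times> 'h) set \<Rightarrow> real" where
  "avg a f X = (\<Sum>i<fst a. fst (snd a) i * f (act (snd (snd a) i, 0) X))"

definition convex_weights :: "nat \<times> (nat \<Rightarrow> real) \<times> (nat \<Rightarrow> 'g) \<Rightarrow> bool" where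
  "convex_weights a \<longleftrightarrow> (\<forall>i<fst a. 0 \<le> fst (snd a) i) \<and> (\<Sum>i<fst a. fst (snd a) i) = 1"

lemma avg_diff: "avg a (\<lambda>X. f X - g X) X = avg a f X - avg a g X"
  by (simp add: avg_def sum_subtractf right_diff_distrib)
lemma avg_cmult: "avg a (\<lambda>X. r * f X) X = r * avg a f X"
  by (simp add: avg_def sum_distrib_left mult.left_commute)
context torus_scheme
begin

lemma avg_mono:
  assumes "convex_weights a" "X \<in> \<T>" "\<And>g. f (act (g, 0) X) \<le> h (act (g, 0) X)"
  shows "avg a f X \<le> avg a h X"
  unfolding avg_def using assms(1,3) by (intro sum_mono mult_left_mono) (auto simp: convex_weights_def)

lemma avg_integral:
  assumes f: "integrable mX f"
  shows "integrable mX (avg a f)" "convex_weights a \<Longrightarrow> (\<integral>X. avg a f X \<partial>mX) = (\<integral>X. f X \<partial>mX)"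
proof -
  have i: "integrable mX (\<lambda>X. f (act t X))" for t
    using integrable_distr[OF measurable_act[of t], of f] f by (simp add: distr_act)
  show "integrable mX (avg a f)" unfolding avg_def[abs_def] using i by (intro Bochner_Integration.integrable_sum integrable_mult_right) simp
  assume a: "convex_weights a"
  have "(\<integral>X. avg a f X \<partial>mX) = (\<Sum>i<fst a. fst (snd a) i * (\<integral>X. f (act (snd (snd a) i, 0) X) \<partial>mX))"
    unfolding avg_def[abs_def] using i by (subst Bochner_Integration.integral_sum) simp_all
  also have "\<dots> = (\<Sum>i<fst a. fst (snd a) i * (\<integral>X. f X \<partial>mX))"
    using f by (intro sum.cong refl) (simp add: integral_act borel_measurable_integrable)
  also have "\<dots> = (\<integral>X. f X \<partial>mX)" using a by (simp add: convex_weights_def sum_distrib_right[symmetric])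
  finally show "(\<integral>X. avg a f X \<partial>mX) = (\<integral>X. f X \<partial>mX)" .
qed

definition torus_cont :: "(('g \<times> 'h) set \<Rightarrow> real) \<Rightarrow> bool" where
  "torus_cont f \<longleftrightarrow> continuous_on UNIV (\<lambda>x. f (q x))"

lemma torus_cont_measurable: "torus_cont f \<Longrightarrow> f \<in> borel_measurable borel_torus"
  unfolding torus_cont_def by (intro measurable_via_q borel_measurable_continuous_onI)

lemma torus_cont_bounded:
  assumes "torus_cont f" obtains B where "\<forall>X\<in>\<T>. \<bar>f X\<bar> \<le> B"
proof -
  obtain s C0 where s: "s \<in> borel_torus \<rightarrow>\<^sub>M borel" "compact C0" "\<And>X. X \<in> \<T> \<Longrightarrow> s X \<in> X" "\<And>X. X \<in> \<T> \<Longrightarrow> s X \<in> C0"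
    by (rule borel_section) (rule that, blast+)
  have "compact ((\<lambda>x. f (q x)) ` C0)"
    by (rule compact_continuous_image[OF continuous_on_subset[OF assms[unfolded torus_cont_def] subset_UNIV] s(2)])
  then obtain B where B: "\<forall>y\<in>(\<lambda>x. f (q x)) ` C0. norm y \<le> B" using compact_imp_bounded[of "(\<lambda>x. f (q x)) ` C0"] unfolding bounded_iff by blast
  have "\<bar>f X\<bar> \<le> B" if X: "X \<in> \<T>" for X
  proof -
    have "f (q (s X)) \<in> (\<lambda>x. f (q x)) ` C0" using s(4)[OF X] by (rule imageI)
    then have "norm (f (q (s X))) \<le> B" using B by blast
    then show ?thesis unfolding torus_eq_q[OF X s(3)[OF X], symmetric] by simp
  qed
  then show ?thesis using that by blast
qed

lemma torus_cont_integrable: "torus_cont f \<Longrightarrow> integrable mX f"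
  by (rule torus_cont_bounded, assumption, rule integrable_bounded_torus[OF torus_cont_measurable]) auto

text \<open>The tube lemma over the compact set that contains a representative of every coset.\<close>

lemma torus_cont_uniform:
  assumes f: "torus_cont f" and e: "e > 0"
  obtains V where "open V" "0 \<in> V" "\<forall>v\<in>V. \<forall>x. \<bar>f (q (x + v)) - f (q x)\<bar> < e"
proof -
  obtain s C0 where s: "s \<in> borel_torus \<rightarrow>\<^sub>M borel" "compact C0" "\<And>X. X \<in> \<T> \<Longrightarrow> s X \<in> X" "\<And>X. X \<in> \<T> \<Longrightarrow> s X \<in> C0"
    by (rule borel_section) (rule that, blast+)
  have f': "continuous_on UNIV (\<lambda>x. f (q x))" using f by (simp add: torus_cont_def)
  have c1: "continuous_on UNIV (\<lambda>p :: ('g \<times> 'h) \<times> ('g \<times> 'h). f (q (snd p + fst p)))"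
    by (rule continuous_on_compose2[OF f']) (auto intro!: continuous_intros)
  have c2: "continuous_on UNIV (\<lambda>p :: ('g \<times> 'h) \<times> ('g \<times> 'h). f (q (snd p)))"
    by (rule continuous_on_compose2[OF f']) (auto intro!: continuous_intros)
  let ?O = "{p :: ('g \<times> 'h) \<times> ('g \<times> 'h). \<bar>f (q (snd p + fst p)) - f (q (snd p))\<bar> < e}"
  have "open ?O" by (intro open_Collect_less continuous_on_rabs continuous_on_diff c1 c2 continuous_on_const)
  moreover have "{0} \<times> C0 \<subseteq> ?O" using e by auto
  ultimately obtain V where V: "0 \<in> V" "open V" "V \<times> C0 \<subseteq> ?O"
    using Elementary_Topology.tube_lemma[OF s(2), of ?O 0] by blast
  have "\<bar>f (q (x + v)) - f (q x)\<bar> < e" if v: "v \<in> V" for v x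
  proof -
    define y where "y = s (q x)"
    have y: "y \<in> C0" "y \<in> q x" unfolding y_def by (rule s(4)[OF q_in_torus], rule s(3)[OF q_in_torus])
    have "(v, y) \<in> ?O" using V(3) v y(1) by blast
    moreover have "q y = q x" using y(2) torus_eq_q[OF q_in_torus y(2)] by simp
    moreover then have "q (y + v) = q (x + v)" by (simp add: q_eq)
    ultimately show ?thesis by simp
  qed
  then show ?thesis using that V by blast
qed

text \<open>By density some lattice point has a second coordinate close to \<open>snd x\<close>; subtracting it moves
\<open>x\<close> close to \<open>G \<times> {0}\<close>.\<close>

lemma orbit_nbhd_cover:
  assumes V: "open V" "0 \<in> V"
  shows "\<exists>g. q x \<in> q ` ((\<lambda>v. (g, 0) + v) ` V)"
proof -
  have c: "continuous_on UNIV (\<lambda>t. (0 :: 'g, snd x - t))" by (intro continuous_intros)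
  have "open ((\<lambda>t. (0 :: 'g, snd x - t)) -` V)" by (rule open_vimage[OF V(1) c])
  moreover have "snd x \<in> (\<lambda>t. (0 :: 'g, snd x - t)) -` V" using V(2) by (simp add: zero_prod_def)
  ultimately have "(\<lambda>t. (0 :: 'g, snd x - t)) -` V \<inter> snd ` L \<noteq> {}"
    using open_Int_closure_eq_empty[of "(\<lambda>t. (0 :: 'g, snd x - t)) -` V" "snd ` L"] unfolding dense_snd_L by blast
  then obtain l where l: "l \<in> L" "(0, snd x - snd l) \<in> V" by blast
  have "q x = q ((fst x - fst l, 0) + (0, snd x - snd l))"
  proof -
    have "(fst x - fst l, 0) + (0, snd x - snd l) - x = - l" by (simp add: prod_eq_iff)
    then show ?thesis unfolding q_eq using L_uminus[OF l(1)] by simp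
  qed
  then show ?thesis using l(2) by blast
qed

text \<open>Cut the torus into finitely many pieces \<open>E i\<close>, each inside a \<open>G\<close>-translate of the image of the
small set \<open>V\<close>, and weight that translate by the measure of the piece. For a function that
varies by less than \<open>e\<close> along \<open>V\<close>, the weighted sum is a Riemann sum for its integral. The weights depend
on \<open>V\<close> only and serve all such functions, which is why the quantifiers stand in this order.\<close>

lemma convex_average_near_integral:
  assumes V: "open V" "0 \<in> V"
  shows "\<exists>a. convex_weights a \<and> (\<forall>f e. torus_cont f \<longrightarrow> (\<forall>v\<in>V. \<forall>x. \<bar>f (q (x + v)) - f (q x)\<bar> < e) \<longrightarrow> (\<forall>X\<in>\<T>. \<bar>avg a f X - (\<integral>X. f X \<partial>mX)\<bar> \<le> e))"
proof -
  interpret P: prob_space mX by (rule prob_mX)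
  define O' where "O' g = q ` ((\<lambda>v. (g, 0) + v) ` V)" for g
  have oO: "openin (torus_topology L) (O' g)" for g unfolding O'_def by (intro open_map_q open_translation_group V(1))
  have "compactin (torus_topology L) \<T>" using compact_torus by (simp add: compact_space_def)
  moreover have "\<And>W. W \<in> range O' \<Longrightarrow> openin (torus_topology L) W" using oO by blast
  moreover have "\<T> \<subseteq> \<Union> (range O')"
  proof
    fix X assume "X \<in> \<T>"
    then obtain x where "X = q x" unfolding carrier_torus by (rule imageE)
    then show "X \<in> \<Union> (range O')" using orbit_nbhd_cover[OF V, of x] unfolding O'_def by blast
  qed
  ultimately obtain \<F> where F: "finite \<F>" "\<F> \<subseteq> range O'" "\<T> \<subseteq> \<Union>\<F>"
    unfolding compactin_def by meson
  obtain Ps where Ps: "finite Ps" "\<F> = O' ` Ps" using finite_subset_image[OF F(1,2)] by blast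
  obtain k and g :: "nat \<Rightarrow> 'g" where kg: "Ps = g ` {i. i < k}"
    using finite_imp_nat_seg_image_inj_on[OF Ps(1)] by auto
  \<comment> \<open>Disjoint pieces of the cover, one for each translate.\<close>
  define E where "E = disjointed (\<lambda>i. O' (g i))"
  have Es: "E i \<in> sets mX" for i
  proof -
    have "O' (g j) \<in> sets mX" for j unfolding sets_mX borel_torus_def by (rule openin_borel_of[OF oO])
    then show ?thesis unfolding E_def disjointed_def by (intro sets.Diff sets.finite_UN) auto
  qed
  have EO: "E i \<subseteq> O' (g i)" for i unfolding E_def by (rule disjointed_subset)
  have dis: "i = j" if "T \<in> E i" "T \<in> E j" for i j T
    using disjoint_family_disjointed[of "\<lambda>i. O' (g i)"] that unfolding E_def disjoint_family_on_def by blast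
  have cov: "\<exists>j<k. T \<in> E j" if "T \<in> \<T>" for T
  proof -
    have "T \<in> \<Union> (O' ` g ` {i. i < k})" using that F(3) unfolding Ps(2) kg by blast
    then have "T \<in> (\<Union>i\<in>{0..<k}. O' (g i))" by auto
    then have "T \<in> (\<Union>i\<in>{0..<k}. E i)" unfolding E_def by (simp only: finite_UN_disjointed_eq)
    then show ?thesis by auto
  qed
  have step: "(\<Sum>i<k. indicator (E i) T * r i) = r j" if "T \<in> E j" "j < k" for T j and r :: "nat \<Rightarrow> real"
  proof -
    have "indicator (E i) T * r i = (if i = j then r j else 0)" for i
    proof (cases "i = j")
      case True then show ?thesis using that(1) by simp
    next
      case False
      then have "T \<notin> E i" using dis[OF _ that(1)] by blast
      then show ?thesis using False by simp
    qed
    then show ?thesis using that(2) by simp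
  qed
  define w where "w i = measure mX (E i)" for i
  have int: "(\<integral>T. (\<Sum>i<k. indicator (E i) T * r i) \<partial>mX) = (\<Sum>i<k. w i * r i)" "integrable mX (\<lambda>T. \<Sum>i<k. indicator (E i) T * r i)" for r :: "nat \<Rightarrow> real"
  proof -
    have i: "integrable mX (\<lambda>T. indicator (E i) T * r i)" for i
      using Es by (intro integrable_mult_left integrable_real_indicator) (simp_all add: P.emeasure_eq_measure)
    show "integrable mX (\<lambda>T. \<Sum>i<k. indicator (E i) T * r i)" using i by (intro Bochner_Integration.integrable_sum)
    show "(\<integral>T. (\<Sum>i<k. indicator (E i) T * r i) \<partial>mX) = (\<Sum>i<k. w i * r i)"
      using i Es sets.sets_into_space[OF Es] by (subst Bochner_Integration.integral_sum) (simp_all add: w_def Int_absorb2)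
  qed
  define a where "a = (k, w, g)"
  have "(\<Sum>i<k. w i) = 1"
  proof -
    have "(\<Sum>i<k. w i * 1) = (\<integral>T. (\<Sum>i<k. indicator (E i) T * 1) \<partial>mX)" using int(1)[of "\<lambda>_. 1"] by simp
    also have "\<dots> = (\<integral>T. 1 \<partial>mX)"
    proof (rule Bochner_Integration.integral_cong[OF refl])
      fix T assume "T \<in> space mX"
      then obtain j where "j < k" "T \<in> E j" using cov by auto
      then show "(\<Sum>i<k. indicator (E i) T * 1) = (1::real)" using step[of T j "\<lambda>_. 1"] by simp
    qed
    finally show ?thesis using P.prob_space by simp
  qed
  then have "convex_weights a" by (simp add: convex_weights_def a_def w_def)
  moreover have "\<bar>avg a f X - (\<integral>X. f X \<partial>mX)\<bar> \<le> e"
    if f: "torus_cont f" and u: "\<forall>v\<in>V. \<forall>x. \<bar>f (q (x + v)) - f (q x)\<bar> < e" and X: "X \<in> \<T>" for f e X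
  proof -
    obtain x where x: "X = q x" using X unfolding carrier_torus by (rule imageE)
    have fi: "integrable mX (\<lambda>T. f (act x T))"
      using integrable_distr[OF measurable_act[of x], of f] torus_cont_integrable[OF f] by (simp add: distr_act)
    \<comment> \<open>The step function \<open>\<phi>\<close> has integral \<open>avg a f X\<close>, and on each piece it is within \<open>e\<close> of the
      translate of \<open>f\<close> by a representative of \<open>X\<close>, whose integral is that of \<open>f\<close>.\<close>
    define \<phi> where "\<phi> T = (\<Sum>i<k. indicator (E i) T * f (act (g i, 0) X))" for T
    have \<phi>i: "integrable mX \<phi>" unfolding \<phi>_def[abs_def] by (rule int(2))
    have "avg a f X = (\<integral>T. \<phi> T \<partial>mX)" unfolding \<phi>_def int(1) by (simp add: avg_def a_def)
    moreover have "(\<integral>X. f X \<partial>mX) = (\<integral>T. f (act x T) \<partial>mX)"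
      using integral_act[of f x] borel_measurable_integrable[OF torus_cont_integrable[OF f]] by simp
    ultimately have "avg a f X - (\<integral>X. f X \<partial>mX) = (\<integral>T. \<phi> T - f (act x T) \<partial>mX)" using \<phi>i fi by simp
    moreover have "\<bar>\<integral>T. \<phi> T - f (act x T) \<partial>mX\<bar> \<le> (\<integral>T. \<bar>\<phi> T - f (act x T)\<bar> \<partial>mX)" by (rule integral_abs_bound)
    moreover have "(\<integral>T. \<bar>\<phi> T - f (act x T)\<bar> \<partial>mX) \<le> (\<integral>T. e \<partial>mX)"
    proof (rule integral_mono)
      show "integrable mX (\<lambda>T. \<bar>\<phi> T - f (act x T)\<bar>)" using \<phi>i fi by simp
      fix T assume "T \<in> space mX"
      then obtain j where j: "j < k" "T \<in> E j" using cov by auto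
      then obtain v where v: "v \<in> V" "T = q ((g j, 0) + v)" using EO[of j] unfolding O'_def by blast
      have "\<phi> T = f (q ((g j, 0) + x))" unfolding \<phi>_def step[OF j(2,1)] x act_q ..
      moreover have "act x T = q (((g j, 0) + x) + v)" unfolding v(2) act_q by (simp add: ac_simps)
      moreover have "\<bar>f (q (((g j, 0) + x) + v)) - f (q ((g j, 0) + x))\<bar> < e" using u v(1) by blast
      ultimately show "\<bar>\<phi> T - f (act x T)\<bar> \<le> e" by (simp only: abs_minus_commute less_imp_le)
    qed simp
    moreover have "(\<integral>T. e \<partial>mX) = e" using P.prob_space by simp
    ultimately show ?thesis by linarith
  qed
  ultimately show ?thesis by blast
qed

text \<open>One sequence of averages for all continuous functions on the torus at the same time.\<close>

definition uniform_avg :: "(nat \<Rightarrow> nat \<times> (nat \<Rightarrow> real) \<times> (nat \<Rightarrow> 'g)) \<Rightarrow> bool" where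
  "uniform_avg a \<longleftrightarrow> (\<forall>n. convex_weights (a n)) \<and>
     (\<forall>f. torus_cont f \<longrightarrow> (\<forall>e>0. \<exists>N. \<forall>n\<ge>N. \<forall>X\<in>\<T>. \<bar>avg (a n) f X - (\<integral>X. f X \<partial>mX)\<bar> \<le> e))"

lemma averages_exist: "\<exists>a. uniform_avg a"
proof -
  obtain A :: "nat \<Rightarrow> ('g \<times> 'h) set" where A: "\<And>i. open (A i)" "\<And>i. 0 \<in> A i"
    "\<And>S. open S \<Longrightarrow> 0 \<in> S \<Longrightarrow> eventually (\<lambda>i. A i \<subseteq> S) sequentially"
    using countable_basis_at_decseq[of "0 :: 'g \<times> 'h"] by blast
  let ?Q = "\<lambda>n a. convex_weights a \<and> (\<forall>f e. torus_cont f \<longrightarrow> (\<forall>v\<in>A n. \<forall>x. \<bar>f (q (x + v)) - f (q x)\<bar> < e) \<longrightarrow> (\<forall>X\<in>\<T>. \<bar>avg a f X - (\<integral>X. f X \<partial>mX)\<bar> \<le> e))"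
  have "\<forall>n. \<exists>a. ?Q n a" using convex_average_near_integral[OF A(1,2)] by (intro allI)
  then obtain a where a: "\<forall>n. ?Q n (a n)" by (rule choice[THEN exE])
  have "\<exists>N. \<forall>n\<ge>N. \<forall>X\<in>\<T>. \<bar>avg (a n) f X - (\<integral>X. f X \<partial>mX)\<bar> \<le> e" if f: "torus_cont f" and e: "e > 0" for f e
  proof -
    obtain V where V: "open V" "0 \<in> V" "\<forall>v\<in>V. \<forall>x. \<bar>f (q (x + v)) - f (q x)\<bar> < e" by (rule torus_cont_uniform[OF f e])
    obtain N where N: "\<And>n. n \<ge> N \<Longrightarrow> A n \<subseteq> V" using A(3)[OF V(1,2)] unfolding eventually_sequentially by blast
    show ?thesis
    proof (intro exI[of _ N] allI impI)
      fix n assume "n \<ge> N"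
      then have "\<forall>v\<in>A n. \<forall>x. \<bar>f (q (x + v)) - f (q x)\<bar> < e" using N V(3) by blast
      then show "\<forall>X\<in>\<T>. \<bar>avg (a n) f X - (\<integral>X. f X \<partial>mX)\<bar> \<le> e" using a f by blast
    qed
  qed
  then have "uniform_avg a" unfolding uniform_avg_def using a by blast
  then show ?thesis by blast
qed

lemma uniform_avg_pointwise:
  assumes "uniform_avg a" "torus_cont f" "X \<in> \<T>"
  shows "(\<lambda>n. avg (a n) f X) \<longlonglongrightarrow> (\<integral>X. f X \<partial>mX)"
proof (rule LIMSEQ_I)
  fix r :: real assume r: "r > 0"
  then have "r / 2 > 0" by simp
  then obtain N where "\<forall>n\<ge>N. \<forall>X\<in>\<T>. \<bar>avg (a n) f X - (\<integral>X. f X \<partial>mX)\<bar> \<le> r / 2"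
    using assms(1,2) unfolding uniform_avg_def by blast
  then have "\<forall>n\<ge>N. norm (avg (a n) f X - (\<integral>X. f X \<partial>mX)) < r" using assms(3) r by (auto intro: le_less_trans[of _ "r/2"])
  then show "\<exists>no. \<forall>n\<ge>no. norm (avg (a n) f X - (\<integral>X. f X \<partial>mX)) < r" by blast
qed

text \<open>The error is dominated pointwise by an integrable function \<open>r\<close> with small integral, because
averages preserve pointwise domination and the integral of \<open>r\<close>.\<close>

definition L1_approx :: "(('g \<times> 'h) set \<Rightarrow> real) \<Rightarrow> bool" where
  "L1_approx f \<longleftrightarrow> integrable mX f \<and> (\<forall>e>0. \<exists>f' r. torus_cont f' \<and> integrable mX r \<and> (\<forall>X\<in>\<T>. \<bar>f X - f' X\<bar> \<le> r X) \<and> (\<integral>X. r X \<partial>mX) \<le> e)"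

text \<open>An error of \<open>e / 3\<close> each comes from averaging the dominating function, from uniform convergence
for the continuous approximation, and from comparing the two integrals.\<close>

lemma L1_approx_L1:
  assumes a: "uniform_avg a" and f: "L1_approx f" and e: "e > 0"
  shows "\<exists>N. \<forall>n\<ge>N. (\<integral>X. \<bar>avg (a n) f X - (\<integral>X. f X \<partial>mX)\<bar> \<partial>mX) \<le> e"
proof -
  interpret P: prob_space mX by (rule prob_mX)
  have e3: "e / 3 > 0" using e by simp
  have fi: "integrable mX f" using f by (simp add: L1_approx_def)
  obtain f' r where fr: "torus_cont f'" "integrable mX r" "\<forall>X\<in>\<T>. \<bar>f X - f' X\<bar> \<le> r X" "(\<integral>X. r X \<partial>mX) \<le> e / 3"
    using f e3 unfolding L1_approx_def by blast
  obtain N where N: "\<And>n X. n \<ge> N \<Longrightarrow> X \<in> \<T> \<Longrightarrow> \<bar>avg (a n) f' X - (\<integral>X. f' X \<partial>mX)\<bar> \<le> e / 3"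
    using a fr(1) e3 unfolding uniform_avg_def by blast
  have ia: "convex_weights (a n)" for n using a by (simp add: uniform_avg_def)
  note f'i = torus_cont_integrable[OF fr(1)]
  have d: "\<bar>(\<integral>X. f' X \<partial>mX) - (\<integral>X. f X \<partial>mX)\<bar> \<le> e / 3"
  proof -
    have "(\<integral>X. f' X \<partial>mX) - (\<integral>X. f X \<partial>mX) = (\<integral>X. f' X - f X \<partial>mX)" using f'i fi by simp
    moreover have "\<bar>\<integral>X. f' X - f X \<partial>mX\<bar> \<le> (\<integral>X. \<bar>f' X - f X\<bar> \<partial>mX)" by (rule integral_abs_bound)
    moreover have "\<dots> \<le> (\<integral>X. r X \<partial>mX)" using f'i fi fr(2,3) by (intro integral_mono) (auto simp: abs_minus_commute)
    ultimately show ?thesis using fr(4) by linarith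
  qed
  have "(\<integral>X. \<bar>avg (a n) f X - (\<integral>X. f X \<partial>mX)\<bar> \<partial>mX) \<le> e" if n: "n \<ge> N" for n
  proof -
    have "(\<integral>X. \<bar>avg (a n) f X - (\<integral>X. f X \<partial>mX)\<bar> \<partial>mX) \<le> (\<integral>X. avg (a n) r X + (e / 3 + e / 3) \<partial>mX)"
    proof (rule integral_mono)
      show "integrable mX (\<lambda>X. \<bar>avg (a n) f X - (\<integral>X. f X \<partial>mX)\<bar>)" using avg_integral(1)[OF fi] by simp
      show "integrable mX (\<lambda>X. avg (a n) r X + (e / 3 + e / 3))" using avg_integral(1)[OF fr(2)] by simp
      fix X assume "X \<in> space mX"
      then have X: "X \<in> \<T>" by simp
      have "avg (a n) f X - avg (a n) f' X \<le> avg (a n) r X"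
        unfolding avg_diff[symmetric] by (rule avg_mono[OF ia X]) (use fr(3) X in \<open>auto simp: abs_le_iff\<close>)
      moreover have "avg (a n) f' X - avg (a n) f X \<le> avg (a n) r X"
        unfolding avg_diff[symmetric] by (rule avg_mono[OF ia X]) (use fr(3) X in \<open>auto simp: abs_le_iff\<close>)
      ultimately show "\<bar>avg (a n) f X - (\<integral>X. f X \<partial>mX)\<bar> \<le> avg (a n) r X + (e / 3 + e / 3)"
        using N[OF n X] d by linarith
    qed
    also have "\<dots> = (\<integral>X. r X \<partial>mX) + (e / 3 + e / 3)"
      using avg_integral[OF fr(2)] ia P.prob_space by simp
    finally show ?thesis using fr(4) by simp
  qed
  then show ?thesis by blast
qed

text \<open>The sum of the functions has finite integral, so it is finite almost everywhere.\<close>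

lemma AE_tendsto_0_of_summable:
  fixes g :: "nat \<Rightarrow> 'b \<Rightarrow> real"
  assumes i: "\<And>n. integrable M (g n)" "\<And>n x. 0 \<le> g n x" and b: "\<And>n. n \<ge> m \<Longrightarrow> (\<integral>x. g n x \<partial>M) \<le> (1/2) ^ n"
  shows "AE x in M. (\<lambda>n. g n x) \<longlonglongrightarrow> 0"
proof -
  have meas: "(\<lambda>x. ennreal (g n x)) \<in> borel_measurable M" for n using i(1) by (intro measurable_compose[OF _ measurable_ennreal]) simp
  have "(\<integral>\<^sup>+x. (\<Sum>n. ennreal (g (n + m) x)) \<partial>M) = (\<Sum>n. \<integral>\<^sup>+x. ennreal (g (n + m) x) \<partial>M)"
    by (rule nn_integral_suminf) (rule meas)
  also have "\<dots> = (\<Sum>n. ennreal (\<integral>x. g (n + m) x \<partial>M))"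
    using i by (intro suminf_cong nn_integral_eq_integral) auto
  also have "\<dots> \<le> (\<Sum>n. ennreal ((1/2) ^ n))"
  proof (rule suminf_le)
    show "ennreal (\<integral>x. g (n + m) x \<partial>M) \<le> ennreal ((1/2) ^ n)" for n
    proof (rule ennreal_leI)
      have "(1/2::real) ^ (n + m) \<le> (1/2) ^ n" by (rule power_decreasing) auto
      then show "(\<integral>x. g (n + m) x \<partial>M) \<le> (1/2) ^ n" by (rule order_trans[OF b[OF le_add2]])
    qed
  qed simp_all
  also have "\<dots> < \<infinity>"
  proof -
    have "(\<Sum>n. ennreal ((1/2) ^ n)) = ennreal (\<Sum>n. (1/2) ^ n)" by (rule suminf_ennreal2) (auto intro!: summable_geometric)
    then show ?thesis by simp
  qed
  finally have "AE x in M. (\<Sum>n. ennreal (g (n + m) x)) \<noteq> \<infinity>"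
  proof -
    assume a: "(\<integral>\<^sup>+x. (\<Sum>n. ennreal (g (n + m) x)) \<partial>M) < \<infinity>"
    note [measurable] = borel_measurable_integrable[OF i(1)]
    have m: "(\<lambda>x. \<Sum>n. ennreal (g (n + m) x)) \<in> borel_measurable M" by measurable
    show ?thesis by (rule nn_integral_PInf_AE[OF m]) (use a in simp)
  qed
  then show ?thesis
  proof (rule AE_mp, intro AE_I2 impI)
    fix x assume "(\<Sum>n. ennreal (g (n + m) x)) \<noteq> \<infinity>"
    then have "summable (\<lambda>n. g (n + m) x)" using i(2) by (intro summable_suminf_not_top) auto
    then have "(\<lambda>n. g (n + m) x) \<longlonglongrightarrow> 0" by (rule summable_LIMSEQ_zero)
    then show "(\<lambda>n. g n x) \<longlonglongrightarrow> 0" by (rule LIMSEQ_offset)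
  qed
qed

text \<open>A diagonal choice: the \<open>n\<close>th average of the new sequence is within \<open>(1/2) ^ n\<close> in mean for the first
\<open>n\<close> functions, which for each fixed function is summable from some index on.\<close>

lemma averages_AE:
  assumes fam: "\<And>i::nat. L1_approx (fam i)"
  obtains a where "uniform_avg a" "AE X in mX. \<forall>i. (\<lambda>n. avg (a n) (fam i) X) \<longlonglongrightarrow> (\<integral>X. fam i X \<partial>mX)"
proof -
  obtain b where b: "uniform_avg b" using averages_exist by blast
  let ?d = "\<lambda>i n. \<integral>X. \<bar>avg (b n) (fam i) X - (\<integral>X. fam i X \<partial>mX)\<bar> \<partial>mX"
  have "\<exists>N\<ge>n. \<forall>i\<le>n. ?d i N \<le> (1/2) ^ n" for n
  proof -
    have "(1/2 :: real) ^ n > 0" by simp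
    then have "\<forall>i. \<exists>N. \<forall>m\<ge>N. ?d i m \<le> (1/2) ^ n" by (intro allI L1_approx_L1[OF b fam])
    then obtain N where N: "\<forall>i. \<forall>m\<ge>N i. ?d i m \<le> (1/2) ^ n" by (rule choice[THEN exE])
    \<comment> \<open>Large enough for the first \<open>n\<close> functions, and at least \<open>n\<close> so that uniform convergence persists.\<close>
    define M where "M = Max (insert n (N ` {..n}))"
    have "n \<le> M" unfolding M_def by (rule Max_ge) simp_all
    moreover have "N i \<le> M" if "i \<le> n" for i unfolding M_def using that by (intro Max_ge) simp_all
    ultimately have "n \<le> M" "\<And>i. i \<le> n \<Longrightarrow> N i \<le> M" by blast+
    then show ?thesis using N by blast
  qed
  then have "\<forall>n. \<exists>N. N \<ge> n \<and> (\<forall>i\<le>n. ?d i N \<le> (1/2) ^ n)" by blast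
  then obtain r where r: "\<forall>n. r n \<ge> n \<and> (\<forall>i\<le>n. ?d i (r n) \<le> (1/2) ^ n)" by (rule choice[THEN exE])
  define a where "a n = b (r n)" for n
  have ua: "uniform_avg a" unfolding uniform_avg_def
  proof (intro conjI allI impI)
    show "convex_weights (a n)" for n using b by (simp add: uniform_avg_def a_def)
    fix f and e :: real assume "torus_cont f" "e > 0"
    then obtain N where "\<forall>n\<ge>N. \<forall>X\<in>\<T>. \<bar>avg (b n) f X - (\<integral>X. f X \<partial>mX)\<bar> \<le> e" using b unfolding uniform_avg_def by blast
    then have "\<forall>n\<ge>N. \<forall>X\<in>\<T>. \<bar>avg (a n) f X - (\<integral>X. f X \<partial>mX)\<bar> \<le> e" unfolding a_def using r by (meson order_trans)
    then show "\<exists>N. \<forall>n\<ge>N. \<forall>X\<in>\<T>. \<bar>avg (a n) f X - (\<integral>X. f X \<partial>mX)\<bar> \<le> e" by blast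
  qed
  have fi: "integrable mX (fam i)" for i using fam by (simp add: L1_approx_def)
  interpret P: prob_space mX by (rule prob_mX)
  have "AE X in mX. (\<lambda>n. \<bar>avg (a n) (fam i) X - (\<integral>X. fam i X \<partial>mX)\<bar>) \<longlonglongrightarrow> 0" for i
  proof (rule AE_tendsto_0_of_summable[where m=i])
    show "integrable mX (\<lambda>X. \<bar>avg (a n) (fam i) X - (\<integral>X. fam i X \<partial>mX)\<bar>)" for n using avg_integral(1)[OF fi] by simp
    show "(\<integral>X. \<bar>avg (a n) (fam i) X - (\<integral>X. fam i X \<partial>mX)\<bar> \<partial>mX) \<le> (1/2) ^ n" if "i \<le> n" for n
      using r that unfolding a_def by blast
  qed simp
  then have "AE X in mX. \<forall>i. (\<lambda>n. avg (a n) (fam i) X) \<longlonglongrightarrow> (\<integral>X. fam i X \<partial>mX)"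
    unfolding AE_all_countable by (simp add: tendsto_rabs_zero_iff LIM_zero_iff)
  then show ?thesis using that ua by blast
qed

lemma torus_cont_periodise: "F \<in> compactly_supported \<Longrightarrow> torus_cont (periodise F)"
  unfolding torus_cont_def by (rule continuous_periodise)

lemma compactly_supported_prod:
  fixes c :: "'g \<Rightarrow> real" and u :: "'h \<Rightarrow> real"
  assumes c: "c \<in> compactly_supported" and u: "u \<in> compactly_supported"
  shows "(\<lambda>y. c (fst y) * u (snd y)) \<in> compactly_supported"
proof (rule compactly_supported_closed_superset)
  note c' = compactly_supportedD[OF c] and u' = compactly_supportedD[OF u]
  have 1: "continuous_on UNIV (\<lambda>y :: 'g \<times> 'h. c (fst y))" by (rule continuous_on_compose2[OF c'(1)]) (auto intro!: continuous_intros)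
  have 2: "continuous_on UNIV (\<lambda>y :: 'g \<times> 'h. u (snd y))" by (rule continuous_on_compose2[OF u'(1)]) (auto intro!: continuous_intros)
  show "continuous_on UNIV (\<lambda>y. c (fst y) * u (snd y))" by (rule continuous_on_mult[OF 1 2])
  show "compact (closure {x. c x \<noteq> 0} \<times> closure {x. u x \<noteq> 0})" by (rule compact_Times[OF c'(2) u'(2)])
  fix y :: "'g \<times> 'h" assume "y \<notin> closure {x. c x \<noteq> 0} \<times> closure {x. u x \<noteq> 0}"
  then have "fst y \<notin> closure {x. c x \<noteq> 0} \<or> snd y \<notin> closure {x. u x \<noteq> 0}" by (auto simp: mem_Times_iff)
  then have "c (fst y) = 0 \<or> u (snd y) = 0" using c'(3)[of "fst y"] u'(3)[of "snd y"] by blast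
  then show "c (fst y) * u (snd y) = 0" by simp
qed

end

context haar_scheme
begin

text \<open>Replace the indicator of \<open>B\<close> by a Urysohn function between a compact and an open set. The
error lives over their difference, whose measure is small, and \<open>mean_tensor\<close> turns this into a
small mean on the torus.\<close>

lemma L1_approx_tensor:
  assumes c: "c \<in> compactly_supported" and B: "rel_compact B"
  shows "L1_approx (periodise (tensor c B))"
  unfolding L1_approx_def
proof (intro conjI allI impI)
  have cc: "test_fun c" by (rule test_fun_compactly_supported[OF c])
  show "integrable mX (periodise (tensor c B))" by (rule periodise_integrable[OF test_fun_tensor[OF cc B]])
  fix e :: real assume e: "e > 0"
  have ca: "test_fun (\<lambda>x. \<bar>c x\<bar>)" by (rule test_fun_abs[OF cc])
  obtain k where k: "k \<ge> 0" "\<forall>N. rel_compact N \<longrightarrow> torus_mean (tensor (\<lambda>x. \<bar>c x\<bar>) N) = k * measure mH N"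
    by (rule mean_tensor[OF ca]) simp
  \<comment> \<open>The denominator \<open>k + 1\<close> covers the case \<open>k = 0\<close>.\<close>
  have e': "e / (k + 1) > 0" using e k(1) by simp
  obtain K U where KU: "compact K" "open U" "K \<subseteq> B" "B \<subseteq> U" "rel_compact U" "measure mH (U - K) < e / (k + 1)"
    by (rule compact_open_sandwich[OF B e'])
  obtain u :: "'h \<Rightarrow> real" where u: "continuous_on UNIV u" "\<And>x. 0 \<le> u x" "\<And>x. u x \<le> 1"
    "\<And>x. x \<in> K \<Longrightarrow> u x = 1" "compact (closure {x. u x \<noteq> 0})" "closure {x. u x \<noteq> 0} \<subseteq> U"
    using lc_Urysohn[OF lcH KU(2,1) order_trans[OF KU(3,4)]] by blast
  have uc: "u \<in> compactly_supported" using u by (simp add: compactly_supported_def)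
  have u0: "u x = 0" if "x \<notin> U" for x using that u(6) closure_subset[of "{x. u x \<noteq> 0}"] by blast
  have bK: "K \<in> sets borel" using rel_compact_compact[OF KU(1)] by (simp add: rel_compact_def)
  have rD: "rel_compact (U - K)" by (rule rel_compact_Diff[OF KU(5) bK])
  let ?F = "\<lambda>y :: 'g \<times> 'h. c (fst y) * u (snd y)" and ?R = "tensor (\<lambda>x. \<bar>c x\<bar>) (U - K)"
  have F: "?F \<in> compactly_supported" by (rule compactly_supported_prod[OF c uc])
  have cb: "test_fun ?F" "test_fun (tensor c B)" "test_fun ?R" by (rule test_fun_compactly_supported[OF F], rule test_fun_tensor[OF cc B], rule test_fun_tensor[OF ca rD])
  have pt: "\<bar>tensor c B y - ?F y\<bar> \<le> ?R y" for y
  proof -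
    have eq: "tensor c B y - ?F y = c (fst y) * (indicator B (snd y) - u (snd y))" by (simp add: tensor_def right_diff_distrib)
    have "\<bar>indicator B (snd y) - u (snd y)\<bar> \<le> indicator (U - K) (snd y)"
      using u(2)[of "snd y"] u(3)[of "snd y"] u(4)[of "snd y"] u0[of "snd y"] KU(3,4) by (auto simp: indicator_def)
    then have "\<bar>c (fst y)\<bar> * \<bar>indicator B (snd y) - u (snd y)\<bar> \<le> \<bar>c (fst y)\<bar> * indicator (U - K) (snd y)"
      by (rule mult_left_mono) simp
    then show ?thesis unfolding eq abs_mult by (simp only: tensor_def)
  qed
  have "\<bar>periodise (tensor c B) X - periodise ?F X\<bar> \<le> periodise ?R X" if X: "X \<in> \<T>" for X
  proof -
    have "periodise (\<lambda>y. tensor c B y - ?F y) X \<le> periodise ?R X"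
      by (rule periodise_mono[OF test_fun_diff[OF cb(2,1)] cb(3) X]) (use pt in \<open>simp add: abs_le_iff\<close>)
    moreover have "periodise (\<lambda>y. ?F y - tensor c B y) X \<le> periodise ?R X"
      by (rule periodise_mono[OF test_fun_diff[OF cb(1,2)] cb(3) X]) (use pt in \<open>simp add: abs_le_iff\<close>)
    ultimately show ?thesis unfolding periodise_diff[OF cb(2,1) X] periodise_diff[OF cb(1,2) X] by (simp add: abs_le_iff)
  qed
  moreover have "(\<integral>X. periodise ?R X \<partial>mX) \<le> e"
  proof -
    have "(\<integral>X. periodise ?R X \<partial>mX) = k * measure mH (U - K)" using k(2) rD by (simp add: torus_mean_def)
    also have "\<dots> \<le> (k + 1) * (e / (k + 1))" using k(1) KU(6) by (intro mult_mono) auto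
    also have "\<dots> = e" using k(1) by simp
    finally show ?thesis .
  qed
  ultimately show "\<exists>f' r. torus_cont f' \<and> integrable mX r \<and> (\<forall>X\<in>\<T>. \<bar>periodise (tensor c B) X - f' X\<bar> \<le> r X) \<and> (\<integral>X. r X \<partial>mX) \<le> e"
    using torus_cont_periodise[OF F] periodise_integrable[OF cb(3)] by blast
qed

text \<open>Cosets whose points over the windows \<open>Bs j\<close> are seen, by the averages \<open>a\<close>, with the expected
frequency. All compactly supported \<open>c\<close> are required rather than a countable dense family, so that
the set is invariant under the action of \<open>G\<close>.\<close>

definition generic :: "(nat \<Rightarrow> nat \<times> (nat \<Rightarrow> real) \<times> (nat \<Rightarrow> 'g)) \<Rightarrow> (nat \<Rightarrow> 'h set) \<Rightarrow> ('g \<times> 'h) set set" where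
  "generic a Bs = {X\<in>\<T>. \<forall>c\<in>compactly_supported. \<forall>j. (\<lambda>n. avg (a n) (periodise (tensor c (Bs j))) X) \<longlonglongrightarrow> torus_mean (tensor c (Bs j))}"

lemma genericD:
  "X \<in> generic a Bs \<Longrightarrow> c \<in> compactly_supported \<Longrightarrow> (\<lambda>n. avg (a n) (periodise (tensor c (Bs j))) X) \<longlonglongrightarrow> torus_mean (tensor c (Bs j))"
  unfolding generic_def by simp

text \<open>Carries the domination of the error through the periodisation.\<close>

lemma tensor_diff_bound:
  assumes c: "c \<in> compactly_supported" and d: "d \<in> compactly_supported" and u: "u \<in> compactly_supported"
    and B: "rel_compact B" and b: "\<And>x. \<bar>c x - d x\<bar> \<le> e * u x" and X: "X \<in> \<T>"
  shows "\<bar>periodise (tensor c B) X - periodise (tensor d B) X\<bar> \<le> e * periodise (tensor u B) X"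
proof -
  note cb = test_fun_tensor[OF test_fun_compactly_supported[OF c] B] test_fun_tensor[OF test_fun_compactly_supported[OF d] B] test_fun_tensor[OF test_fun_compactly_supported[OF u] B]
  have pt: "\<bar>tensor c B y - tensor d B y\<bar> \<le> e * tensor u B y" for y
    using b[of "fst y"] by (simp add: tensor_def indicator_def)
  have "periodise (\<lambda>y. tensor c B y - tensor d B y) X \<le> periodise (\<lambda>y. e * tensor u B y) X"
    by (rule periodise_mono[OF test_fun_diff[OF cb(1,2)] test_fun_cmult[OF cb(3)] X]) (use pt in \<open>simp add: abs_le_iff\<close>)
  moreover have "periodise (\<lambda>y. tensor d B y - tensor c B y) X \<le> periodise (\<lambda>y. e * tensor u B y) X"
    by (rule periodise_mono[OF test_fun_diff[OF cb(2,1)] test_fun_cmult[OF cb(3)] X]) (use pt in \<open>simp add: abs_le_iff\<close>)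
  ultimately show ?thesis unfolding periodise_diff[OF cb(1,2) X] periodise_diff[OF cb(2,1) X] periodise_cmult by (simp add: abs_le_iff)
qed

text \<open>Almost everywhere convergence for a countable dense family extends to all \<open>c\<close>, because the
error is dominated by \<open>e\<close> times the periodisation for \<open>u\<close>, whose averages converge as well.\<close>

lemma generic_AE:
  assumes Bs: "\<And>j. rel_compact (Bs j)"
  obtains a where "uniform_avg a" "AE X in mX. X \<in> generic a Bs"
proof -
  obtain D :: "('g \<Rightarrow> real) set" where D: "countable D" "D \<subseteq> compactly_supported" "D \<noteq> {}"
    "\<And>c. c \<in> compactly_supported \<Longrightarrow> \<exists>u\<in>D. (\<forall>x. 0 \<le> u x) \<and> (\<forall>e>0. \<exists>d\<in>D. \<forall>x. \<bar>c x - d x\<bar> \<le> e * u x)"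
    using compactly_supported_dense[OF lcG] by blast
  define fam where "fam i = periodise (tensor (from_nat_into D (fst (prod_decode i))) (Bs (snd (prod_decode i))))" for i
  have "L1_approx (fam i)" for i unfolding fam_def using from_nat_into[OF D(3)] D(2) by (intro L1_approx_tensor Bs) blast
  then obtain a where a: "uniform_avg a" "AE X in mX. \<forall>i. (\<lambda>n. avg (a n) (fam i) X) \<longlonglongrightarrow> (\<integral>X. fam i X \<partial>mX)"
    by (rule averages_AE)
  have "AE X in mX. X \<in> generic a Bs"
  proof (rule AE_mp[OF a(2)], intro AE_I2 impI)
    fix X assume "X \<in> space mX" and conv: "\<forall>i. (\<lambda>n. avg (a n) (fam i) X) \<longlonglongrightarrow> (\<integral>X. fam i X \<partial>mX)"
    then have X: "X \<in> \<T>" by simp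
    have ia: "convex_weights (a n)" for n using a(1) by (simp add: uniform_avg_def)
    have convD: "(\<lambda>n. avg (a n) (periodise (tensor d (Bs j))) X) \<longlonglongrightarrow> torus_mean (tensor d (Bs j))" if dD: "d \<in> D" for d j
    proof -
      obtain m where m: "from_nat_into D m = d" using from_nat_into_surj[OF D(1) dD] by blast
      have "fam (prod_encode (m, j)) = periodise (tensor d (Bs j))" by (simp add: fam_def m)
      then show ?thesis using conv[rule_format, of "prod_encode (m, j)"] by (simp add: torus_mean_def)
    qed
    have "(\<lambda>n. avg (a n) (periodise (tensor c (Bs j))) X) \<longlonglongrightarrow> torus_mean (tensor c (Bs j))" if c: "c \<in> compactly_supported" for c j
    proof (rule LIMSEQ_I)
      fix r :: real assume r: "r > 0"
      obtain u where u: "u \<in> D" "\<forall>x. 0 \<le> u x" "\<forall>e>0. \<exists>d\<in>D. \<forall>x. \<bar>c x - d x\<bar> \<le> e * u x" using D(4)[OF c] by blast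
      let ?B = "Bs j"
      define Iu where "Iu = torus_mean (tensor u ?B)"
      have Iu: "Iu \<ge> 0" unfolding Iu_def torus_mean_def by (intro integral_nonneg_AE AE_I2) (auto simp: periodise_def tensor_def u(2) intro!: sum_nonneg)
      \<comment> \<open>From some index on the averages for \<open>u\<close> are at most \<open>Iu + 1\<close>, so the approximation error is at
        most \<open>r / 4\<close>.\<close>
      define e where "e = r / 4 / (Iu + 1)"
      have Iu1: "Iu + 1 \<noteq> 0" "Iu + 1 > 0" using Iu by linarith+
      have e: "e > 0" unfolding e_def using r Iu1 by (intro divide_pos_pos) simp_all
      have eI: "e * (Iu + 1) = r / 4" by (rule nonzero_eq_divide_eq[THEN iffD1, OF Iu1(1) e_def])
      obtain d where d: "d \<in> D" "\<forall>x. \<bar>c x - d x\<bar> \<le> e * u x" using u(3) e by blast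
      have dc: "d \<in> compactly_supported" and uc: "u \<in> compactly_supported" using d(1) u(1) D(2) by auto
      have bd: "\<bar>periodise (tensor c ?B) Z - periodise (tensor d ?B) Z\<bar> \<le> e * periodise (tensor u ?B) Z" if "Z \<in> \<T>" for Z
        by (rule tensor_diff_bound[OF c dc uc Bs _ that]) (use d(2) in blast)
      obtain N1 where N1: "\<And>n. n \<ge> N1 \<Longrightarrow> \<bar>avg (a n) (periodise (tensor d ?B)) X - torus_mean (tensor d ?B)\<bar> < r / 4"
        using LIMSEQ_D[OF convD[OF d(1)], of "r / 4"] r by auto
      obtain N2 where N2: "\<And>n. n \<ge> N2 \<Longrightarrow> \<bar>avg (a n) (periodise (tensor u ?B)) X - Iu\<bar> < 1"
        using LIMSEQ_D[OF convD[OF u(1)], of 1] unfolding Iu_def by auto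
      have i: "integrable mX (periodise (tensor c ?B))" "integrable mX (periodise (tensor d ?B))" "integrable mX (periodise (tensor u ?B))"
        by (rule periodise_integrable[OF test_fun_tensor[OF test_fun_compactly_supported[OF c] Bs]]
            periodise_integrable[OF test_fun_tensor[OF test_fun_compactly_supported[OF dc] Bs]]
            periodise_integrable[OF test_fun_tensor[OF test_fun_compactly_supported[OF uc] Bs]])+
      have Id: "\<bar>torus_mean (tensor c ?B) - torus_mean (tensor d ?B)\<bar> \<le> r / 4"
      proof -
        have "torus_mean (tensor c ?B) - torus_mean (tensor d ?B) = (\<integral>X. periodise (tensor c ?B) X - periodise (tensor d ?B) X \<partial>mX)" unfolding torus_mean_def using i by simp
        moreover have "\<bar>\<integral>X. periodise (tensor c ?B) X - periodise (tensor d ?B) X \<partial>mX\<bar> \<le> (\<integral>X. \<bar>periodise (tensor c ?B) X - periodise (tensor d ?B) X\<bar> \<partial>mX)" by (rule integral_abs_bound)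
        moreover have "\<dots> \<le> (\<integral>X. e * periodise (tensor u ?B) X \<partial>mX)" using i bd by (intro integral_mono) auto
        moreover have "\<dots> = e * Iu" by (simp add: Iu_def torus_mean_def)
        moreover have "e * Iu \<le> r / 4" using eI e by (simp add: distrib_left)
        ultimately show ?thesis by linarith
      qed
      have "norm (avg (a n) (periodise (tensor c ?B)) X - torus_mean (tensor c ?B)) < r" if n: "n \<ge> max N1 N2" for n
      proof -
        have "avg (a n) (periodise (tensor c ?B)) X - avg (a n) (periodise (tensor d ?B)) X \<le> avg (a n) (\<lambda>Z. e * periodise (tensor u ?B) Z) X"
          unfolding avg_diff[symmetric] by (rule avg_mono[OF ia X]) (use bd X in \<open>auto simp: abs_le_iff\<close>)
        moreover have "avg (a n) (periodise (tensor d ?B)) X - avg (a n) (periodise (tensor c ?B)) X \<le> avg (a n) (\<lambda>Z. e * periodise (tensor u ?B) Z) X"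
          unfolding avg_diff[symmetric] by (rule avg_mono[OF ia X]) (use bd X in \<open>auto simp: abs_le_iff\<close>)
        moreover have "avg (a n) (\<lambda>Z. e * periodise (tensor u ?B) Z) X \<le> r / 4"
        proof -
          have "avg (a n) (periodise (tensor u ?B)) X \<le> Iu + 1" using N2[of n] n by simp
          then show ?thesis unfolding avg_cmult eI[symmetric] using e by simp
        qed
        ultimately show ?thesis using N1[of n] n Id r unfolding real_norm_def by linarith
      qed
      then show "\<exists>no. \<forall>n\<ge>no. norm (avg (a n) (periodise (tensor c ?B)) X - torus_mean (tensor c ?B)) < r" by blast
    qed
    then show "X \<in> generic a Bs" using X by (simp add: generic_def)
  qed
  then show ?thesis using that a(1) by blast
qed

text \<open>Acting by \<open>g\<close> amounts to translating the function \<open>c\<close>, and the averages are built from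
translations, which commute.\<close>

lemma generic_act:
  assumes Bs: "\<And>j. rel_compact (Bs j)" and X: "X \<in> generic a Bs"
  shows "act (g, 0) X \<in> generic a Bs"
proof -
  have XT: "X \<in> \<T>" using X by (simp add: generic_def)
  have "(\<lambda>n. avg (a n) (periodise (tensor c (Bs j))) (act (g, 0) X)) \<longlonglongrightarrow> torus_mean (tensor c (Bs j))" if c: "c \<in> compactly_supported" for c j
  proof -
    let ?c = "\<lambda>x. c (g + x)"
    have shift: "(\<lambda>y. tensor c (Bs j) ((g, 0) + y)) = tensor ?c (Bs j)" by (simp add: tensor_def fun_eq_iff)
    have "avg (a n) (periodise (tensor c (Bs j))) (act (g, 0) X) = avg (a n) (periodise (tensor ?c (Bs j))) X" for n
    proof -
      have "periodise (tensor c (Bs j)) (act (h, 0) (act (g, 0) X)) = periodise (tensor ?c (Bs j)) (act (h, 0) X)" for h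
      proof -
        have "act (h, 0) (act (g, 0) X) = act (g, 0) (act (h, 0) X)" by (simp add: act_act add.commute)
        then show ?thesis by (simp only: periodise_act[of _ "(g, 0)"] shift)
      qed
      then show ?thesis by (simp add: avg_def)
    qed
    moreover have "torus_mean (tensor ?c (Bs j)) = torus_mean (tensor c (Bs j))"
      unfolding shift[symmetric] by (rule torus_mean_translate[OF test_fun_tensor[OF test_fun_compactly_supported[OF c] Bs]])
    moreover have "(\<lambda>n. avg (a n) (periodise (tensor ?c (Bs j))) X) \<longlonglongrightarrow> torus_mean (tensor ?c (Bs j))"
      by (rule genericD[OF X compactly_supported_translate[OF c]])
    ultimately show ?thesis by simp
  qed
  then show ?thesis using XT by (simp add: generic_def)
qed

section \<open>Recovering a coset up to a Haar period\<close>

lemma borel_image_add: "S \<in> sets borel \<Longrightarrow> (\<lambda>x. d + x) ` S \<in> sets borel" for d :: 'h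
  using measurable_sets[OF measurable_translate[of "- d"]] by (simp add: image_translate)

text \<open>Reads off from the comb which first coordinates occur over the window.\<close>

lemma nuG_atom:
  "emeasure (nuG B X) {x} = 0 \<longleftrightarrow> \<not> (\<exists>y\<in>X. snd y \<in> B \<and> fst y = x)" for B :: "'h set" and X :: "('g \<times> 'h) set"
proof -
  let ?E = "{y \<in> X \<inter> (UNIV \<times> B). fst y \<in> {x}}"
  have "{x} \<in> sets borel" by simp
  then have "emeasure (nuG B X) {x} = emeasure (count_space (X \<inter> (UNIV \<times> B))) ?E" by (rule emeasure_nuG)
  also have "\<dots> = 0 \<longleftrightarrow> ?E = {}" by (rule emeasure_count_space_eq_0[THEN trans]) auto
  also have "?E = {y. y \<in> X \<and> snd y \<in> B \<and> fst y = x}" by (simp add: mem_Times_iff)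
  also have "\<dots> = {} \<longleftrightarrow> \<not> (\<exists>y\<in>X. snd y \<in> B \<and> fst y = x)" by blast
  finally show ?thesis .
qed

lemma coset_inj_fst: "X \<in> \<T> \<Longrightarrow> y \<in> X \<Longrightarrow> z \<in> X \<Longrightarrow> fst y = fst z \<Longrightarrow> y = z"
proof -
  assume a: "X \<in> \<T>" "y \<in> X" "z \<in> X" "fst y = fst z"
  have "z - y \<in> L" using a(3) torus_eq_q[OF a(1,2)] in_q by blast
  moreover have "fst (z - y) = fst (0 :: 'g \<times> 'h)" using a(4) by simp
  ultimately have "z - y = 0" using inj_onD[OF inj_fst_L] L_0 by blast
  then show "y = z" by simp
qed

text \<open>The two differences have the same measure, since \<open>W\<close> and its translate do; a full overlap makes
both null.\<close>

lemma period_of_overlap: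
  assumes le: "measure mH W \<le> measure mH (W \<inter> (\<lambda>t. d + t) -` W)"
  shows "d \<in> haar_periods mH W"
proof -
  let ?W1 = "(\<lambda>t. d + t) -` W"
  have r1: "rel_compact ?W1" by (rule rel_compact_vimage_add[OF rel_compact_W])
  have b1: "?W1 \<in> sets borel" using r1 by (simp add: rel_compact_def)
  have rI: "rel_compact (W \<inter> ?W1)" using rel_compact_Int[OF r1 W_borel] .
  have m1: "measure mH ?W1 = measure mH W" using mH_vimage[OF W_borel, of d] by (simp add: measure_def)
  have "measure mH (W - W \<inter> ?W1) = measure mH W - measure mH (W \<inter> ?W1)"
    by (rule measurable_measure_Diff[OF fmeasurable_mH[OF rel_compact_W]]) (use rI in \<open>auto simp: rel_compact_def sets_mH\<close>)
  then have z1: "measure mH (W - W \<inter> ?W1) = 0" using le measure_nonneg[of mH "W - W \<inter> ?W1"] by linarith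
  have "measure mH (?W1 - W \<inter> ?W1) = measure mH ?W1 - measure mH (W \<inter> ?W1)"
    by (rule measurable_measure_Diff[OF fmeasurable_mH[OF r1]]) (use rI in \<open>auto simp: rel_compact_def sets_mH\<close>)
  then have z2: "measure mH (?W1 - W \<inter> ?W1) = 0" using le m1 measure_nonneg[of mH "?W1 - W \<inter> ?W1"] by linarith
  have bI: "W \<inter> ?W1 \<in> sets borel" using rI by (simp add: rel_compact_def)
  have e1: "emeasure mH (W - W \<inter> ?W1) = 0" "emeasure mH (?W1 - W \<inter> ?W1) = 0"
    using emeasure_mH[OF rel_compact_Diff[OF rel_compact_W bI]] emeasure_mH[OF rel_compact_Diff[OF r1 bI]] z1 z2 by simp_all
  have s: "W - W \<inter> ?W1 \<in> sets borel" "?W1 - W \<inter> ?W1 \<in> sets borel" using W_borel b1 bI by auto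
  have eq1: "(\<lambda>w. d + w) ` W - W = (\<lambda>w. d + w) ` (W - W \<inter> ?W1)" by auto
  have W1: "(\<lambda>w. d + w) ` ?W1 = W"
  proof (intro equalityI subsetI)
    fix w assume "w \<in> W"
    then have "d + (w - d) \<in> (\<lambda>w. d + w) ` ?W1" by (intro imageI) simp
    then show "w \<in> (\<lambda>w. d + w) ` ?W1" by simp
  qed auto
  have eq2: "W - (\<lambda>w. d + w) ` W = (\<lambda>w. d + w) ` (?W1 - W \<inter> ?W1)"
  proof (intro equalityI subsetI)
    fix w assume w: "w \<in> W - (\<lambda>w. d + w) ` W"
    have dw: "d + (w - d) = w" by simp
    have "w - d \<notin> W"
    proof
      assume "w - d \<in> W"
      then have "d + (w - d) \<in> (\<lambda>w. d + w) ` W" by (rule imageI)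
      then show False using w unfolding dw by blast
    qed
    moreover have "w - d \<in> ?W1" using w by simp
    ultimately have "d + (w - d) \<in> (\<lambda>w. d + w) ` (?W1 - W \<inter> ?W1)" by (intro imageI) blast
    then show "w \<in> (\<lambda>w. d + w) ` (?W1 - W \<inter> ?W1)" unfolding dw .
  qed auto
  have "emeasure mH (((\<lambda>w. d + w) ` W - W) \<union> (W - (\<lambda>w. d + w) ` W)) = 0"
  proof (rule emeasure_Un_null_set[THEN trans])
    have "emeasure mH ((\<lambda>w. d + w) ` (?W1 - W \<inter> ?W1)) = 0" using mH_translate[OF s(2), of d] e1(2) by simp
    moreover have "(\<lambda>w. d + w) ` (?W1 - W \<inter> ?W1) \<in> sets mH"
      unfolding sets_mH by (rule borel_image_add[OF s(2)])
    ultimately show "W - (\<lambda>w. d + w) ` W \<in> null_sets mH" unfolding eq2 by (simp add: null_sets_def)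
    show "(\<lambda>w. d + w) ` W - W \<in> sets mH"
      unfolding eq1 sets_mH by (rule borel_image_add[OF s(1)])
    show "emeasure mH ((\<lambda>w. d + w) ` W - W) = 0" unfolding eq1 using mH_translate[OF s(1), of d] e1(1) by simp
  qed
  then show ?thesis by (simp add: haar_periods_def)
qed

text \<open>Indicators of compact sets are upper semicontinuous: a continuous function above the
indicator of \<open>K\<close> with almost the same mean bounds the averages at every single coset, not only
at generic ones. This matters since the set \<open>K\<close> used later depends on the coset.\<close>

lemma upper_bound_compact:
  assumes a: "uniform_avg a" and X: "X \<in> \<T>" and c: "c \<in> compactly_supported" "\<forall>x. 0 \<le> c x" and K: "compact K"
    and k: "k > 0" "\<forall>N. rel_compact N \<longrightarrow> torus_mean (tensor c N) = k * measure mH N"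
    and lim: "v \<longlonglongrightarrow> l" and le: "\<And>n. v n \<le> avg (a n) (periodise (tensor c K)) X"
  shows "l \<le> k * measure mH K"
proof (rule field_le_epsilon)
  fix e :: real assume e: "e > 0"
  have ia: "convex_weights (a n)" for n using a by (simp add: uniform_avg_def)
  have rK: "rel_compact K" by (rule rel_compact_compact[OF K])
  have "e / k > 0" using e k(1) by simp
  then obtain K0 U where KU: "compact K0" "open U" "K0 \<subseteq> K" "K \<subseteq> U" "rel_compact U" "measure mH (U - K0) < e / k"
    by (rule compact_open_sandwich[OF rK])
  obtain u :: "'h \<Rightarrow> real" where u: "continuous_on UNIV u" "\<And>x. 0 \<le> u x" "\<And>x. u x \<le> 1"
    "\<And>x. x \<in> K \<Longrightarrow> u x = 1" "compact (closure {x. u x \<noteq> 0})" "closure {x. u x \<noteq> 0} \<subseteq> U"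
    using lc_Urysohn[OF lcH KU(2) K KU(4)] by blast
  have uc: "u \<in> compactly_supported" using u by (simp add: compactly_supported_def)
  have u0: "u x = 0" if "x \<notin> U" for x using that u(6) closure_subset[of "{x. u x \<noteq> 0}"] by blast
  let ?F = "\<lambda>y :: 'g \<times> 'h. c (fst y) * u (snd y)"
  have F: "?F \<in> compactly_supported" by (rule compactly_supported_prod[OF c(1) uc])
  have cc: "test_fun c" by (rule test_fun_compactly_supported[OF c(1)])
  have "periodise (tensor c K) Z \<le> periodise ?F Z" if "Z \<in> \<T>" for Z
    by (rule periodise_mono[OF test_fun_tensor[OF cc rK] test_fun_compactly_supported[OF F] that])
      (use c(2) u(2,4) in \<open>auto simp: tensor_def indicator_def\<close>)
  then have "avg (a n) (periodise (tensor c K)) X \<le> avg (a n) (periodise ?F) X" for n using X by (intro avg_mono[OF ia X]) simp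
  then have "v n \<le> avg (a n) (periodise ?F) X" for n using le order_trans by blast
  then have "l \<le> (\<integral>X. periodise ?F X \<partial>mX)"
    using LIMSEQ_le[OF lim uniform_avg_pointwise[OF a torus_cont_periodise[OF F] X]] by blast
  also have "\<dots> \<le> torus_mean (tensor c U)" unfolding torus_mean_def[symmetric]
    by (rule torus_mean_mono[OF test_fun_compactly_supported[OF F] test_fun_tensor[OF cc KU(5)]])
      (use c(2) u(3) u0 in \<open>auto simp: tensor_def indicator_def mult_left_le\<close>)
  also have "\<dots> = k * measure mH U" using k(2) KU(5) by blast
  also have "measure mH U \<le> measure mH K + measure mH (U - K0)"
  proof -
    have bK: "K \<in> sets borel" "K0 \<in> sets borel" "U \<in> sets borel"
      using rK rel_compact_compact[OF KU(1)] KU(5) by (simp_all add: rel_compact_def)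
    have "measure mH U \<le> measure mH (K \<union> (U - K0))"
    proof (rule measure_mono_fmeasurable)
      show "U \<subseteq> K \<union> (U - K0)" using KU(3) by blast
      show "U \<in> sets mH" using bK by (simp add: sets_mH)
      show "K \<union> (U - K0) \<in> fmeasurable mH" by (intro fmeasurable.Un fmeasurable_mH rK rel_compact_Diff[OF KU(5) bK(2)])
    qed
    also have "\<dots> \<le> measure mH K + measure mH (U - K0)" using bK by (intro measure_Un_le) (auto simp: sets_mH)
    finally show ?thesis .
  qed
  also have "k * (measure mH K + measure mH (U - K0)) \<le> k * measure mH K + e"
    using KU(6) k(1) by (simp add: distrib_left pos_less_divide_eq mult.commute)
  finally show "l \<le> k * measure mH K + e" using k(1) by simp
qed

text \<open>The set \<open>Bs 0\<close> is the window and the sets \<open>Bs (Suc j)\<close> are compact subsets that exhaust it in measure.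
For \<open>t\<close> in \<open>snd ` X\<close>, the points \<open>t\<close> and \<open>d + t\<close> lie in \<open>W\<close> simultaneously, hence
\<open>indicator K t + indicator K (d + t) - indicator W t \<le> indicator K' t\<close> with \<open>K = Bs (Suc j)\<close> and \<open>K' = K \<inter> (K - d)\<close>. The averages of
the left side are known at the generic cosets \<open>X\<close> and \<open>(0, d) + X\<close>; those of the right side are
bounded since \<open>K'\<close> is compact. In the limit \<open>W\<close> and \<open>W - d\<close> overlap in measure \<open>mH W\<close>.\<close>

lemma generic_injective:
  assumes a: "uniform_avg a" and Bs: "\<And>j. rel_compact (Bs j)" and B0: "Bs 0 = W"
    and K: "\<And>j. compact (Bs (Suc j))" "\<And>j. Bs (Suc j) \<subseteq> W" "\<And>j. measure mH (W - Bs (Suc j)) < 1 / Suc j"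
    and X: "X \<in> generic a Bs" and Y: "Y \<in> generic a Bs" and eq: "nuG W X = nuG W Y"
  shows "\<exists>d\<in>haar_periods mH W. Y = act (0, d) X"
proof -
  have XT: "X \<in> \<T>" and YT: "Y \<in> \<T>" using X Y by (simp_all add: generic_def)
  have ia: "convex_weights (a n)" for n using a by (simp add: uniform_avg_def)
  obtain c k where c: "c \<in> compactly_supported" "\<forall>x. 0 \<le> c x" and k: "k > 0" "\<forall>N. rel_compact N \<longrightarrow> torus_mean (tensor c N) = k * measure mH N"
    by (rule mean_tensor_pos)
  have cc: "test_fun c" by (rule test_fun_compactly_supported[OF c(1)])
  have convX: "(\<lambda>n. avg (a n) (periodise (tensor c (Bs j))) X) \<longlonglongrightarrow> k * measure mH (Bs j)"
    and convY: "(\<lambda>n. avg (a n) (periodise (tensor c (Bs j))) Y) \<longlonglongrightarrow> k * measure mH (Bs j)" for j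
    using genericD[OF X c(1), of j] genericD[OF Y c(1), of j] k(2)[rule_format, OF Bs[of j]] by simp_all
  have transfer: "\<exists>y'\<in>Y. snd y' \<in> W \<and> fst y' = fst y" if "y \<in> X" "snd y \<in> W" for y
    using nuG_atom[of W X "fst y"] nuG_atom[of W Y "fst y"] that unfolding eq by auto
  have transfer': "\<exists>y'\<in>X. snd y' \<in> W \<and> fst y' = fst y" if "y \<in> Y" "snd y \<in> W" for y
    using nuG_atom[of W X "fst y"] nuG_atom[of W Y "fst y"] that unfolding eq by auto
  \<comment> \<open>A generic coset has points over the window, since otherwise all averages for \<open>W\<close> would vanish.\<close>
  have "\<exists>p\<in>X. snd p \<in> W"
  proof (rule ccontr)
    assume no: "\<not> (\<exists>p\<in>X. snd p \<in> W)"
    have "periodise (tensor c W) (act (g, 0) X) = 0" for g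
    proof -
      have "{y \<in> act (g, 0) X. tensor c W y \<noteq> 0} = {}" using no by (auto simp: act_def tensor_def indicator_def split: if_splits)
      then show ?thesis by (simp only: periodise_def sum.empty)
    qed
    then have "avg (a n) (periodise (tensor c W)) X = 0" for n by (simp add: avg_def)
    then have "(\<lambda>n. 0) \<longlonglongrightarrow> k * measure mH W" using convX[of 0] by (simp add: B0)
    then have "0 = k * measure mH W" by (simp only: LIMSEQ_const_iff)
    then show False using k(1) W_pos' by simp
  qed
  then obtain p where p: "p \<in> X" "snd p \<in> W" by blast
  then obtain p' where p': "p' \<in> Y" "fst p' = fst p" using transfer by blast
  \<comment> \<open>A common first coordinate determines the only possible shift.\<close>
  define d where "d = snd p' - snd p"
  have pd: "p' = (0, d) + p" using p'(2) by (simp add: d_def prod_eq_iff)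
  have Yd: "Y = act (0, d) X"
    using torus_eq_q[OF YT p'(1)] torus_eq_q[OF XT p(1)] by (simp add: act_q pd)
  \<comment> \<open>Points of the two cosets with the same first coordinate correspond under the shift by \<open>d\<close>.\<close>
  have iff: "snd y \<in> W \<longleftrightarrow> d + snd y \<in> W" if y: "y \<in> X" for y
  proof
    assume "snd y \<in> W"
    then obtain y' where y': "y' \<in> Y" "snd y' \<in> W" "fst y' = fst y" using transfer[OF y] by blast
    then obtain z where z: "z \<in> X" "y' = (0, d) + z" unfolding Yd act_def by blast
    then have "z = y" using coset_inj_fst[OF XT z(1) y] y'(3) by simp
    then show "d + snd y \<in> W" using y'(2) z(2) by simp
  next
    assume dy: "d + snd y \<in> W"
    have "(0, d) + y \<in> Y" unfolding Yd act_def using y by (rule imageI)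
    then obtain z where z: "z \<in> X" "snd z \<in> W" "fst z = fst ((0, d) + y)" using transfer'[of "(0, d) + y"] dy by auto
    then have "z = y" using coset_inj_fst[OF XT z(1) y] by simp
    then show "snd y \<in> W" using z(2) by simp
  qed
  have main: "2 * measure mH (Bs (Suc j)) - measure mH W \<le> measure mH (W \<inter> (\<lambda>t. d + t) -` W)" for j
  proof -
    let ?K = "Bs (Suc j)"
    define K' where "K' = ?K \<inter> (\<lambda>t. d + t) -` ?K"
    have cK': "compact K'" unfolding K'_def vimage_translate
      by (rule compact_Int[OF K(1) compact_translation_group(2)[OF K(1)]])
    have rK': "rel_compact K'" by (rule rel_compact_compact[OF cK'])
    note cb = test_fun_tensor[OF cc Bs[of "Suc j"]] test_fun_tensor[OF cc rel_compact_W] test_fun_tensor[OF cc rK']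
    note cbt = test_fun_translate[OF cb(1), of "(0, d)"]
    have ineq: "periodise (tensor c ?K) (act (g, 0) X) + periodise (tensor c ?K) (act (g, 0) Y) - periodise (tensor c W) (act (g, 0) X) \<le> periodise (tensor c K') (act (g, 0) X)" for g
    proof -
      let ?X = "act (g, 0) X"
      have T: "?X \<in> \<T>" using XT by simp
      have "act (g, 0) Y = act (0, d) ?X" unfolding Yd by (simp add: act_act add.commute)
      then have Yp: "periodise (tensor c ?K) (act (g, 0) Y) = periodise (\<lambda>y. tensor c ?K ((0, d) + y)) ?X" by (simp only: periodise_act)
      have "periodise (\<lambda>y. (tensor c ?K y + tensor c ?K ((0, d) + y)) - tensor c W y) ?X \<le> periodise (tensor c K') ?X"
      proof (rule periodise_mono[OF test_fun_diff[OF test_fun_add[OF cb(1) cbt] cb(2)] cb(3) T])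
        fix y assume "y \<in> ?X"
        then obtain z where z: "z \<in> X" "y = (g, 0) + z" unfolding act_def by blast
        have iffy: "snd y \<in> W \<longleftrightarrow> d + snd y \<in> W" using iff[OF z(1)] z(2) by simp
        have "indicator ?K (snd y) + indicator ?K (d + snd y) - indicator W (snd y) \<le> (indicator K' (snd y) :: real)"
          using iffy K(2)[of j] by (auto simp: indicator_def K'_def)
        then have "c (fst y) * (indicator ?K (snd y) + indicator ?K (d + snd y) - indicator W (snd y)) \<le> c (fst y) * indicator K' (snd y)"
          using c(2) by (intro mult_left_mono) auto
        then show "(tensor c ?K y + tensor c ?K ((0, d) + y)) - tensor c W y \<le> tensor c K' y"
          by (simp add: tensor_def algebra_simps)
      qed
      then show ?thesis
        unfolding Yp periodise_diff[OF test_fun_add[OF cb(1) cbt] cb(2) T] periodise_add[OF cb(1) cbt T] .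
    qed
    let ?v = "\<lambda>n. avg (a n) (periodise (tensor c ?K)) X + avg (a n) (periodise (tensor c ?K)) Y - avg (a n) (periodise (tensor c W)) X"
    have vle: "?v n \<le> avg (a n) (periodise (tensor c K')) X" for n
    proof -
      have "?v n = (\<Sum>i<fst (a n). fst (snd (a n)) i * (periodise (tensor c ?K) (act (snd (snd (a n)) i, 0) X) + periodise (tensor c ?K) (act (snd (snd (a n)) i, 0) Y) - periodise (tensor c W) (act (snd (snd (a n)) i, 0) X)))"
        unfolding avg_def sum.distrib[symmetric] sum_subtractf[symmetric] by (simp add: algebra_simps)
      also have "\<dots> \<le> avg (a n) (periodise (tensor c K')) X"
        unfolding avg_def using ia[of n] ineq by (intro sum_mono mult_left_mono) (auto simp: convex_weights_def)
      finally show ?thesis .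
    qed
    have vlim: "?v \<longlonglongrightarrow> k * measure mH ?K + k * measure mH ?K - k * measure mH W"
      using convX[of "Suc j"] convY[of "Suc j"] convX[of 0] unfolding B0 by (intro tendsto_diff tendsto_add)
    have "k * measure mH ?K + k * measure mH ?K - k * measure mH W \<le> k * measure mH K'"
      by (rule upper_bound_compact[OF a XT c cK' k vlim vle])
    then have "k * (2 * measure mH ?K - measure mH W) \<le> k * measure mH K'" by (simp add: algebra_simps)
    then have "2 * measure mH ?K - measure mH W \<le> measure mH K'" using k(1) by simp
    also have "\<dots> \<le> measure mH (W \<inter> (\<lambda>t. d + t) -` W)"
    proof (rule measure_mono_fmeasurable)
      show "K' \<subseteq> W \<inter> (\<lambda>t. d + t) -` W" unfolding K'_def using K(2)[of j] by blast
      show "K' \<in> sets mH" using rK' by (simp add: rel_compact_def sets_mH)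
      show "W \<inter> (\<lambda>t. d + t) -` W \<in> fmeasurable mH"
        by (intro fmeasurable_mH rel_compact_Int[OF rel_compact_vimage_add[OF rel_compact_W] W_borel])
    qed
    finally show ?thesis .
  qed
  have "measure mH W \<le> measure mH (W \<inter> (\<lambda>t. d + t) -` W)"
  proof (rule field_le_epsilon)
    fix e :: real assume e: "e > 0"
    obtain j where j: "2 / e < real (Suc j)" using reals_Archimedean2[of "2 / e"] by (metis less_SucI of_nat_less_iff order_less_trans lessI)
    then have "2 * (1 / real (Suc j)) < e" using e by (simp add: field_simps)
    moreover have "measure mH W - measure mH (Bs (Suc j)) < 1 / real (Suc j)"
      using measurable_measure_Diff[OF fmeasurable_mH[OF rel_compact_W] _ K(2)[of j]] Bs[of "Suc j"] K(3)[of j] by (simp add: rel_compact_def sets_mH)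
    ultimately show "measure mH W \<le> measure mH (W \<inter> (\<lambda>t. d + t) -` W) + e" using main[of j] by linarith
  qed
  then show ?thesis using period_of_overlap Yd by blast
qed

text \<open>The generic set for the window and a sequence of compact subsets that exhaust it in measure.\<close>

theorem nuG_determines_coset:
  obtains Y where "AE X in mX. X \<in> Y" "Y \<subseteq> \<T>" "\<forall>X\<in>Y. \<forall>g. act (g, 0) X \<in> Y"
    "\<forall>X\<in>Y. \<forall>Z\<in>Y. nuG W X = nuG W Z \<longrightarrow> (\<exists>d\<in>haar_periods mH W. Z = act (0, d) X)"
proof -
  have "\<exists>K. compact K \<and> K \<subseteq> W \<and> measure mH (W - K) < 1 / Suc j" for j
  proof -
    have "1 / real (Suc j) > 0" by simp
    then obtain K U where KU: "compact K" "open U" "K \<subseteq> W" "W \<subseteq> U" "rel_compact U" "measure mH (U - K) < 1 / real (Suc j)"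
      by (rule compact_open_sandwich[OF rel_compact_W])
    have bK: "K \<in> sets borel" using rel_compact_compact[OF KU(1)] by (simp add: rel_compact_def)
    have "measure mH (W - K) \<le> measure mH (U - K)"
      by (rule measure_mono_fmeasurable) (use KU(4) W_borel bK fmeasurable_mH[OF rel_compact_Diff[OF KU(5) bK]] in \<open>auto simp: sets_mH\<close>)
    then show ?thesis using KU by (intro exI[of _ K]) simp
  qed
  then obtain K where K: "\<And>j. compact (K j)" "\<And>j. K j \<subseteq> W" "\<And>j. measure mH (W - K j) < 1 / Suc j" by metis
  define Bs where "Bs j = (case j of 0 \<Rightarrow> W | Suc i \<Rightarrow> K i)" for j
  have B: "Bs 0 = W" "\<And>j. Bs (Suc j) = K j" by (simp_all add: Bs_def)
  have rB: "rel_compact (Bs j)" for j by (cases j) (simp_all add: B rel_compact_W rel_compact_compact[OF K(1)])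
  obtain a where a: "uniform_avg a" "AE X in mX. X \<in> generic a Bs" by (rule generic_AE[OF rB])
  show ?thesis
  proof (rule that[of "generic a Bs"])
    show "\<forall>X\<in>generic a Bs. \<forall>Z\<in>generic a Bs. nuG W X = nuG W Z \<longrightarrow> (\<exists>d\<in>haar_periods mH W. Z = act (0, d) X)"
      using generic_injective[where Bs=Bs, OF a(1) rB B(1)] K unfolding B(2) by blast
    show "\<forall>X\<in>generic a Bs. \<forall>g. act (g, 0) X \<in> generic a Bs" using generic_act[where Bs=Bs, OF rB] by blast
    show "generic a Bs \<subseteq> \<T>" by (auto simp: generic_def)
  qed (rule a(2))
qed

end

context haar_scheme
begin

section \<open>Haar periods\<close>

abbreviation Wv :: "'h \<Rightarrow> 'h set" where "Wv v \<equiv> (\<lambda>t. v + t) -` W"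
abbreviation Per :: "'h set" where "Per \<equiv> haar_periods mH W"

lemma rel_compact_Wv: "rel_compact (Wv v)" by (rule rel_compact_vimage_add[OF rel_compact_W])
lemma borel_Wv: "Wv v \<in> sets borel" using rel_compact_Wv by (simp add: rel_compact_def)

lemma measure_vimage_add: "A \<in> sets borel \<Longrightarrow> measure mH ((\<lambda>t. v + t) -` A) = measure mH A"
  using mH_vimage[of A v] by (simp add: measure_def)

lemma measure_Diff_Wv: "measure mH (W - Wv v) = measure mH W - measure mH (W \<inter> Wv v)"
  and measure_Wv_Diff: "measure mH (Wv v - W) = measure mH W - measure mH (W \<inter> Wv v)"
proof -
  have b: "W \<inter> Wv v \<in> sets mH" using W_borel borel_Wv by (simp add: sets_mH)
  have "W - Wv v = W - W \<inter> Wv v" by blast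
  then show "measure mH (W - Wv v) = measure mH W - measure mH (W \<inter> Wv v)"
    using measurable_measure_Diff[OF fmeasurable_mH[OF rel_compact_W] b] by simp
  have "Wv v - W = Wv v - W \<inter> Wv v" by blast
  then show "measure mH (Wv v - W) = measure mH W - measure mH (W \<inter> Wv v)"
    using measurable_measure_Diff[OF fmeasurable_mH[OF rel_compact_Wv] b] measure_vimage_add[OF W_borel] by simp
qed

text \<open>Shifting the inner compact set of a sandwich by a small amount keeps it inside the outer open
set.\<close>

lemma translation_continuous:
  assumes e: "e > (0::real)"
  obtains V where "open V" "0 \<in> V" "\<forall>v\<in>V. measure mH (W - Wv v) < e"
proof -
  obtain K U where KU: "compact K" "open U" "K \<subseteq> W" "W \<subseteq> U" "rel_compact U" "measure mH (U - K) < e"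
    by (rule compact_open_sandwich[OF rel_compact_W e])
  have bK: "K \<in> sets borel" using rel_compact_compact[OF KU(1)] by (simp add: rel_compact_def)
  have bU: "U \<in> sets borel" using KU(2) by simp
  have c: "continuous_on UNIV (\<lambda>p :: 'h \<times> 'h. snd p - fst p)" by (intro continuous_intros)
  have "open ((\<lambda>p :: 'h \<times> 'h. snd p - fst p) -` U)" by (rule open_vimage[OF KU(2) c])
  moreover have "{0} \<times> K \<subseteq> (\<lambda>p :: 'h \<times> 'h. snd p - fst p) -` U" using KU(3,4) by auto
  ultimately have "\<exists>V. 0 \<in> V \<and> open V \<and> V \<times> K \<subseteq> (\<lambda>p :: 'h \<times> 'h. snd p - fst p) -` U"
    by (rule Elementary_Topology.tube_lemma[OF KU(1)])
  then obtain V where V: "0 \<in> V" "open V" "V \<times> K \<subseteq> (\<lambda>p :: 'h \<times> 'h. snd p - fst p) -` U"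
    by (elim exE conjE)
  have "measure mH (W - Wv v) < e" if v: "v \<in> V" for v
  proof -
    let ?Kv = "(\<lambda>t. v + t) -` K"
    have KvU: "?Kv \<subseteq> U"
    proof
      fix t assume "t \<in> ?Kv"
      then have "(v, v + t) \<in> (\<lambda>p :: 'h \<times> 'h. snd p - fst p) -` U" using V(3) v by blast
      then show "t \<in> U" by simp
    qed
    have rKv: "rel_compact ?Kv" by (rule rel_compact_vimage_add[OF rel_compact_compact[OF KU(1)]])
    have bKv: "?Kv \<in> sets borel" using rKv by (simp add: rel_compact_def)
    have "measure mH (W - Wv v) \<le> measure mH (U - ?Kv)"
    proof (rule measure_mono_fmeasurable)
      show "W - Wv v \<subseteq> U - ?Kv" using KU(3,4) by blast
      show "W - Wv v \<in> sets mH" using W_borel borel_Wv by (simp add: sets_mH)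
      show "U - ?Kv \<in> fmeasurable mH" by (rule fmeasurable_mH[OF rel_compact_Diff[OF KU(5) bKv]])
    qed
    also have "\<dots> = measure mH U - measure mH ?Kv"
      using measurable_measure_Diff[OF fmeasurable_mH[OF KU(5)] _ KvU] bKv by (simp add: sets_mH)
    also have "\<dots> = measure mH U - measure mH K" by (simp add: measure_vimage_add[OF bK])
    also have "\<dots> = measure mH (U - K)"
      using measurable_measure_Diff[OF fmeasurable_mH[OF KU(5)] _ order_trans[OF KU(3,4)]] bK by (simp add: sets_mH)
    finally show ?thesis using KU(6) by simp
  qed
  then show ?thesis using that V(1,2) by blast
qed

lemma period_iff: "d \<in> Per \<longleftrightarrow> measure mH (W - Wv d) = 0"
proof
  assume d: "d \<in> Per"
  let ?dW = "(\<lambda>w. d + w) ` W"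
  have bd: "?dW \<in> sets borel" by (rule borel_image_add[OF W_borel])
  have "sym_diff ?dW W \<in> null_sets mH"
    using d bd W_borel by (auto simp: haar_periods_def null_sets_def sets_mH)
  then have "?dW - W \<in> null_sets mH" by (rule null_sets_subset) (use bd W_borel in \<open>auto simp: sets_mH\<close>)
  then have z: "emeasure mH (?dW - W) = 0" by blast
  have "?dW - W = (\<lambda>w. d + w) ` (W - Wv d)" by auto
  then have "emeasure mH (W - Wv d) = 0" using z mH_translate[of "W - Wv d" d] W_borel borel_Wv by simp
  then show "measure mH (W - Wv d) = 0" by (simp add: measure_def)
next
  assume "measure mH (W - Wv d) = 0"
  then show "d \<in> Per" unfolding measure_Diff_Wv by (intro period_of_overlap) simp
qed

text \<open>A triangle inequality: the measure of \<open>W - Wv d\<close> is half the measure of the symmetric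
difference of \<open>W\<close> and its translate, so it defines a translation invariant pseudometric, and the
periods are its zeros.\<close>

lemma measure_Diff_trans:
  "measure mH (W - Wv (d + e)) \<le> measure mH (W - Wv e) + measure mH (W - Wv d)"
proof -
  have shift: "Wv e - Wv (d + e) = (\<lambda>t. e + t) -` (W - Wv d)" by (auto simp: add.assoc)
  have r: "rel_compact (W - Wv e)" "rel_compact (Wv e - Wv (d + e))"
    using rel_compact_Diff[OF rel_compact_W borel_Wv] rel_compact_Diff[OF rel_compact_Wv borel_Wv] by auto
  have "measure mH (W - Wv (d + e)) \<le> measure mH ((W - Wv e) \<union> (Wv e - Wv (d + e)))"
  proof (rule measure_mono_fmeasurable)
    show "W - Wv (d + e) \<in> sets mH" using W_borel borel_Wv by (simp add: sets_mH)
    show "(W - Wv e) \<union> (Wv e - Wv (d + e)) \<in> fmeasurable mH" by (intro fmeasurable.Un fmeasurable_mH r)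
  qed blast
  also have "\<dots> \<le> measure mH (W - Wv e) + measure mH (Wv e - Wv (d + e))"
    using r by (intro measure_Un_le) (auto simp: rel_compact_def sets_mH)
  also have "measure mH (Wv e - Wv (d + e)) = measure mH (W - Wv d)"
    unfolding shift by (rule measure_vimage_add) (use W_borel borel_Wv in simp)
  finally show ?thesis .
qed

lemma measure_Diff_uminus: "measure mH (W - Wv (- d)) = measure mH (W - Wv d)"
proof -
  have eq: "(\<lambda>t. d + t) -` (W \<inter> Wv (- d)) = W \<inter> Wv d" by auto
  have b: "W \<inter> Wv (- d) \<in> sets borel" by (rule sets.Int[OF W_borel borel_Wv])
  have "measure mH (W \<inter> Wv (- d)) = measure mH (W \<inter> Wv d)"
    using measure_vimage_add[OF b, of d] unfolding eq by (rule sym)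
  then show ?thesis unfolding measure_Diff_Wv by (simp only:)
qed

lemma Per_0: "0 \<in> Per" unfolding period_iff by (simp add: vimage_def)

lemma Per_add: assumes "d \<in> Per" "e \<in> Per" shows "d + e \<in> Per"
  using measure_Diff_trans[of d e] assms measure_nonneg[of mH "W - Wv (d + e)"] unfolding period_iff by linarith

lemma Per_uminus: "d \<in> Per \<Longrightarrow> - d \<in> Per" unfolding period_iff measure_Diff_uminus .

text \<open>The pseudometric is small near 0, so a limit of periods is at distance less than any \<open>e\<close>
from one.\<close>

lemma closed_Per: "closed Per"
proof -
  have "closure Per \<subseteq> Per"
  proof
    fix d assume d: "d \<in> closure Per"
    have "measure mH (W - Wv d) \<le> 0 + e" if e: "e > 0" for e
    proof -
      obtain V where V: "open V" "0 \<in> V" "\<forall>v\<in>V. measure mH (W - Wv v) < e" by (rule translation_continuous[OF e])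
      have c: "continuous_on UNIV (\<lambda>t. d - t)" by (intro continuous_intros)
      have "open ((\<lambda>t. d - t) -` V)" by (rule open_vimage[OF V(1) c])
      moreover have "d \<in> (\<lambda>t. d - t) -` V \<inter> closure Per" using d V(2) by simp
      ultimately have "(\<lambda>t. d - t) -` V \<inter> Per \<noteq> {}"
        using open_Int_closure_eq_empty[of "(\<lambda>t. d - t) -` V" Per] by blast
      then obtain d' where d': "d' \<in> Per" "d - d' \<in> V" by blast
      have "measure mH (W - Wv d') = 0" using d'(1) unfolding period_iff .
      moreover have "measure mH (W - Wv (d - d')) < e" using V(3) d'(2) by blast
      moreover have "measure mH (W - Wv ((d - d') + d')) \<le> measure mH (W - Wv d') + measure mH (W - Wv (d - d'))"
        by (rule measure_Diff_trans)
      ultimately show ?thesis by simp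
    qed
    then have "measure mH (W - Wv d) \<le> 0" by (rule field_le_epsilon)
    then show "d \<in> Per" unfolding period_iff using measure_nonneg[of mH "W - Wv d"] by linarith
  qed
  then show ?thesis using closure_subset_eq by blast
qed

text \<open>A period moves \<open>W\<close>, a set of positive measure, to a set that meets it; so it is a difference of two
points of \<open>W\<close>.\<close>

lemma compact_Per: "compact Per"
proof -
  have c: "continuous_on (closure W \<times> closure W) (\<lambda>p :: 'h \<times> 'h. fst p - snd p)" by (intro continuous_intros)
  have cpt: "compact ((\<lambda>p :: 'h \<times> 'h. fst p - snd p) ` (closure W \<times> closure W))"
    by (rule compact_continuous_image[OF c compact_Times[OF W_compact W_compact]])
  have "Per \<subseteq> (\<lambda>p :: 'h \<times> 'h. fst p - snd p) ` (closure W \<times> closure W)"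
  proof
    fix d assume "d \<in> Per"
    then have "measure mH (W \<inter> Wv d) = measure mH W" unfolding period_iff measure_Diff_Wv by simp
    then have "W \<inter> Wv d \<noteq> {}" using W_pos' by (metis measure_empty less_irrefl)
    then obtain t where t: "t \<in> W" "d + t \<in> W" by blast
    then have "(d + t, t) \<in> closure W \<times> closure W" using closure_subset[of W] by blast
    then have "fst (d + t, t) - snd (d + t, t) \<in> (\<lambda>p :: 'h \<times> 'h. fst p - snd p) ` (closure W \<times> closure W)" by (rule imageI)
    then show "d \<in> (\<lambda>p :: 'h \<times> 'h. fst p - snd p) ` (closure W \<times> closure W)" by simp
  qed
  then show ?thesis using compact_Int_closed[OF cpt closed_Per] by (simp add: inf.absorb2)
qed

section \<open>A periodic version of the window\<close>

text \<open>Otherwise finitely many null translates of \<open>V\<close> would cover \<open>W\<close>.\<close>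

lemma open_pos: assumes "open V" "V \<noteq> {}" shows "emeasure mH V > 0"
proof (rule ccontr)
  assume "\<not> emeasure mH V > 0"
  then have z: "emeasure mH V = 0" by simp
  obtain v where v: "v \<in> V" using assms(2) by blast
  have "\<And>x. x \<in> closure W \<Longrightarrow> open ((\<lambda>w. (x - v) + w) ` V)" by (rule open_translation_group(1)[OF assms(1)])
  moreover have "closure W \<subseteq> (\<Union>x\<in>closure W. (\<lambda>w. (x - v) + w) ` V)"
  proof
    fix x assume x: "x \<in> closure W"
    have "(x - v) + v \<in> (\<lambda>w. (x - v) + w) ` V" using v by (rule imageI)
    then show "x \<in> (\<Union>x\<in>closure W. (\<lambda>w. (x - v) + w) ` V)" using x by auto
  qed
  ultimately obtain C where C: "C \<subseteq> closure W" "finite C" "closure W \<subseteq> (\<Union>x\<in>C. (\<lambda>w. (x - v) + w) ` V)"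
    by (rule compactE_image[OF W_compact])
  have "(\<Union>x\<in>C. (\<lambda>w. (x - v) + w) ` V) \<in> null_sets mH"
  proof (rule null_sets.finite_UN[OF C(2)])
    fix x
    have "V \<in> sets borel" using assms(1) by simp
    then show "(\<lambda>w. (x - v) + w) ` V \<in> null_sets mH"
      using mH_translate[of V "x - v"] z borel_image_add[of V "x - v"] by (auto simp: null_sets_def sets_mH)
  qed
  then have "W \<in> null_sets mH"
    by (rule null_sets_subset) (use C(3) closure_subset[of W] W_borel in \<open>auto simp: sets_mH\<close>)
  then show False using W_pos by auto
qed

text \<open>The points \<open>h\<close> for which more than half of \<open>h + V\<close> lies in \<open>W\<close>. Unlike membership in \<open>W\<close> itself
this depends on \<open>W\<close> up to null sets only, so it is exactly invariant under Haar periods.\<close>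

definition majority :: "'h set \<Rightarrow> 'h set" where
  "majority V = {h. 2 * measure mH (V \<inter> Wv h) > measure mH V}"

lemma majority_periodic:
  assumes V: "rel_compact V" and t: "t \<in> Per" shows "h + t \<in> majority V \<longleftrightarrow> h \<in> majority V"
proof -
  have le: "measure mH (V \<inter> Wv h) \<le> measure mH (V \<inter> Wv (h + t))" if t: "t \<in> Per" for h t
  proof -
    have shift: "Wv h - Wv (h + t) = (\<lambda>s. h + s) -` (W - Wv t)" by (auto simp: ac_simps)
    have bV: "V \<in> sets borel" using V by (simp add: rel_compact_def)
    have z: "measure mH (Wv h - Wv (h + t)) = 0"
      unfolding shift using measure_vimage_add[of "W - Wv t" h] t W_borel borel_Wv unfolding period_iff by simp
    have r: "rel_compact (V \<inter> Wv (h + t))" "rel_compact (Wv h - Wv (h + t))"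
      using rel_compact_Int[OF rel_compact_Wv bV] rel_compact_Diff[OF rel_compact_Wv borel_Wv] by auto
    have "measure mH (V \<inter> Wv h) \<le> measure mH ((V \<inter> Wv (h + t)) \<union> (Wv h - Wv (h + t)))"
    proof (rule measure_mono_fmeasurable)
      show "V \<inter> Wv h \<in> sets mH" using bV borel_Wv by (simp add: sets_mH)
      show "(V \<inter> Wv (h + t)) \<union> (Wv h - Wv (h + t)) \<in> fmeasurable mH" by (intro fmeasurable.Un fmeasurable_mH r)
    qed blast
    also have "\<dots> \<le> measure mH (V \<inter> Wv (h + t)) + measure mH (Wv h - Wv (h + t))"
      using r by (intro measure_Un_le) (auto simp: rel_compact_def sets_mH)
    finally show ?thesis using z by simp
  qed
  have "measure mH (V \<inter> Wv (h + t)) = measure mH (V \<inter> Wv h)"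
    using le[OF t, of h] le[OF Per_uminus[OF t], of "h + t"] by simp
  then show ?thesis by (simp add: majority_def)
qed

text \<open>Chebyshev's inequality: a point \<open>h\<close> where \<open>W\<close> and the majority vote disagree sees a disagreement on
at least half of \<open>h + V\<close>. By Tonelli the total disagreement is at most \<open>2 * e\<close> times the measure of \<open>V\<close>, so
the points of disagreement have measure at most \<open>4 * e\<close>.\<close>

lemma majority_approx:
  assumes V: "open V" "0 \<in> V" "rel_compact V" and small: "\<forall>v\<in>V. measure mH (W - Wv v) < e" and e: "e > 0"
  shows "majority V \<in> sets borel" "emeasure mH (sym_diff W (majority V)) \<le> ennreal (4 * e)"
proof -
  interpret H: sigma_finite_measure mH by (rule sigma_finite_mH)
  interpret PS: pair_sigma_finite mH mH by unfold_locales
  have bV: "V \<in> sets borel" using V(3) by (simp add: rel_compact_def)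
  have Vp: "measure mH V > 0"
  proof -
    have "V \<noteq> {}" using V(2) by blast
    then have "emeasure mH V > 0" by (rule open_pos[OF V(1)])
    then show ?thesis unfolding emeasure_mH[OF V(3)] by simp
  qed
  have m1: "(\<lambda>p :: 'h \<times> 'h. fst p + snd p) \<in> borel \<rightarrow>\<^sub>M borel"
    by (intro borel_measurable_continuous_onI continuous_intros)
  have cong: "sets (mH \<Otimes>\<^sub>M mH) = sets (borel :: ('h \<times> 'h) measure)"
    unfolding borel_prod[symmetric] by (intro sets_pair_measure_cong sets_mH)
  have sp: "space (mH \<Otimes>\<^sub>M mH) = UNIV" by (simp add: space_pair_measure)
  have A: "{p :: 'h \<times> 'h. fst p + snd p \<in> W} \<in> sets borel" using measurable_sets[OF m1 W_borel] by (simp add: vimage_def)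
  have f: "fst \<in> (borel :: ('h \<times> 'h) measure) \<rightarrow>\<^sub>M borel" "snd \<in> (borel :: ('h \<times> 'h) measure) \<rightarrow>\<^sub>M borel"
    by (intro borel_measurable_continuous_onI continuous_on_fst continuous_on_snd continuous_on_id)+
  have BV: "{p :: 'h \<times> 'h. snd p \<in> V} \<in> sets borel" using measurable_sets[OF f(2) bV] by (simp add: vimage_def)
  have BW: "{p :: 'h \<times> 'h. fst p \<in> W} \<in> sets borel" using measurable_sets[OF f(1) W_borel] by (simp add: vimage_def)
  let ?E = "{p :: 'h \<times> 'h. snd p \<in> V} \<inter> {p. fst p + snd p \<in> W}"
  have E: "?E \<in> sets (mH \<Otimes>\<^sub>M mH)" unfolding cong using A BV by (rule sets.Int[rotated])
  have rVW: "rel_compact (V \<inter> Wv h)" for h by (rule rel_compact_Int[OF rel_compact_Wv bV])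
  have "(\<lambda>h. emeasure mH (Pair h -` ?E)) \<in> borel_measurable mH" by (rule H.measurable_emeasure_Pair[OF E])
  moreover have "Pair h -` ?E = V \<inter> Wv h" for h by auto
  ultimately have m: "(\<lambda>h. emeasure mH (V \<inter> Wv h)) \<in> borel_measurable mH" by simp
  have mm: "(\<lambda>h. measure mH (V \<inter> Wv h)) \<in> borel_measurable borel"
  proof -
    note [measurable] = m
    have "(\<lambda>h. enn2real (emeasure mH (V \<inter> Wv h))) \<in> borel_measurable mH" by measurable
    then show ?thesis unfolding measure_def using measurable_cong_sets[OF sets_mH refl] by blast
  qed
  have "{h \<in> space borel. measure mH V < 2 * measure mH (V \<inter> Wv h)} \<in> sets borel" using mm by (intro borel_measurable_less) auto
  then show bM: "majority V \<in> sets borel" by (simp add: majority_def)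
  \<comment> \<open>The pairs \<open>(h, v)\<close> with \<open>v \<in> V\<close> for which \<open>h\<close> and \<open>h + v\<close> disagree about \<open>W\<close>.\<close>
  let ?F = "{p :: 'h \<times> 'h. snd p \<in> V} \<inter> sym_diff {p. fst p \<in> W} {p. fst p + snd p \<in> W}"
  have F: "?F \<in> sets (mH \<Otimes>\<^sub>M mH)" unfolding cong using A BV BW by auto
  have r1: "rel_compact (V - Wv h)" for h by (rule rel_compact_Diff[OF V(3) borel_Wv])
  have low: "ennreal (measure mH V / 2) * indicator (sym_diff W (majority V)) h \<le> emeasure mH (Pair h -` ?F)" for h
  proof (cases "h \<in> sym_diff W (majority V)")
    case False then show ?thesis by simp
  next
    case True
    show ?thesis
    proof (cases "h \<in> W")
      case hW: True
      then have "h \<notin> majority V" using True by blast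
      then have a: "2 * measure mH (V \<inter> Wv h) \<le> measure mH V" by (simp add: majority_def)
      have "Pair h -` ?F = V - Wv h" using hW by auto
      moreover have "measure mH (V - Wv h) = measure mH V - measure mH (V \<inter> Wv h)"
      proof -
        have "V - Wv h = V - V \<inter> Wv h" by blast
        moreover have "V \<inter> Wv h \<in> sets mH" using rVW by (simp add: rel_compact_def sets_mH)
        ultimately show ?thesis using measurable_measure_Diff[OF fmeasurable_mH[OF V(3)], of "V \<inter> Wv h"] by simp
      qed
      ultimately show ?thesis using True a by (simp add: emeasure_mH[OF r1] ennreal_leI)
    next
      case hW: False
      then have "h \<in> majority V" using True by blast
      then have a: "measure mH V < 2 * measure mH (V \<inter> Wv h)" by (simp add: majority_def)
      have "Pair h -` ?F = V \<inter> Wv h" using hW by auto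
      then show ?thesis using True a by (simp add: emeasure_mH[OF rVW] ennreal_leI)
    qed
  qed
  have up: "emeasure mH ((\<lambda>h. (h, v)) -` ?F) \<le> ennreal (2 * e) * indicator V v" for v
  proof (cases "v \<in> V")
    case False
    then have "(\<lambda>h. (h, v)) -` ?F = {}" by auto
    then show ?thesis by simp
  next
    case True
    have eq: "(\<lambda>h. (h, v)) -` ?F = (W - Wv v) \<union> (Wv v - W)" using True by (auto simp: add.commute)
    have r: "rel_compact (W - Wv v)" "rel_compact (Wv v - W)"
      by (rule rel_compact_Diff[OF rel_compact_W borel_Wv], rule rel_compact_Diff[OF rel_compact_Wv W_borel])
    have "emeasure mH ((W - Wv v) \<union> (Wv v - W)) \<le> emeasure mH (W - Wv v) + emeasure mH (Wv v - W)"
      using r by (intro emeasure_subadditive) (auto simp: rel_compact_def sets_mH)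
    also have "\<dots> = ennreal (measure mH (W - Wv v) + measure mH (Wv v - W))"
      unfolding emeasure_mH[OF r(1)] emeasure_mH[OF r(2)] by simp
    also have "\<dots> \<le> ennreal (2 * e)"
      using small True measure_Wv_Diff[of v] measure_Diff_Wv[of v] by (intro ennreal_leI) fastforce
    finally show ?thesis using True unfolding eq by simp
  qed
  have bS: "sym_diff W (majority V) \<in> sets mH" using bM W_borel by (auto simp: sets_mH)
  have "ennreal (measure mH V / 2) * emeasure mH (sym_diff W (majority V)) = (\<integral>\<^sup>+h. ennreal (measure mH V / 2) * indicator (sym_diff W (majority V)) h \<partial>mH)"
    using bS by (simp only: nn_integral_cmult_indicator)
  also have "\<dots> \<le> (\<integral>\<^sup>+h. emeasure mH (Pair h -` ?F) \<partial>mH)" by (intro nn_integral_mono low)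
  also have "\<dots> = emeasure (mH \<Otimes>\<^sub>M mH) ?F" by (rule H.emeasure_pair_measure_alt[OF F, symmetric])
  also have "\<dots> = (\<integral>\<^sup>+v. emeasure mH ((\<lambda>h. (h, v)) -` ?F) \<partial>mH)" by (rule PS.emeasure_pair_measure_alt2[OF F])
  also have "\<dots> \<le> (\<integral>\<^sup>+v. ennreal (2 * e) * indicator V v \<partial>mH)" by (intro nn_integral_mono up)
  also have "\<dots> = ennreal (2 * e) * emeasure mH V" using bV by (intro nn_integral_cmult_indicator) (simp add: sets_mH)
  also have "\<dots> = ennreal (measure mH V / 2) * ennreal (4 * e)"
    unfolding emeasure_mH[OF V(3)] using e by (simp add: ennreal_mult[symmetric] mult.commute)
  finally have fin: "ennreal (measure mH V / 2) * emeasure mH (sym_diff W (majority V)) \<le> ennreal (measure mH V / 2) * ennreal (4 * e)" .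
  then show "emeasure mH (sym_diff W (majority V)) \<le> ennreal (4 * e)"
    using Vp by (subst (asm) ennreal_mult_le_mult_iff) auto
qed

text \<open>Majority votes over neighbourhoods chosen for the summable errors \<open>(1/2) ^ n\<close> agree eventually with
\<open>W\<close> at almost every point, by the Borel-Cantelli lemma. Their lower limit inherits exact
periodicity.\<close>

lemma periodic_version:
  obtains W' where "W' \<in> sets borel" "\<forall>t\<in>Per. \<forall>h. h + t \<in> W' \<longleftrightarrow> h \<in> W'" "AE h in mH. h \<in> W \<longleftrightarrow> h \<in> W'"
proof -
  have "\<exists>V. open V \<and> 0 \<in> V \<and> rel_compact V \<and> (\<forall>v\<in>V. measure mH (W - Wv v) < (1/2)^n)" for n :: nat
  proof -
    have "(1/2 :: real)^n > 0" by simp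
    then obtain V where V: "open V" "0 \<in> V" "\<forall>v\<in>V. measure mH (W - Wv v) < (1/2)^n" by (rule translation_continuous)
    obtain V' where V': "open V'" "0 \<in> V'" "compact (closure V')" "closure V' \<subseteq> V" by (rule lc_nbhd[OF lcH V(1,2)])
    then have "rel_compact V'" "V' \<subseteq> V" using closure_subset[of V'] by (auto simp: rel_compact_def)
    then show ?thesis using V V' by (intro exI[of _ V']) blast
  qed
  then have "\<forall>n. \<exists>V. open V \<and> 0 \<in> V \<and> rel_compact V \<and> (\<forall>v\<in>V. measure mH (W - Wv v) < (1/2)^n)" by (rule allI)
  then obtain V where V: "\<forall>n. open (V n) \<and> 0 \<in> V n \<and> rel_compact (V n) \<and> (\<forall>v\<in>V n. measure mH (W - Wv v) < (1/2)^n)"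
    by (rule choice[THEN exE])
  have ap: "majority (V n) \<in> sets borel" "emeasure mH (sym_diff W (majority (V n))) \<le> ennreal (4 * (1/2)^n)" for n
    using majority_approx[of "V n" "(1/2)^n"] V by auto
  \<comment> \<open>The points that eventually win every vote.\<close>
  define W' where "W' = (\<Union>N. \<Inter>n\<in>{N..}. majority (V n))"
  have "W' \<in> sets borel" unfolding W'_def using ap(1) by (intro sets.countable_UN sets.countable_INT) auto
  moreover have "h + t \<in> W' \<longleftrightarrow> h \<in> W'" if "t \<in> Per" for t h
    using majority_periodic[OF _ that] V by (simp add: W'_def)
  moreover have "AE h in mH. h \<in> W \<longleftrightarrow> h \<in> W'"
  proof -
    let ?A = "\<lambda>n. sym_diff W (majority (V n))"
    have "AE h in mH. eventually (\<lambda>n. h \<in> space mH - ?A n) sequentially"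
    proof (rule borel_cantelli_AE1)
      show "?A n \<in> sets mH" for n using ap(1) W_borel by (auto simp: sets_mH)
      show "emeasure mH (?A n) < \<infinity>" for n using ap(2)[of n] by (rule le_less_trans) simp
      show "summable (\<lambda>n. measure mH (?A n))"
      proof (rule summable_comparison_test)
        show "summable (\<lambda>n. 4 * (1/2 :: real)^n)" by (intro summable_mult summable_geometric) simp
        have "measure mH (?A n) \<le> 4 * (1/2)^n" for n
          unfolding measure_def using ap(2)[of n] by (intro enn2real_leI) auto
        then show "\<exists>N. \<forall>n\<ge>N. norm (measure mH (?A n)) \<le> 4 * (1/2)^n" by (intro exI[of _ 0]) simp
      qed
    qed
    then show ?thesis
    proof (rule AE_mp, intro AE_I2 impI)
      fix h assume "eventually (\<lambda>n. h \<in> space mH - ?A n) sequentially"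
      then obtain N where "\<And>n. n \<ge> N \<Longrightarrow> h \<notin> ?A n" unfolding eventually_sequentially by blast
      then have N: "\<And>n. n \<ge> N \<Longrightarrow> h \<in> W \<longleftrightarrow> h \<in> majority (V n)" by blast
      show "h \<in> W \<longleftrightarrow> h \<in> W'"
      proof
        assume "h \<in> W" then show "h \<in> W'" unfolding W'_def using N by (intro UN_I[of N]) auto
      next
        assume "h \<in> W'"
        then obtain M where "\<And>n. n \<ge> M \<Longrightarrow> h \<in> majority (V n)" unfolding W'_def by auto
        then have "h \<in> majority (V (max M N))" by simp
        then show "h \<in> W" using N[of "max M N"] by simp
      qed
    qed
  qed
  ultimately show ?thesis using that by blast
qed

section \<open>Cosets missing a null set\<close>

text \<open>The mean number of points of a coset in a box over the null set is zero, by \<open>mean_tensor\<close>.\<close>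

lemma AE_misses_null:
  assumes N: "N \<in> sets borel" "emeasure mH N = 0"
  shows "AE X in mX. \<forall>y\<in>X. snd y \<notin> N"
proof -
  obtain Q :: "nat \<Rightarrow> 'g set" where Q: "\<And>n. open (Q n)" "\<And>n. compact (closure (Q n))" "incseq Q"
    "\<And>K. compact K \<Longrightarrow> \<exists>n. K \<subseteq> Q n"
    using lc_exhaustion[OF lcG] by blast
  obtain R :: "nat \<Rightarrow> 'h set" where R: "\<And>n. open (R n)" "\<And>n. compact (closure (R n))" "incseq R"
    "\<And>K. compact K \<Longrightarrow> \<exists>n. K \<subseteq> R n"
    using lc_exhaustion[OF lcH] by blast
  have rQ: "rel_compact (Q n)" and rR: "rel_compact (R n)" for n using Q(1,2) R(1,2) by (simp_all add: rel_compact_def)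
  let ?F = "\<lambda>n. tensor (indicator (Q n)) (N \<inter> R n) :: 'g \<times> 'h \<Rightarrow> real"
  have rN: "rel_compact (N \<inter> R n)" for n by (rule rel_compact_Int[OF rR N(1)])
  have F: "test_fun (?F n)" for n by (intro test_fun_tensor test_fun_indicator rQ rN)
  have F0: "0 \<le> ?F n y" for n y by (simp add: tensor_def)
  have "AE X in mX. periodise (?F n) X = 0" for n
  proof -
    obtain k where k: "k \<ge> 0" "\<forall>M. rel_compact M \<longrightarrow> torus_mean (tensor (indicator (Q n)) M) = k * measure mH M"
      by (rule mean_tensor[OF test_fun_indicator[OF rQ]]) simp
    have "emeasure mH (N \<inter> R n) \<le> emeasure mH N" by (intro emeasure_mono) (auto simp: sets_mH N(1))
    then have "measure mH (N \<inter> R n) = 0" using N(2) by (simp add: measure_def)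
    then have z: "torus_mean (?F n) = 0" using k(2) rN[of n] by simp
    have "AE X in mX. 0 \<le> periodise (?F n) X" by (intro AE_I2 periodise_nonneg F0)
    from integral_nonneg_eq_0_iff_AE[OF periodise_integrable[OF F] this] z
    show ?thesis unfolding torus_mean_def by (rule iffD1)
  qed
  then have "AE X in mX. \<forall>n. periodise (?F n) X = 0" by (simp add: AE_all_countable)
  then show ?thesis
  proof (rule AE_mp, intro AE_I2 impI ballI notI)
    fix X y assume "X \<in> space mX" and z: "\<forall>n. periodise (?F n) X = 0" and y: "y \<in> X" "snd y \<in> N"
    then have X: "X \<in> \<T>" by simp
    obtain n1 where n1: "{fst y} \<subseteq> Q n1" using Q(4)[of "{fst y}"] by auto
    obtain n2 where n2: "{snd y} \<subseteq> R n2" using R(4)[of "{snd y}"] by auto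
    define n where "n = max n1 n2"
    have "fst y \<in> Q n" "snd y \<in> R n"
      using n1 n2 incseqD[OF Q(3), of n1 n] incseqD[OF R(3), of n2 n] by (auto simp: n_def)
    then have "?F n y = 1" using y(2) by (simp add: tensor_def)
    then show False using periodise_ge_term[OF F F0 X y(1), of n] z by simp
  qed
qed

section \<open>A sigma-compact invariant set of continuity\<close>

lemma periodise_cong: "(\<And>y. y \<in> X \<Longrightarrow> F y = G y) \<Longrightarrow> periodise F X = periodise G X"
  unfolding periodise_def by (rule sum.cong) auto

text \<open>With \<open>D i = U i - K i\<close> for compact
\<open>K i \<subseteq> W\<close> and open \<open>U i \<supseteq> W\<close>, a point of such a coset over \<open>Q i\<close> stays away from the
boundary of \<open>W\<close>.\<close>

definition avoiding :: "(nat \<Rightarrow> 'g set) \<Rightarrow> (nat \<Rightarrow> 'h set) \<Rightarrow> ('g \<times> 'h) set set" where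
  "avoiding Q D = {X\<in>\<T>. \<forall>i. \<forall>y\<in>X. \<not> (fst y \<in> Q i \<and> snd y \<in> D i)}"

text \<open>Counts points in boxes by periodisations, which are measurable; the count is an integer, so
being less than 1 means being 0.\<close>

lemma avoiding_eq_periodise:
  assumes Q: "\<And>i. rel_compact (Q i)" and D: "\<And>i. rel_compact (D i)"
  shows "avoiding Q D = {X\<in>space mX. \<forall>i. periodise (tensor (indicator (Q i)) (D i)) X < 1}"
proof (intro equalityI subsetI)
  fix X assume X: "X \<in> avoiding Q D"
  have "periodise (tensor (indicator (Q i)) (D i)) X = 0" for i
  proof -
    have "tensor (indicator (Q i)) (D i) y = 0" if "y \<in> X" for y using X that by (auto simp: avoiding_def tensor_def indicator_def)
    then have "{y \<in> X. tensor (indicator (Q i)) (D i) y \<noteq> (0::real)} = {}" by blast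
    then show ?thesis by (simp only: periodise_def sum.empty)
  qed
  then show "X \<in> {X\<in>space mX. \<forall>i. periodise (tensor (indicator (Q i)) (D i)) X < 1}" using X by (simp add: avoiding_def)
next
  fix X assume X: "X \<in> {X\<in>space mX. \<forall>i. periodise (tensor (indicator (Q i)) (D i)) X < 1}"
  then have XT: "X \<in> \<T>" by simp
  have "\<not> (fst y \<in> Q i \<and> snd y \<in> D i)" if y: "y \<in> X" for y i
  proof
    assume "fst y \<in> Q i \<and> snd y \<in> D i"
    then have "tensor (indicator (Q i)) (D i) y = (1::real)" by (simp add: tensor_def)
    moreover have "tensor (indicator (Q i)) (D i) y \<le> periodise (tensor (indicator (Q i)) (D i)) X"
      by (rule periodise_ge_term[OF test_fun_tensor[OF test_fun_indicator[OF Q] D] _ XT y]) (simp add: tensor_def)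
    moreover have "periodise (tensor (indicator (Q i)) (D i)) X < 1" using X by simp
    ultimately show False by linarith
  qed
  then show "X \<in> avoiding Q D" using XT by (simp add: avoiding_def)
qed

lemma avoiding_measurable:
  assumes Q: "\<And>i. rel_compact (Q i)" and D: "\<And>i. rel_compact (D i)"
  shows "avoiding Q D \<in> sets mX"
proof -
  have m: "periodise (tensor (indicator (Q i)) (D i)) \<in> borel_measurable mX" for i
    by (rule periodise_measurable[OF test_fun_tensor[OF test_fun_indicator[OF Q] D]])
  have "{X\<in>space mX. periodise (tensor (indicator (Q i)) (D i)) X < 1} \<in> sets mX" for i
    using m[of i] by (intro borel_measurable_less) simp_all
  then show ?thesis unfolding avoiding_eq_periodise[OF Q D] by (intro sets.sets_Collect_countable_All)
qed

text \<open>Markov's inequality with error \<open>e * (1/2) ^ Suc i\<close> for the \<open>i\<close>th box.\<close>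

lemma avoiding_large:
  assumes Q: "\<And>i. rel_compact (Q i)" and e: "e > (0::real)"
  obtains K U where "\<forall>i. compact (K i) \<and> open (U i) \<and> K i \<subseteq> W \<and> W \<subseteq> U i \<and> rel_compact (U i)"
    "measure mX (\<T> - avoiding Q (\<lambda>i. U i - K i)) \<le> e"
proof -
  interpret P: prob_space mX by (rule prob_mX)
  have "\<exists>K U. compact K \<and> open U \<and> K \<subseteq> W \<and> W \<subseteq> U \<and> rel_compact U \<and> torus_mean (tensor (indicator (Q i)) (U - K)) \<le> e * (1/2) ^ Suc i" for i
  proof -
    obtain k where k: "k \<ge> 0" "\<forall>N. rel_compact N \<longrightarrow> torus_mean (tensor (indicator (Q i)) N) = k * measure mH N"
      by (rule mean_tensor[OF test_fun_indicator[OF Q[of i]]]) simp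
    \<comment> \<open>The denominator \<open>k + 1\<close> covers the case \<open>k = 0\<close>.\<close>
    define d where "d = e * (1/2) ^ Suc i / (k + 1)"
    have k1: "k + 1 > 0" "k + 1 \<noteq> 0" using k(1) by linarith+
    have d: "d > 0" unfolding d_def using e k1 by simp
    have dk: "d * (k + 1) = e * (1/2) ^ Suc i" by (rule nonzero_eq_divide_eq[THEN iffD1, OF k1(2) d_def])
    obtain K U where KU: "compact K" "open U" "K \<subseteq> W" "W \<subseteq> U" "rel_compact U" "measure mH (U - K) < d"
      by (rule compact_open_sandwich[OF rel_compact_W d])
    have "K \<in> sets borel" using rel_compact_compact[OF KU(1)] by (simp add: rel_compact_def)
    then have "torus_mean (tensor (indicator (Q i)) (U - K)) = k * measure mH (U - K)" using k(2) rel_compact_Diff[OF KU(5)] by blast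
    also have "\<dots> \<le> (k + 1) * d" using k(1) KU(6) by (intro mult_mono) auto
    finally have "torus_mean (tensor (indicator (Q i)) (U - K)) \<le> e * (1/2) ^ Suc i" using dk by (simp only: mult.commute)
    then show ?thesis using KU by blast
  qed
  then have "\<forall>i. \<exists>K U. compact K \<and> open U \<and> K \<subseteq> W \<and> W \<subseteq> U \<and> rel_compact U \<and> torus_mean (tensor (indicator (Q i)) (U - K)) \<le> e * (1/2) ^ Suc i" by (rule allI)
  then obtain K where "\<forall>i. \<exists>U. compact (K i) \<and> open U \<and> K i \<subseteq> W \<and> W \<subseteq> U \<and> rel_compact U \<and> torus_mean (tensor (indicator (Q i)) (U - K i)) \<le> e * (1/2) ^ Suc i"
    by (rule choice[THEN exE])
  then obtain U where KU: "\<forall>i. compact (K i) \<and> open (U i) \<and> K i \<subseteq> W \<and> W \<subseteq> U i \<and> rel_compact (U i) \<and> torus_mean (tensor (indicator (Q i)) (U i - K i)) \<le> e * (1/2) ^ Suc i"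
    by (rule choice[THEN exE])
  let ?D = "\<lambda>i. U i - K i"
  let ?F = "\<lambda>i. tensor (indicator (Q i)) (?D i) :: 'g \<times> 'h \<Rightarrow> real"
  have rD: "rel_compact (?D i)" for i
    using KU rel_compact_compact[of "K i"] by (intro rel_compact_Diff) (auto simp: rel_compact_def)
  have F: "test_fun (?F i)" for i by (rule test_fun_tensor[OF test_fun_indicator[OF Q] rD])
  let ?B = "\<lambda>i. {X\<in>space mX. 1 \<le> periodise (?F i) X}"
  have B: "?B i \<in> sets mX" for i using periodise_measurable[OF F[of i]] by (intro borel_measurable_le) simp_all
  have sub: "\<T> - avoiding Q ?D \<subseteq> (\<Union>i. ?B i)" unfolding avoiding_eq_periodise[OF Q rD] by (auto simp: not_less)
  have mB: "emeasure mX (?B i) \<le> ennreal (e * (1/2) ^ Suc i)" for i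
  proof -
    have "emeasure mX (?B i) \<le> ennreal ((1 / 1) * (\<integral>X. periodise (?F i) X \<partial>mX))"
      by (rule integral_Markov_inequality[OF periodise_integrable[OF F]]) (auto intro!: AE_I2 periodise_nonneg simp: tensor_def)
    also have "\<dots> \<le> ennreal (e * (1/2) ^ Suc i)" using KU by (intro ennreal_leI) (simp add: torus_mean_def)
    finally show ?thesis .
  qed
  have "emeasure mX (\<T> - avoiding Q ?D) \<le> emeasure mX (\<Union>i. ?B i)" by (intro emeasure_mono sub sets.countable_UN) (use B in auto)
  also have "\<dots> \<le> (\<Sum>i. emeasure mX (?B i))" by (rule emeasure_subadditive_countably) (use B in auto)
  also have "\<dots> \<le> (\<Sum>i. ennreal (e * (1/2) ^ Suc i))" by (intro suminf_le mB) simp_all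
  also have "\<dots> = ennreal e"
  proof (rule suminf_ennreal_eq)
    show "0 \<le> e * (1/2) ^ Suc i" for i using e by simp
    show "(\<lambda>i. e * (1/2) ^ Suc i) sums e" using sums_mult[OF power_half_series, of e] by simp
  qed
  finally have "measure mX (\<T> - avoiding Q ?D) \<le> e" using e by (simp add: P.emeasure_eq_measure)
  then show ?thesis using that[of K U] KU by blast
qed

text \<open>The compact support of \<open>c\<close> lies in some \<open>Q i\<close>. Over it the coset has no point in
\<open>U i - K i\<close>, so the indicator of \<open>W\<close> may be replaced by a Urysohn function, which makes the
integral continuous.\<close>

lemma avoiding_continuous:
  assumes Q: "\<And>K. compact K \<Longrightarrow> \<exists>n. K \<subseteq> Q n"
    and KU: "\<And>i. compact (K i)" "\<And>i. open (U i)" "\<And>i. K i \<subseteq> W" "\<And>i. W \<subseteq> U i"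
    and c: "c \<in> compactly_supported"
  shows "\<exists>f. torus_cont f \<and> (\<forall>X\<in>avoiding Q (\<lambda>i. U i - K i). (\<integral>x. c x \<partial>nuG W X) = f X)"
proof -
  note c' = compactly_supportedD[OF c]
  obtain i where i: "closure {x. c x \<noteq> 0} \<subseteq> Q i" using Q[OF c'(2)] by blast
  obtain u :: "'h \<Rightarrow> real" where u: "continuous_on UNIV u" "\<And>x. 0 \<le> u x" "\<And>x. u x \<le> 1"
    "\<And>x. x \<in> K i \<Longrightarrow> u x = 1" "compact (closure {x. u x \<noteq> 0})" "closure {x. u x \<noteq> 0} \<subseteq> U i"
    using lc_Urysohn[OF lcH KU(2) KU(1) order_trans[OF KU(3,4)], of i i] by blast
  have uc: "u \<in> compactly_supported" using u by (simp add: compactly_supported_def)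
  have u0: "u x = 0" if "x \<notin> U i" for x using that u(6) closure_subset[of "{x. u x \<noteq> 0}"] by blast
  let ?F = "\<lambda>y :: 'g \<times> 'h. c (fst y) * u (snd y)"
  have F: "?F \<in> compactly_supported" by (rule compactly_supported_prod[OF c uc])
  have "(\<integral>x. c x \<partial>nuG W X) = periodise ?F X" if X: "X \<in> avoiding Q (\<lambda>i. U i - K i)" for X
  proof -
    have XT: "X \<in> \<T>" using X by (simp add: avoiding_def)
    have "(\<integral>x. c x \<partial>nuG W X) = periodise (\<lambda>y. c (fst y) * indicator W (snd y)) X"
      by (rule integral_nuG[OF W_borel borel_measurable_continuous_onI[OF c'(1)] c'(2) c'(3) W_compact XT])
    also have "\<dots> = periodise ?F X"
    proof (rule periodise_cong)
      fix y assume y: "y \<in> X"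
      show "c (fst y) * indicator W (snd y) = c (fst y) * u (snd y)"
      proof (cases "c (fst y) = 0")
        case False
        then have "fst y \<in> Q i" using i c'(3)[of "fst y"] by blast
        then have n: "snd y \<notin> U i - K i" using X y unfolding avoiding_def by blast
        show ?thesis
        proof (cases "snd y \<in> K i")
          case True then show ?thesis using u(4)[OF True] KU(3)[of i] by (simp add: subsetD)
        next
          case False
          then have "snd y \<notin> U i" using n by blast
          moreover then have "snd y \<notin> W" using KU(4)[of i] by blast
          ultimately show ?thesis using u0 by simp
        qed
      qed simp
    qed
    finally show ?thesis .
  qed
  then show ?thesis using torus_cont_periodise[OF F] by blast
qed

text \<open>The action moves the first coordinates only; a larger box absorbs the displacement.\<close>

lemma avoiding_act:
  assumes "X \<in> avoiding Q D" "\<And>i x. x \<in> Q i \<Longrightarrow> x - g \<in> Q (s i)"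
  shows "act (g, 0) X \<in> avoiding Q (\<lambda>i. D (s i))"
proof -
  have X: "X \<in> \<T>" using assms(1) by (simp add: avoiding_def)
  have "\<not> (fst y \<in> Q i \<and> snd y \<in> D (s i))" if y: "y \<in> act (g, 0) X" for y i
  proof
    assume a: "fst y \<in> Q i \<and> snd y \<in> D (s i)"
    obtain z where z: "z \<in> X" "y = (g, 0) + z" using y unfolding act_def by (rule imageE)
    have "fst z = fst y - g" "snd z = snd y" using z(2) by simp_all
    then have "fst z \<in> Q (s i)" "snd z \<in> D (s i)" using a assms(2) by auto
    then show False using assms(1) z(1) unfolding avoiding_def by blast
  qed
  then show ?thesis using X by (simp add: avoiding_def)
qed

text \<open>Complements of outer approximations.\<close>

lemma inner_regular_mX:
  assumes B: "B \<in> sets mX" and e: "e > (0::real)"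
  obtains C where "closedin (torus_topology L) C" "C \<subseteq> B" "measure mX (B - C) < e"
proof -
  interpret P: prob_space mX by (rule prob_mX)
  have BT: "B \<subseteq> \<T>" using sets.sets_into_space[OF B] by simp
  have B': "\<T> - B \<in> sets mX" using sets.compl_sets[OF B] by simp
  have "emeasure mX (\<T> - B) = (INF U\<in>{U. openin (torus_topology L) U \<and> \<T> - B \<subseteq> U}. emeasure mX U)"
    using haar_mX B' unfolding haar_measure_def regular_borel_measure_def by blast
  moreover have "emeasure mX (\<T> - B) < emeasure mX (\<T> - B) + ennreal e" using e by (simp add: P.emeasure_eq_measure ennreal_lessI ennreal_plus[symmetric] add_nonneg_pos del: ennreal_plus)
  ultimately have "(INF U\<in>{U. openin (torus_topology L) U \<and> \<T> - B \<subseteq> U}. emeasure mX U) < emeasure mX (\<T> - B) + ennreal e" by simp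
  then obtain U where U: "openin (torus_topology L) U" "\<T> - B \<subseteq> U" "emeasure mX U < emeasure mX (\<T> - B) + ennreal e"
    unfolding INF_less_iff by blast
  have Us: "U \<in> sets mX" unfolding sets_mX borel_torus_def by (rule openin_borel_of[OF U(1)])
  have UT: "U \<subseteq> \<T>" using openin_subset[OF U(1)] by simp
  have "ennreal (measure mX U) < ennreal (measure mX (\<T> - B) + e)"
    using U(3) e by (simp add: P.emeasure_eq_measure ennreal_plus[symmetric] del: ennreal_plus)
  then have lt: "measure mX U < measure mX (\<T> - B) + e" by (rule ennreal_less_iff[THEN iffD1, rotated]) simp
  have "closedin (torus_topology L) (\<T> - U)" using U(1) by (simp add: closedin_def UT double_diff)
  moreover have "\<T> - U \<subseteq> B" using U(2) by blast
  moreover have "measure mX (B - (\<T> - U)) < e"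
  proof -
    have "B - (\<T> - U) = U - (\<T> - B)" using BT UT by blast
    then show ?thesis using P.finite_measure_Diff[OF Us B' U(2)] lt by simp
  qed
  ultimately show ?thesis using that by blast
qed

text \<open>Almost all of the torus is exhausted by closed sets \<open>E n\<close>, on each of which \<open>nuG W\<close> is
continuous. Moving \<open>E n\<close> by a compact set of elements of \<open>G\<close> preserves compactness, and also the
continuity of \<open>nuG W\<close>, by \<open>avoiding_act\<close>. Countably many compact sets exhaust \<open>G\<close>, so the union
over all of these is invariant and still a countable union of compact images.\<close>

lemma sigma_compact_core:
  assumes Y: "AE X in mX. X \<in> Y" "\<forall>X\<in>Y. \<forall>g. act (g, 0) X \<in> Y"
  obtains A :: "nat \<Rightarrow> ('g \<times> 'h) set" where "\<forall>n. compact (A n)" "(\<Union>n. q ` A n) \<subseteq> Y"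
    "\<forall>X\<in>(\<Union>n. q ` A n). \<forall>g. act (g, 0) X \<in> (\<Union>n. q ` A n)"
    "AE X in mX. X \<in> (\<Union>n. q ` A n)"
    "\<forall>n. \<forall>c\<in>compactly_supported. \<exists>f. torus_cont f \<and> (\<forall>X\<in>q ` A n. (\<integral>x. c x \<partial>nuG W X) = f X)"
proof -
  interpret P: prob_space mX by (rule prob_mX)
  obtain Q :: "nat \<Rightarrow> 'g set" where Q: "\<And>n. open (Q n)" "\<And>n. compact (closure (Q n))" "incseq Q"
    "\<And>K. compact K \<Longrightarrow> \<exists>n. K \<subseteq> Q n"
    using lc_exhaustion[OF lcG] by blast
  have rQ: "rel_compact (Q n)" for n using Q(1,2) by (simp add: rel_compact_def)
  obtain N where N: "{X\<in>space mX. X \<notin> Y} \<subseteq> N" "N \<in> null_sets mX" using Y(1) unfolding eventually_ae_filter by blast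
  obtain s0 C0 where s0: "s0 \<in> borel_torus \<rightarrow>\<^sub>M borel" "compact C0" "\<And>X. X \<in> \<T> \<Longrightarrow> s0 X \<in> X" "\<And>X. X \<in> \<T> \<Longrightarrow> s0 X \<in> C0"
    by (rule borel_section) (rule that, blast+)
  let ?ok = "\<lambda>n K U. (\<forall>i. compact (K i) \<and> open (U i) \<and> K i \<subseteq> W \<and> W \<subseteq> U i \<and> rel_compact (U i)) \<and>
    measure mX (\<T> - avoiding Q (\<lambda>i. U i - K i)) \<le> 1 / Suc n"
  have "\<exists>C K U. closedin (torus_topology L) C \<and> C \<subseteq> Y \<and> C \<subseteq> avoiding Q (\<lambda>i. U i - K i) \<and> measure mX (\<T> - C) \<le> 2 / Suc n \<and>
    (\<forall>i. compact (K i) \<and> open (U i) \<and> K i \<subseteq> W \<and> W \<subseteq> U i \<and> rel_compact (U i))" for n :: nat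
  proof -
    have e: "1 / real (Suc n) > 0" by simp
    obtain K U where KU': "\<forall>i. compact (K i) \<and> open (U i) \<and> K i \<subseteq> W \<and> W \<subseteq> U i \<and> rel_compact (U i)"
      "measure mX (\<T> - avoiding Q (\<lambda>i. U i - K i)) \<le> 1 / Suc n"
      by (rule avoiding_large[where Q=Q, OF rQ e])
    have KU: "compact (K i)" "rel_compact (U i)" for i using KU'(1) by blast+
    let ?C = "avoiding Q (\<lambda>i. U i - K i)"
    have rD: "rel_compact (U i - K i)" for i
      using KU(2) rel_compact_compact[OF KU(1)] by (intro rel_compact_Diff) (auto simp: rel_compact_def)
    have C: "?C \<in> sets mX" by (rule avoiding_measurable[OF rQ rD])
    have Ns: "N \<in> sets mX" using N(2) by blast
    have CN: "?C - N \<in> sets mX" using C Ns by blast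
    obtain E where E: "closedin (torus_topology L) E" "E \<subseteq> ?C - N" "measure mX (?C - N - E) < 1 / Suc n"
      by (rule inner_regular_mX[OF CN e])
    have Es: "E \<in> sets mX" unfolding sets_mX borel_torus_def by (rule closedin_borel_of[OF E(1)])
    have "\<T> - E \<subseteq> (\<T> - ?C) \<union> N \<union> (?C - N - E)" by blast
    moreover have TC: "\<T> - ?C \<in> sets mX" using sets.compl_sets[OF C] by simp
    ultimately have "measure mX (\<T> - E) \<le> measure mX ((\<T> - ?C) \<union> N \<union> (?C - N - E))"
      using Ns CN Es by (intro P.finite_measure_mono) auto
    also have "\<dots> \<le> measure mX ((\<T> - ?C) \<union> N) + measure mX (?C - N - E)"
      using TC Ns CN Es by (intro measure_Un_le) auto
    also have "measure mX ((\<T> - ?C) \<union> N) \<le> measure mX (\<T> - ?C) + measure mX N"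
      using TC Ns by (intro measure_Un_le) auto
    also have "measure mX N = 0" using N(2) by (simp add: measure_def null_sets_def)
    finally have "measure mX (\<T> - E) \<le> 2 / Suc n" using KU'(2) E(3) by simp
    moreover have "E \<subseteq> Y"
    proof
      fix X assume X: "X \<in> E"
      then have "X \<in> \<T>" "X \<notin> N" using E(2) by (auto simp: avoiding_def)
      then show "X \<in> Y" using N(1) by auto
    qed
    moreover have "E \<subseteq> ?C" using E(2) by blast
    moreover note KU'(1)
    ultimately show ?thesis using E(1) by (intro exI[of _ E] exI[of _ K] exI[of _ U] conjI)
  qed
  then have "\<forall>n. \<exists>C K U. closedin (torus_topology L) C \<and> C \<subseteq> Y \<and> C \<subseteq> avoiding Q (\<lambda>i. U i - K i) \<and> measure mX (\<T> - C) \<le> 2 / Suc n \<and>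
    (\<forall>i. compact (K i) \<and> open (U i) \<and> K i \<subseteq> W \<and> W \<subseteq> U i \<and> rel_compact (U i))" by (rule allI)
  then obtain E where E: "\<forall>n. \<exists>K U. closedin (torus_topology L) (E n) \<and> E n \<subseteq> Y \<and> E n \<subseteq> avoiding Q (\<lambda>i. U i - K i) \<and> measure mX (\<T> - E n) \<le> 2 / Suc n \<and>
    (\<forall>i. compact (K i) \<and> open (U i) \<and> K i \<subseteq> W \<and> W \<subseteq> U i \<and> rel_compact (U i))" by (rule choice[THEN exE])
  have E1': "closedin (torus_topology L) (E n) \<and> E n \<subseteq> Y \<and> measure mX (\<T> - E n) \<le> 2 / Suc n" for n
    using E[rule_format, of n] by (elim exE conjE, intro conjI)
  have E1: "closedin (torus_topology L) (E n)" "E n \<subseteq> Y" "measure mX (\<T> - E n) \<le> 2 / Suc n" for n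
    using E1'[of n] by simp_all
  have ET: "E n \<subseteq> \<T>" for n using closedin_subset[OF E1(1)] by simp
  \<comment> \<open>A compact set of representatives of \<open>E n\<close>.\<close>
  define B where "B n = C0 \<inter> {x. q x \<in> E n}" for n
  have cB: "compact (B n)" for n
    unfolding B_def using E1(1)[of n] s0(2) by (intro compact_Int_closed) (simp_all add: closedin_torus)
  have qB: "q ` B n = E n" for n
  proof (intro equalityI subsetI)
    fix X assume X: "X \<in> E n"
    then have XT: "X \<in> \<T>" using ET by blast
    have "X = q (s0 X)" by (rule torus_eq_q[OF XT s0(3)[OF XT]])
    moreover then have "s0 X \<in> B n" using X s0(4)[OF XT] by (simp add: B_def)
    ultimately show "X \<in> q ` B n" by (rule image_eqI)
  qed (auto simp: B_def)
  \<comment> \<open>Representatives of the translates of \<open>E n\<close> by the compact set \<open>closure (Q m)\<close>.\<close>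
  define S where "S n m = (\<lambda>p :: 'g \<times> ('g \<times> 'h). (fst p, 0) + snd p) ` (closure (Q m) \<times> B n)" for n m
  have cS: "compact (S n m)" for n m
  proof -
    have c: "continuous_on (closure (Q m) \<times> B n) (\<lambda>p :: 'g \<times> ('g \<times> 'h). (fst p, 0) + snd p)" by (intro continuous_intros)
    show ?thesis unfolding S_def by (rule compact_continuous_image[OF c compact_Times[OF Q(2) cB]])
  qed
  have qS: "X \<in> q ` S n m \<longleftrightarrow> (\<exists>g\<in>closure (Q m). \<exists>Z\<in>E n. X = act (g, 0) Z)" for X n m
  proof
    assume "X \<in> q ` S n m"
    then obtain g b where gb: "g \<in> closure (Q m)" "b \<in> B n" "X = q ((g, 0) + b)" unfolding S_def by auto
    then have "X = act (g, 0) (q b)" "q b \<in> E n" using qB[of n] by (auto simp: act_q)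
    then show "\<exists>g\<in>closure (Q m). \<exists>Z\<in>E n. X = act (g, 0) Z" using gb(1) by blast
  next
    assume "\<exists>g\<in>closure (Q m). \<exists>Z\<in>E n. X = act (g, 0) Z"
    then obtain g b where gb: "g \<in> closure (Q m)" "b \<in> B n" "X = act (g, 0) (q b)" unfolding qB[symmetric] by blast
    have "(fst (g, b), 0) + snd (g, b) \<in> S n m" unfolding S_def using gb(1,2) by (intro imageI) simp
    then have "q ((g, 0) + b) \<in> q ` S n m" by simp
    then show "X \<in> q ` S n m" unfolding gb(3) act_q .
  qed
  define A where "A n = S (fst (prod_decode n)) (snd (prod_decode n))" for n
  have UA: "X \<in> (\<Union>n. q ` A n) \<longleftrightarrow> (\<exists>g n. \<exists>Z\<in>E n. X = act (g, 0) Z)" for X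
  proof
    assume "X \<in> (\<Union>n. q ` A n)"
    then show "\<exists>g n. \<exists>Z\<in>E n. X = act (g, 0) Z" unfolding A_def UN_iff qS by blast
  next
    assume "\<exists>g n. \<exists>Z\<in>E n. X = act (g, 0) Z"
    then obtain g n Z where g: "Z \<in> E n" "X = act (g, 0) Z" by blast
    obtain m where "{g} \<subseteq> Q m" using Q(4)[of "{g}"] by auto
    then have "g \<in> closure (Q m)" using closure_subset[of "Q m"] by blast
    then have "X \<in> q ` S n m" unfolding qS using g by blast
    then have "X \<in> q ` A (prod_encode (n, m))" by (simp add: A_def)
    then show "X \<in> (\<Union>n. q ` A n)" by blast
  qed
  show ?thesis
  proof (rule that[of A])
    show "\<forall>n. compact (A n)" unfolding A_def using cS by (intro allI)
    show "(\<Union>n. q ` A n) \<subseteq> Y"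
    proof
      fix X assume "X \<in> (\<Union>n. q ` A n)"
      then obtain g n Z where "Z \<in> E n" "X = act (g, 0) Z" unfolding UA by blast
      then show "X \<in> Y" using Y(2) E1(2) by blast
    qed
    show "\<forall>X\<in>(\<Union>n. q ` A n). \<forall>g. act (g, 0) X \<in> (\<Union>n. q ` A n)"
    proof (intro ballI allI)
      fix X g assume "X \<in> (\<Union>n. q ` A n)"
      then obtain h n Z where Z: "Z \<in> E n" "X = act (h, 0) Z" unfolding UA by blast
      have "act (g, 0) X = act (g + h, 0) Z" unfolding Z(2) by (simp add: act_act)
      then show "act (g, 0) X \<in> (\<Union>n. q ` A n)" unfolding UA using Z(1) by blast
    qed
    show "AE X in mX. X \<in> (\<Union>n. q ` A n)"
    proof (rule AE_I)
      have Es: "\<T> - E n \<in> sets mX" for n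
        using sets.compl_sets[of "E n" mX] closedin_borel_of[OF E1(1)[of n]] unfolding sets_mX borel_torus_def by (simp add: borel_torus_def[symmetric])
      then show "(\<Inter>n. \<T> - E n) \<in> sets mX" by blast
      show "{X \<in> space mX. X \<notin> (\<Union>n. q ` A n)} \<subseteq> (\<Inter>n. \<T> - E n)"
      proof
        fix X assume X: "X \<in> {X \<in> space mX. X \<notin> (\<Union>n. q ` A n)}"
        have "X \<notin> E n" for n
        proof
          assume "X \<in> E n"
          moreover have "X = act (0, 0) X" unfolding zero_prod_def[symmetric] by simp
          ultimately have "X \<in> (\<Union>n. q ` A n)" unfolding UA by blast
          then show False using X by blast
        qed
        then show "X \<in> (\<Inter>n. \<T> - E n)" using X by simp
      qed
      have "measure mX (\<Inter>n. \<T> - E n) \<le> 0 + e" if e: "e > 0" for e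
      proof -
        obtain n where n: "2 / e < real n" using reals_Archimedean2 by blast
        have "2 / real (Suc n) \<le> e" using n e by (simp add: field_simps)
        moreover have "measure mX (\<Inter>n. \<T> - E n) \<le> measure mX (\<T> - E n)" using Es by (intro P.finite_measure_mono) auto
        ultimately show ?thesis using E1(3)[of n] by linarith
      qed
      then have "measure mX (\<Inter>n. \<T> - E n) \<le> 0" by (rule field_le_epsilon)
      then have "measure mX (\<Inter>n. \<T> - E n) = 0" by (rule antisym[OF _ measure_nonneg])
      then show "emeasure mX (\<Inter>n. \<T> - E n) = 0" unfolding P.emeasure_eq_measure by (simp only: ennreal_0)
    qed
    show "\<forall>n. \<forall>c\<in>compactly_supported. \<exists>f. torus_cont f \<and> (\<forall>X\<in>q ` A n. (\<integral>x. c x \<partial>nuG W X) = f X)"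
    proof (intro allI ballI)
      fix n and c :: "'g \<Rightarrow> real" assume c: "c \<in> compactly_supported"
      define n' m where "n' = fst (prod_decode n)" and "m = snd (prod_decode n)"
      obtain K U where KU: "E n' \<subseteq> avoiding Q (\<lambda>i. U i - K i)" "\<forall>i. compact (K i) \<and> open (U i) \<and> K i \<subseteq> W \<and> W \<subseteq> U i \<and> rel_compact (U i)"
        using E[rule_format, of n'] by (elim exE conjE) (rule that)
      \<comment> \<open>Every box \<open>Q i\<close>, displaced by the compact set \<open>closure (Q m)\<close>, fits into some box \<open>Q j\<close>.\<close>
      have "\<exists>j. \<forall>g\<in>closure (Q m). \<forall>x\<in>Q i. x - g \<in> Q j" for i
      proof -
        have ct: "continuous_on (closure (Q i) \<times> closure (Q m)) (\<lambda>p :: 'g \<times> 'g. fst p - snd p)" by (intro continuous_intros)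
        have "compact ((\<lambda>p :: 'g \<times> 'g. fst p - snd p) ` (closure (Q i) \<times> closure (Q m)))"
          by (rule compact_continuous_image[OF ct compact_Times[OF Q(2) Q(2)]])
        then obtain j where j: "(\<lambda>p :: 'g \<times> 'g. fst p - snd p) ` (closure (Q i) \<times> closure (Q m)) \<subseteq> Q j" using Q(4) by blast
        have "x - g \<in> Q j" if "g \<in> closure (Q m)" "x \<in> Q i" for g x
        proof -
          have "(x, g) \<in> closure (Q i) \<times> closure (Q m)" using that closure_subset[of "Q i"] by blast
          then have "fst (x, g) - snd (x, g) \<in> Q j" using j by blast
          then show ?thesis by simp
        qed
        then show ?thesis by blast
      qed
      then have "\<forall>i. \<exists>j. \<forall>g\<in>closure (Q m). \<forall>x\<in>Q i. x - g \<in> Q j" by (rule allI)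
      then obtain s where s: "\<forall>i. \<forall>g\<in>closure (Q m). \<forall>x\<in>Q i. x - g \<in> Q (s i)" by (rule choice[THEN exE])
      have "\<exists>f. torus_cont f \<and> (\<forall>X\<in>avoiding Q (\<lambda>i. U (s i) - K (s i)). (\<integral>x. c x \<partial>nuG W X) = f X)"
        by (rule avoiding_continuous[OF Q(4) _ _ _ _ c]) (use KU(2) in simp_all)
      then obtain f where f: "torus_cont f" "\<forall>X\<in>avoiding Q (\<lambda>i. U (s i) - K (s i)). (\<integral>x. c x \<partial>nuG W X) = f X" by (elim exE conjE)
      have "X \<in> avoiding Q (\<lambda>i. U (s i) - K (s i))" if X: "X \<in> q ` A n" for X
      proof -
        have "X \<in> q ` S n' m" using X unfolding A_def n'_def m_def .
        then obtain g Z where gZ: "g \<in> closure (Q m)" "Z \<in> E n'" "X = act (g, 0) Z" unfolding qS by (elim bexE)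
        have "Z \<in> avoiding Q (\<lambda>i. U i - K i)" using KU(1) gZ(2) by (rule subsetD)
        then show ?thesis unfolding gZ(3) by (rule avoiding_act) (use s gZ(1) in blast)
      qed
      then show "\<exists>f. torus_cont f \<and> (\<forall>X\<in>q ` A n. (\<integral>x. c x \<partial>nuG W X) = f X)" using f by blast
    qed
  qed
qed

section \<open>The quotient torus\<close>

abbreviation PP :: "('g \<times> 'h) set set" where "PP \<equiv> torus_periods L mH W"

definition qproj :: "('g \<times> 'h) set \<Rightarrow> ('g \<times> 'h) set set" where "qproj X = PP #>\<^bsub>torus L\<^esub> X"

lemma PP_eq: "PP = (\<lambda>t. q (0, t)) ` Per"
  unfolding torus_periods_def by auto

text \<open>A point of the quotient torus is the orbit of a coset under translation by periods.\<close>

lemma qproj_eq_image: "X \<in> \<T> \<Longrightarrow> qproj X = (\<lambda>t. act (0, t) X) ` Per"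
  unfolding qproj_def r_coset_def PP_eq by (auto simp: torus_mult)

lemma qproj_eq: assumes "X \<in> \<T>" "Y \<in> \<T>" shows "qproj X = qproj Y \<longleftrightarrow> (\<exists>t\<in>Per. Y = act (0, t) X)"
proof
  assume "qproj X = qproj Y"
  moreover have "Y \<in> qproj Y" unfolding qproj_eq_image[OF assms(2)] using Per_0 by (intro image_eqI[of _ _ 0]) (simp_all add: zero_prod_def[symmetric])
  ultimately show "\<exists>t\<in>Per. Y = act (0, t) X" unfolding qproj_eq_image[OF assms(1)] by auto
next
  assume "\<exists>t\<in>Per. Y = act (0, t) X"
  then obtain t where t: "t \<in> Per" "Y = act (0, t) X" by blast
  show "qproj X = qproj Y" unfolding qproj_eq_image[OF assms(1)] qproj_eq_image[OF assms(2)]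
  proof (intro equalityI subsetI)
    fix Z assume "Z \<in> (\<lambda>t. act (0, t) X) ` Per"
    then obtain s where s: "s \<in> Per" "Z = act (0, s) X" by blast
    have "s + - t \<in> Per" by (intro Per_add Per_uminus s t)
    moreover have "Z = act (0, s + - t) Y" unfolding s(2) t(2) by (simp add: act_act)
    ultimately show "Z \<in> (\<lambda>t. act (0, t) Y) ` Per" by (rule rev_image_eqI)
  next
    fix Z assume "Z \<in> (\<lambda>t. act (0, t) Y) ` Per"
    then obtain s where s: "s \<in> Per" "Z = act (0, s) Y" by blast
    have "s + t \<in> Per" by (intro Per_add s t)
    moreover have "Z = act (0, s + t) X" unfolding s(2) t(2) by (simp add: act_act)
    ultimately show "Z \<in> (\<lambda>t. act (0, t) X) ` Per" by (rule rev_image_eqI)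
  qed
qed

lemma comm_group_torus: "comm_group (torus L)"
  unfolding torus_def by (rule comm_group.abelian_FactGroup[OF comm_group_additive subgroup_L])

lemma subgroup_PP: "subgroup PP (torus L)"
proof (rule group.subgroupI[OF comm_group.axioms(2)[OF comm_group_torus]])
  show "PP \<subseteq> \<T>" unfolding PP_eq by auto
  show "PP \<noteq> {}" unfolding PP_eq using Per_0 by blast
  fix a assume "a \<in> PP"
  then obtain t where t: "t \<in> Per" "a = q (0, t)" unfolding PP_eq by blast
  have one: "\<one>\<^bsub>torus L\<^esub> = q 0" by (simp add: torus_def q_def)
  have "inv\<^bsub>torus L\<^esub> a = q (0, - t)"
  proof (rule group.inv_equality[OF comm_group.axioms(2)[OF comm_group_torus]])
    show "q (0, - t) \<otimes>\<^bsub>torus L\<^esub> a = \<one>\<^bsub>torus L\<^esub>" unfolding t(2) one torus_mult[OF q_in_torus] act_q by (simp add: zero_prod_def)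
  qed (simp_all add: t(2))
  then show "inv\<^bsub>torus L\<^esub> a \<in> PP" unfolding PP_eq using Per_uminus[OF t(1)] by blast
  fix b assume "b \<in> PP"
  then obtain s where s: "s \<in> Per" "b = q (0, s)" unfolding PP_eq by blast
  have "a \<otimes>\<^bsub>torus L\<^esub> b = q (0, t + s)" unfolding t(2) s(2) torus_mult[OF q_in_torus] act_q by simp
  then show "a \<otimes>\<^bsub>torus L\<^esub> b \<in> PP" unfolding PP_eq using Per_add[OF t(1) s(1)] by blast
qed

lemma carrier_quotient: "carrier (quotient_torus L mH W) = qproj ` \<T>"
  unfolding quotient_torus_def carrier_FactGroup qproj_def ..

lemma quotient_mult: "X \<in> \<T> \<Longrightarrow> qproj (q x) \<otimes>\<^bsub>quotient_torus L mH W\<^esub> qproj X = qproj (act x X)"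
proof -
  assume X: "X \<in> \<T>"
  have "normal PP (torus L)" using comm_group.normal_iff_subgroup[OF comm_group_torus] subgroup_PP by blast
  from normal.rcos_sum[OF this q_in_torus X] show ?thesis
    unfolding qproj_def quotient_torus_def mult_FactGroup torus_mult[OF X] .
qed

lemma qact_qproj: assumes "X \<in> \<T>" shows "act x ` qproj X = qproj (act x X)"
proof -
  have "act x (act (0, t) X) = act (0, t) (act x X)" for t by (simp add: act_act add.commute)
  then show ?thesis unfolding qproj_eq_image[OF assms] qproj_eq_image[OF act_torus[OF assms]] image_image by simp
qed

lemma quotient_torus_action_qproj: "X \<in> \<T> \<Longrightarrow> quotient_torus_action g (qproj X) = qproj (act (g, 0) X)"
  unfolding quotient_torus_action_def torus_action_eq_act by (rule qact_qproj)

abbreviation QT where "QT \<equiv> quotient_torus_topology L mH W"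

lemma openin_QT: "openin QT U \<longleftrightarrow> U \<subseteq> qproj ` \<T> \<and> openin (torus_topology L) {X\<in>\<T>. qproj X \<in> U}"
  unfolding quotient_torus_topology_def openin_quotient_topology qproj_def[symmetric] by simp

lemma topspace_QT: "topspace QT = qproj ` \<T>"
  unfolding quotient_torus_topology_def topspace_quotient_topology qproj_def[symmetric] by simp

lemma open_map_qproj_q: assumes "open V" shows "openin QT (qproj ` q ` V)"
proof -
  have "{X\<in>\<T>. qproj X \<in> qproj ` q ` V} = q ` (\<Union>t\<in>Per. (\<lambda>x. (0, t) + x) ` V)"
  proof (intro equalityI subsetI)
    fix X assume "X \<in> {X\<in>\<T>. qproj X \<in> qproj ` q ` V}"
    then obtain v where X: "X \<in> \<T>" and v: "v \<in> V" "qproj (q v) = qproj X" by auto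
    then obtain t where t: "t \<in> Per" "X = act (0, t) (q v)" unfolding qproj_eq[OF q_in_torus X] by blast
    then have "X = q ((0, t) + v)" by (simp only: act_q)
    then show "X \<in> q ` (\<Union>t\<in>Per. (\<lambda>x. (0, t) + x) ` V)" using t(1) v(1) by blast
  next
    fix X assume "X \<in> q ` (\<Union>t\<in>Per. (\<lambda>x. (0, t) + x) ` V)"
    then obtain t v where tv: "t \<in> Per" "v \<in> V" "X = q ((0, t) + v)" by blast
    then have "qproj (q v) = qproj X" using qproj_eq[of "q v" X] by (auto simp: act_q)
    then have "qproj X \<in> qproj ` q ` V" using tv(2) by (metis imageI)
    then show "X \<in> {X\<in>\<T>. qproj X \<in> qproj ` q ` V}" unfolding tv(3) by simp
  qed
  moreover have "open (\<Union>t\<in>Per. (\<lambda>x. (0 :: 'g, t) + x) ` V)" by (intro open_UN ballI open_translation_group(1) assms)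
  ultimately show ?thesis unfolding openin_QT using open_map_q by auto
qed

lemma qproj_measurable: "qproj \<in> mX \<rightarrow>\<^sub>M borel_of QT"
proof (rule measurable_borel_of)
  show "qproj \<in> space mX \<rightarrow> topspace QT" by (simp add: topspace_QT)
  fix U assume "openin QT U"
  then have "openin (torus_topology L) {X\<in>\<T>. qproj X \<in> U}" by (simp add: openin_QT)
  then have "{X\<in>\<T>. qproj X \<in> U} \<in> sets mX" unfolding sets_mX borel_torus_def by (rule openin_borel_of)
  moreover have "qproj -` U \<inter> space mX = {X\<in>\<T>. qproj X \<in> U}" by auto
  ultimately show "qproj -` U \<inter> space mX \<in> sets mX" by simp
qed

text \<open>Only finitely many lattice translates of \<open>A\<close> meet a given relatively compact neighbourhood.\<close>

lemma compact_image_closed: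
  assumes A: "compact A" shows "closed {x. q x \<in> q ` A}"
proof -
  have "\<exists>T. open T \<and> x \<in> T \<and> T \<subseteq> - {x. q x \<in> q ` A}" if x: "x \<in> - {x. q x \<in> q ` A}" for x
  proof -
    obtain N where N: "open N" "x \<in> N" "compact (closure N)" "closure N \<subseteq> UNIV"
      by (rule lc_nbhd[OF lcGH open_UNIV UNIV_I])
    let ?l = "lattice_hits (closure N) A"
    have f: "finite ?l" by (rule finite_lattice_hits[OF N(3) A])
    have "closed (\<Union>l\<in>?l. (\<lambda>x. x - l) ` A)"
      using f compact_imp_closed[OF compact_translation_group(2)[OF A]] by (intro closed_UN) auto
    then have o: "open (N - (\<Union>l\<in>?l. (\<lambda>x. x - l) ` A))" using N(1) by (rule open_Diff[rotated])
    have "x \<notin> (\<Union>l\<in>?l. (\<lambda>x. x - l) ` A)"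
    proof
      assume "x \<in> (\<Union>l\<in>?l. (\<lambda>x. x - l) ` A)"
      then obtain l a where la: "l \<in> L" "a \<in> A" "x = a - l" unfolding lattice_hits_def by blast
      then have "q x = q a" by (simp add: q_eq)
      then show False using x la(2) by blast
    qed
    moreover have "N - (\<Union>l\<in>?l. (\<lambda>x. x - l) ` A) \<subseteq> - {x. q x \<in> q ` A}"
    proof
      fix z assume z: "z \<in> N - (\<Union>l\<in>?l. (\<lambda>x. x - l) ` A)"
      show "z \<in> - {x. q x \<in> q ` A}"
      proof
        assume "z \<in> {x. q x \<in> q ` A}"
        then obtain a where a: "a \<in> A" "q z = q a" by blast
        then have l: "a - z \<in> L" by (simp add: q_eq)
        have "z \<in> closure N" using z closure_subset[of N] by blast
        then have "a - z \<in> ?l" unfolding lattice_hits_def using l a(1) by (intro CollectI conjI bexI[of _ z]) simp_all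
        moreover have "a - (a - z) \<in> (\<lambda>x. x - (a - z)) ` A" using a(1) by (rule imageI)
        ultimately show False using z by auto
      qed
    qed
    ultimately show ?thesis using o N(2) by (intro exI[of _ "N - (\<Union>l\<in>?l. (\<lambda>x. x - l) ` A)"]) blast
  qed
  note * = this
  have "open (- {x. q x \<in> q ` A})" by (rule open_subopen[THEN iffD2]) (rule ballI, rule *)
  then show ?thesis by (simp add: closed_def)
qed

text \<open>The preimage of the image is the image of a compact set again, because the periods form a
compact group.\<close>

lemma qproj_compact_closed:
  assumes A: "compact A" shows "closedin QT (qproj ` q ` A)"
proof -
  let ?A = "(\<lambda>p :: 'h \<times> ('g \<times> 'h). (0, fst p) + snd p) ` (Per \<times> A)"
  have ct: "continuous_on (Per \<times> A) (\<lambda>p :: 'h \<times> ('g \<times> 'h). (0, fst p) + snd p)" by (intro continuous_intros)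
  have cA: "compact ?A" by (rule compact_continuous_image[OF ct compact_Times[OF compact_Per A]])
  have eq: "{X\<in>\<T>. qproj X \<in> qproj ` q ` A} = q ` ?A"
  proof (intro equalityI subsetI)
    fix X assume "X \<in> {X\<in>\<T>. qproj X \<in> qproj ` q ` A}"
    then obtain v where X: "X \<in> \<T>" and v: "v \<in> A" "qproj (q v) = qproj X" by auto
    then obtain t where t: "t \<in> Per" "X = act (0, t) (q v)" unfolding qproj_eq[OF q_in_torus X] by blast
    have "(0, fst (t, v)) + snd (t, v) \<in> ?A" using t(1) v(1) by (intro imageI) simp
    then show "X \<in> q ` ?A" unfolding t(2) act_q by simp
  next
    fix X assume "X \<in> q ` ?A"
    then obtain t v where tv: "t \<in> Per" "v \<in> A" "X = q ((0, t) + v)" by auto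
    then have "qproj (q v) = qproj X" using qproj_eq[of "q v" X] by (auto simp: act_q)
    then have "qproj X \<in> qproj ` q ` A" using tv(2) by (metis imageI)
    then show "X \<in> {X\<in>\<T>. qproj X \<in> qproj ` q ` A}" unfolding tv(3) by simp
  qed
  have "closedin (torus_topology L) (q ` ?A)" unfolding closedin_torus using compact_image_closed[OF cA] by auto
  then have "openin (torus_topology L) (\<T> - q ` ?A)" by (simp add: closedin_def)
  moreover have "{X\<in>\<T>. qproj X \<in> qproj ` \<T> - qproj ` q ` A} = \<T> - q ` ?A" unfolding eq[symmetric] by blast
  ultimately show ?thesis unfolding closedin_def topspace_QT openin_QT by auto
qed

end

section \<open>The two systems\<close>

locale full_scheme = haar_scheme L mX mH W
  for L :: "('g::{topological_ab_group_add, second_countable_topology, t2_space} \<times>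
               'h::{topological_ab_group_add, second_countable_topology, t2_space}) set"
  and mX and mH :: "'h measure" and W :: "'h set" +
  fixes mX' :: "('g \<times> 'h) set set measure"
  assumes mX': "normalised_haar_measure (quotient_torus L mH W) (quotient_torus_topology L mH W) mX'"
begin

lemma haar_mX': "haar_measure (quotient_torus L mH W) QT mX'" and mX'_1: "emeasure mX' (qproj ` \<T>) = 1"
  using mX' by (simp_all add: normalised_haar_measure_def topspace_QT)

lemma sets_mX': "sets mX' = sets (borel_of QT)"
  using haar_mX' unfolding haar_measure_def regular_borel_measure_def by blast

lemma space_mX' [simp]: "space mX' = qproj ` \<T>"
  using sets_eq_imp_space_eq[OF sets_mX'] by (simp add: topspace_QT)

lemma prob_mX': "prob_space mX'" by (rule prob_spaceI) (simp add: mX'_1)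

text \<open>The invariance of the Haar measure on the quotient torus, expressed by translations of
\<open>G \<times> H\<close>.\<close>

lemma mX'_translate:
  assumes A: "A \<in> sets mX'" shows "emeasure mX' ((\<lambda>C. act x ` C) ` A) = emeasure mX' A"
proof -
  have sub: "A \<subseteq> qproj ` \<T>" using sets.sets_into_space[OF A] by simp
  have inv: "\<forall>a\<in>carrier (quotient_torus L mH W). \<forall>A\<in>sets mX'. emeasure mX' ((\<lambda>x. a \<otimes>\<^bsub>quotient_torus L mH W\<^esub> x) ` A) = emeasure mX' A"
    using haar_mX' unfolding haar_measure_def by blast
  have car: "qproj (q x) \<in> carrier (quotient_torus L mH W)" unfolding carrier_quotient by (intro imageI q_in_torus)
  have "emeasure mX' ((\<lambda>C. qproj (q x) \<otimes>\<^bsub>quotient_torus L mH W\<^esub> C) ` A) = emeasure mX' A"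
    by (rule bspec[OF bspec[OF inv car] A])
  moreover have "(\<lambda>C. qproj (q x) \<otimes>\<^bsub>quotient_torus L mH W\<^esub> C) ` A = (\<lambda>C. act x ` C) ` A"
  proof (rule image_cong[OF refl])
    fix C assume "C \<in> A"
    then obtain X where X: "X \<in> \<T>" "C = qproj X" using sub by blast
    show "qproj (q x) \<otimes>\<^bsub>quotient_torus L mH W\<^esub> C = act x ` C" unfolding X(2) quotient_mult[OF X(1)] qact_qproj[OF X(1)] ..
  qed
  ultimately show ?thesis by simp
qed

lemma open_preimage_QT: "openin QT U \<Longrightarrow> open {z. qproj (q z) \<in> U}"
  unfolding openin_QT openin_torus by simp

lemma qact_measurable: "(\<lambda>C. act x ` C) \<in> mX' \<rightarrow>\<^sub>M mX'"
proof -
  have "(\<lambda>C. act x ` C) \<in> mX' \<rightarrow>\<^sub>M borel_of QT"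
  proof (rule measurable_borel_of)
    show "(\<lambda>C. act x ` C) \<in> space mX' \<rightarrow> topspace QT" by (auto simp: topspace_QT qact_qproj)
    fix U assume U: "openin QT U"
    let ?V = "(\<lambda>C. act x ` C) -` U \<inter> qproj ` \<T>"
    have "{z. q z \<in> {X\<in>\<T>. qproj X \<in> ?V}} = (\<lambda>z. x + z) -` {z. qproj (q z) \<in> U}" by (auto simp: qact_qproj act_q)
    moreover have "open ((\<lambda>z. x + z) -` {z. qproj (q z) \<in> U})"
      by (rule open_vimage[OF open_preimage_QT[OF U]]) (intro continuous_intros)
    ultimately have "openin QT ?V" unfolding openin_QT openin_torus by auto
    then show "(\<lambda>C. act x ` C) -` U \<inter> space mX' \<in> sets mX'" unfolding sets_mX' space_mX' by (rule openin_borel_of)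
  qed
  then show ?thesis using measurable_cong_sets[OF refl sets_mX'] by blast
qed

lemma qproj_measurable': "qproj \<in> mX \<rightarrow>\<^sub>M mX'"
  using qproj_measurable measurable_cong_sets[OF refl sets_mX'] by blast

text \<open>Uniqueness of Haar measure on a compact group: integrate the indicator of
\<open>X + C \<in> A\<close> over \<open>X\<close> in the torus and \<open>C\<close> in the quotient. For fixed \<open>X\<close> invariance of
\<open>mX'\<close> gives \<open>mX' A\<close>, and for fixed \<open>C\<close> invariance of \<open>mX\<close> gives the measure of the preimage
of \<open>A\<close>.\<close>

lemma quotient_haar_open:
  assumes A: "openin QT A" shows "emeasure mX (qproj -` A \<inter> \<T>) = emeasure mX' A"
proof -
  interpret P: prob_space mX by (rule prob_mX)
  interpret P': prob_space mX' by (rule prob_mX')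
  interpret PS: pair_sigma_finite mX mX' by unfold_locales
  have As: "A \<in> sets mX'" unfolding sets_mX' by (rule openin_borel_of[OF A])
  have AT: "A \<subseteq> qproj ` \<T>" using openin_subset[OF A] by (simp add: topspace_QT)
  obtain s C0 where s: "s \<in> borel_torus \<rightarrow>\<^sub>M borel" "compact C0" "\<And>X. X \<in> \<T> \<Longrightarrow> s X \<in> X" "\<And>X. X \<in> \<T> \<Longrightarrow> s X \<in> C0"
    by (rule borel_section) (rule that, blast+)
  have s': "s \<in> mX \<rightarrow>\<^sub>M borel" using s(1) measurable_cong_sets[OF sets_mX refl] by blast
  have qs: "q (s X) = X" if "X \<in> \<T>" for X using torus_eq_q[OF that s(3)[OF that]] by simp
  let ?O = "{p :: ('g \<times> 'h) \<times> ('g \<times> 'h). qproj (q (fst p + snd p)) \<in> A}"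
  have c: "continuous_on UNIV (\<lambda>p :: ('g \<times> 'h) \<times> ('g \<times> 'h). fst p + snd p)" by (intro continuous_intros)
  have "open ((\<lambda>p :: ('g \<times> 'h) \<times> ('g \<times> 'h). fst p + snd p) -` {z. qproj (q z) \<in> A})"
    by (rule open_vimage[OF open_preimage_QT[OF A] c])
  then have oO: "open ?O" by (simp add: vimage_def)
  obtain B :: "('g \<times> 'h) set set" where B: "countable B" "topological_basis B" using ex_countable_basis by blast
  \<comment> \<open>The basic rectangles in the preimage of \<open>A\<close> under addition: they exhibit \<open>E\<close> as a countable union
    of measurable rectangles, which puts it into the product sigma-algebra.\<close>
  define J where "J = {r \<in> B \<times> B. fst r \<times> snd r \<subseteq> ?O}"
  have cJ: "countable J" unfolding J_def using B(1) by (intro countable_subset[OF _ countable_SIGMA[of B "\<lambda>_. B"]]) auto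
  define E where "E = {p. fst p \<in> \<T> \<and> snd p \<in> qproj ` \<T> \<and> act (s (fst p)) ` snd p \<in> A}"
  have E_eq: "E = (\<Union>r\<in>J. (s -` fst r \<inter> \<T>) \<times> (qproj ` q ` snd r))"
  proof (intro equalityI subsetI)
    fix p assume p: "p \<in> E"
    obtain X C where XC: "p = (X, C)" by (cases p)
    have X: "X \<in> \<T>" "C \<in> qproj ` \<T>" "act (s X) ` C \<in> A" using p by (simp_all add: E_def XC)
    then obtain y where y: "C = qproj (q y)" unfolding carrier_torus by blast
    have "(s X, y) \<in> ?O" using X(3) by (simp add: y qact_qproj act_q)
    then obtain U V where UV': "open U" "open V" "(s X, y) \<in> U \<times> V" "U \<times> V \<subseteq> ?O"
      by (rule open_prod_elim[OF oO])
    then have UV: "open U" "open V" "s X \<in> U" "y \<in> V" "U \<times> V \<subseteq> ?O" by simp_all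
    obtain U' where U': "U' \<in> B" "s X \<in> U'" "U' \<subseteq> U" by (rule topological_basisE[OF B(2) UV(1,3)])
    obtain V' where V': "V' \<in> B" "y \<in> V'" "V' \<subseteq> V" by (rule topological_basisE[OF B(2) UV(2,4)])
    have "U' \<times> V' \<subseteq> ?O" using U'(3) V'(3) UV(5) by blast
    then have "(U', V') \<in> J" using U'(1) V'(1) by (simp add: J_def)
    moreover have "p \<in> (s -` fst (U', V') \<inter> \<T>) \<times> (qproj ` q ` snd (U', V'))" using X(1) U'(2) V'(2) by (simp add: XC y)
    ultimately show "p \<in> (\<Union>r\<in>J. (s -` fst r \<inter> \<T>) \<times> (qproj ` q ` snd r))" by (rule UN_I)
  next
    fix p assume "p \<in> (\<Union>r\<in>J. (s -` fst r \<inter> \<T>) \<times> (qproj ` q ` snd r))"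
    then obtain r where r: "r \<in> J" "fst p \<in> s -` fst r \<inter> \<T>" "snd p \<in> qproj ` q ` snd r" by (auto simp: mem_Times_iff)
    then obtain y where y: "y \<in> snd r" "snd p = qproj (q y)" by blast
    have "(s (fst p), y) \<in> fst r \<times> snd r" using r(2) y(1) by blast
    then have "(s (fst p), y) \<in> ?O" using r(1) unfolding J_def by blast
    then have "act (s (fst p)) ` snd p \<in> A" by (simp add: y(2) qact_qproj act_q)
    then show "p \<in> E" using r(2) by (simp add: E_def y(2))
  qed
  have Em: "E \<in> sets (mX \<Otimes>\<^sub>M mX')"
    unfolding E_eq
  proof (intro sets.countable_UN'[OF cJ] image_subsetI pair_measureI)
    fix r assume r: "r \<in> J"
    have o: "open (fst r)" "open (snd r)" using r topological_basis_open[OF B(2)] by (auto simp: J_def)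
    have "fst r \<in> sets borel" using o(1) by simp
    from measurable_sets[OF s' this] show "s -` fst r \<inter> \<T> \<in> sets mX" by simp
    show "qproj ` q ` snd r \<in> sets mX'" unfolding sets_mX' by (intro openin_borel_of open_map_qproj_q o(2))
  qed
  have "emeasure (mX \<Otimes>\<^sub>M mX') E = (\<integral>\<^sup>+X. emeasure mX' (Pair X -` E) \<partial>mX)"
    by (rule P'.emeasure_pair_measure_alt[OF Em])
  also have "\<dots> = (\<integral>\<^sup>+X. emeasure mX' A \<partial>mX)"
  proof (rule nn_integral_cong)
    fix X assume "X \<in> space mX"
    then have X: "X \<in> \<T>" by simp
    have "Pair X -` E = (\<lambda>C. act (- s X) ` C) ` A"
    proof (intro equalityI subsetI)
      fix C assume "C \<in> Pair X -` E"
      then have C: "act (s X) ` C \<in> A" by (simp add: E_def)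
      have "act (- s X) ` (act (s X) ` C) = C" by (simp add: image_image act_act)
      then show "C \<in> (\<lambda>C. act (- s X) ` C) ` A" using C by (metis imageI)
    next
      fix C assume "C \<in> (\<lambda>C. act (- s X) ` C) ` A"
      then obtain D where D: "D \<in> A" "C = act (- s X) ` D" by blast
      then obtain Z where Z: "Z \<in> \<T>" "D = qproj Z" using AT by blast
      have "C = qproj (act (- s X) Z)" unfolding D(2) Z(2) by (rule qact_qproj[OF Z(1)])
      moreover have "act (s X) ` C = D" unfolding D(2) by (simp add: image_image act_act)
      ultimately show "C \<in> Pair X -` E" using X D(1) Z(1) by (auto simp: E_def)
    qed
    then show "emeasure mX' (Pair X -` E) = emeasure mX' A" using mX'_translate[OF As] by simp
  qed
  also have "\<dots> = emeasure mX' A" by (simp add: P.emeasure_space_1[unfolded space_mX])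
  finally have 1: "emeasure (mX \<Otimes>\<^sub>M mX') E = emeasure mX' A" .
  have "emeasure (mX \<Otimes>\<^sub>M mX') E = (\<integral>\<^sup>+C. emeasure mX ((\<lambda>X. (X, C)) -` E) \<partial>mX')"
    by (rule PS.emeasure_pair_measure_alt2[OF Em])
  also have "\<dots> = (\<integral>\<^sup>+C. emeasure mX (qproj -` A \<inter> \<T>) \<partial>mX')"
  proof (rule nn_integral_cong)
    fix C assume "C \<in> space mX'"
    then obtain y where y: "C = qproj (q y)" unfolding space_mX' carrier_torus by blast
    have pA: "qproj -` A \<inter> \<T> \<in> sets mX" using measurable_sets[OF qproj_measurable' As] by simp
    have eq: "act (s X) ` C = qproj (act y X)" if "X \<in> \<T>" for X
    proof -
      have "act y X = q (y + s X)" using act_q[of y "s X"] qs[OF that] by simp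
      then show ?thesis by (simp add: y qact_qproj act_q add.commute)
    qed
    have "(\<lambda>X. (X, C)) -` E = act y -` (qproj -` A \<inter> \<T>) \<inter> space mX" using eq by (auto simp: E_def y)
    then have "emeasure mX ((\<lambda>X. (X, C)) -` E) = emeasure (distr mX mX (act y)) (qproj -` A \<inter> \<T>)"
      using emeasure_distr[OF measurable_act pA, of y] by simp
    then show "emeasure mX ((\<lambda>X. (X, C)) -` E) = emeasure mX (qproj -` A \<inter> \<T>)" by (simp add: distr_act)
  qed
  also have "\<dots> = emeasure mX (qproj -` A \<inter> \<T>)" using P'.emeasure_space_1 by simp
  finally show ?thesis using 1 by simp
qed

lemma distr_qproj: "distr mX mX' qproj = mX'"
proof (rule measure_eqI_generator_eq[where E="{U. openin QT U}" and \<Omega>="qproj ` \<T>" and A="\<lambda>_. qproj ` \<T>"])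
  interpret P': prob_space mX' by (rule prob_mX')
  show "Int_stable {U. openin QT U}" by (auto simp: Int_stable_def)
  show "{U. openin QT U} \<subseteq> Pow (qproj ` \<T>)" using openin_subset[of QT] by (auto simp: topspace_QT)
  show "sets mX' = sigma_sets (qproj ` \<T>) {U. openin QT U}" unfolding sets_mX' sets_borel_of topspace_QT ..
  then show "sets (distr mX mX' qproj) = sigma_sets (qproj ` \<T>) {U. openin QT U}" by simp
  show eq: "emeasure (distr mX mX' qproj) U = emeasure mX' U" if "U \<in> {U. openin QT U}" for U
  proof -
    have U: "openin QT U" using that by simp
    then have "U \<in> sets mX'" unfolding sets_mX' by (rule openin_borel_of)
    then show ?thesis using quotient_haar_open[OF U] by (simp add: emeasure_distr[OF qproj_measurable'])
  qed
  have o: "openin QT (qproj ` \<T>)" using openin_topspace[of QT] by (simp add: topspace_QT)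
  then show "range (\<lambda>_::nat. qproj ` \<T>) \<subseteq> {U. openin QT U}" by auto
  have "emeasure (distr mX mX' qproj) (qproj ` \<T>) = 1" using eq[of "qproj ` \<T>"] o mX'_1 by simp
  then show "emeasure (distr mX mX' qproj) (qproj ` \<T>) \<noteq> \<infinity>" by simp
qed simp

lemma quotient_torus_action_eq: "quotient_torus_action g = (\<lambda>C. act (g, 0) ` C)"
  by (simp add: quotient_torus_action_def torus_action_eq_act fun_eq_iff)

lemma pp_quotient: "pp_system mX' quotient_torus_action"
  unfolding pp_system_def
proof (intro conjI allI ballI)
  show "prob_space mX'" by (rule prob_mX')
  fix g :: 'g
  have m: "quotient_torus_action g \<in> mX' \<rightarrow>\<^sub>M mX'" unfolding quotient_torus_action_eq by (rule qact_measurable)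
  then show "quotient_torus_action g \<in> mX' \<rightarrow>\<^sub>M mX'" .
  have "distr mX' mX' (quotient_torus_action g) = distr (distr mX mX' qproj) mX' (quotient_torus_action g)" by (simp only: distr_qproj)
  also have "\<dots> = distr mX mX' (quotient_torus_action g \<circ> qproj)" by (rule distr_distr[OF m qproj_measurable'])
  also have "\<dots> = distr mX mX' (qproj \<circ> act (g, 0))"
    by (rule distr_cong) (simp_all add: quotient_torus_action_qproj)
  also have "\<dots> = distr (distr mX mX (act (g, 0))) mX' qproj" by (rule distr_distr[OF qproj_measurable' measurable_act, symmetric])
  also have "\<dots> = mX'" by (simp only: distr_act distr_qproj)
  finally show "distr mX' mX' (quotient_torus_action g) = mX'" .
next
  fix C assume "C \<in> space mX'"
  then obtain X where X: "X \<in> \<T>" "C = qproj X" by auto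
  show "quotient_torus_action 0 C = C" unfolding quotient_torus_action_eq by (simp add: zero_prod_def[symmetric])
  show "quotient_torus_action (g + h) C = quotient_torus_action g (quotient_torus_action h C)" for g h
    unfolding quotient_torus_action_eq by (simp add: image_image act_act)
qed

abbreviation HT where "HT \<equiv> hull_topology L W"
abbreviation mM where "mM \<equiv> mirsky_measure L W mX"
abbreviation nW where "nW \<equiv> (nuG W :: ('g \<times> 'h) set \<Rightarrow> 'g measure)"

lemma hull_sub: "extended_hull L W \<subseteq> topspace vague_topology"
  unfolding extended_hull_def by (rule closure_of_subset_topspace)

lemma topspace_HT: "topspace HT = extended_hull L W"
  unfolding hull_topology_def using hull_sub by (simp add: Int_absorb1)

lemma nW_vague: "X \<in> \<T> \<Longrightarrow> nW X \<in> topspace vague_topology"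
  by (simp add: topspace_vague regular_nuG[OF W_compact])

lemma nW_hull: "X \<in> \<T> \<Longrightarrow> nW X \<in> extended_hull L W"
  unfolding extended_hull_def using closure_of_subset[of "nW ` \<T>" vague_topology] nW_vague by blast

lemma integral_nW:
  assumes c: "c \<in> compactly_supported" and X: "X \<in> \<T>"
  shows "(\<integral>x. c x \<partial>nW X) = periodise (tensor c W) X"
proof -
  note c' = compactly_supportedD[OF c]
  have "(\<integral>x. c x \<partial>nW X) = periodise (\<lambda>y. c (fst y) * indicator W (snd y)) X"
    by (rule integral_nuG[OF W_borel borel_measurable_continuous_onI[OF c'(1)] c'(2) c'(3) W_compact X])
  then show ?thesis unfolding tensor_def[abs_def] .
qed

lemma nW_measurable_vague: "nW \<in> mX \<rightarrow>\<^sub>M borel_of vague_topology"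
proof (rule measurable_vague[OF lcG])
  show "regular_borel_measure euclidean (nW X)" if "X \<in> space mX" for X using that by (simp add: regular_nuG[OF W_compact])
  fix c :: "'g \<Rightarrow> real" assume c: "c \<in> compactly_supported"
  have "periodise (tensor c W) \<in> borel_measurable mX" by (rule periodise_measurable[OF test_fun_tensor[OF test_fun_compactly_supported[OF c] rel_compact_W]])
  then show "(\<lambda>X. \<integral>y. c y \<partial>nW X) \<in> borel_measurable mX"
    by (rule measurable_cong[THEN iffD1, rotated]) (simp add: integral_nW[OF c])
qed

lemma nW_measurable: "nW \<in> mX \<rightarrow>\<^sub>M borel_of HT"
proof (rule measurable_borel_of)
  show "nW \<in> space mX \<rightarrow> topspace HT" using nW_hull by (simp add: topspace_HT)
  fix U assume "openin HT U"
  then obtain V where V: "openin vague_topology V" "U = V \<inter> extended_hull L W"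
    unfolding hull_topology_def openin_subtopology by blast
  have "nW -` V \<inter> space mX \<in> sets mX" by (rule measurable_sets[OF nW_measurable_vague openin_borel_of[OF V(1)]])
  moreover have "nW -` U \<inter> space mX = nW -` V \<inter> space mX" using V(2) nW_hull by auto
  ultimately show "nW -` U \<inter> space mX \<in> sets mX" by simp
qed

lemma sets_mM: "sets mM = sets (borel_of HT)" by (simp add: mirsky_measure_def)
lemma space_mM: "space mM = extended_hull L W" by (simp add: mirsky_measure_def topspace_HT)
lemma emeasure_mM: "S \<in> sets mM \<Longrightarrow> emeasure mM S = emeasure mX (nW -` S \<inter> \<T>)"
  unfolding mirsky_measure_def by (subst emeasure_distr[OF nW_measurable]) simp_all

lemma translate_nW: "X \<in> \<T> \<Longrightarrow> translate g (nW X) = nW (act (g, 0) X)"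
  by (rule nuG_act[OF W_borel W_compact, symmetric])

text \<open>The hull is the closure of an invariant set, so it is invariant.\<close>

lemma continuous_translate_HT: "continuous_map HT HT (translate g)"
proof -
  have "translate g ` extended_hull L W \<subseteq> vague_topology closure_of (translate g ` nW ` \<T>)"
    unfolding extended_hull_def by (rule continuous_map_image_closure_subset[OF continuous_map_translate])
  also have "\<dots> \<subseteq> extended_hull L W" unfolding extended_hull_def
    by (rule closure_of_mono) (auto simp: translate_nW)
  finally have "translate g ` extended_hull L W \<subseteq> extended_hull L W" .
  then show ?thesis unfolding hull_topology_def
    by (intro continuous_map_into_subtopology continuous_map_from_subtopology continuous_map_translate) auto
qed

lemma pp_mirsky: "pp_system mM translate"
  unfolding pp_system_def
proof (intro conjI allI ballI)
  show "prob_space mM" unfolding mirsky_measure_def by (rule prob_space.prob_space_distr[OF prob_mX nW_measurable])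
  fix g :: 'g
  have m: "translate g \<in> borel_of HT \<rightarrow>\<^sub>M borel_of HT" by (rule continuous_map_measurable[OF continuous_translate_HT refl])
  then show "translate g \<in> mM \<rightarrow>\<^sub>M mM" using measurable_cong_sets[OF sets_mM sets_mM] by blast
  have "distr mM mM (translate g) = distr mM (borel_of HT) (translate g)" by (rule distr_cong) (simp_all add: sets_mM)
  also have "\<dots> = distr mX (borel_of HT) (translate g \<circ> nW)" unfolding mirsky_measure_def by (rule distr_distr[OF m nW_measurable])
  also have "\<dots> = distr mX (borel_of HT) (nW \<circ> act (g, 0))" by (rule distr_cong) (simp_all add: translate_nW)
  also have "\<dots> = distr (distr mX mX (act (g, 0))) (borel_of HT) nW" by (rule distr_distr[OF nW_measurable measurable_act, symmetric])
  also have "\<dots> = mM" by (simp only: distr_act mirsky_measure_def)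
  finally show "distr mM mM (translate g) = mM" .
next
  fix m assume "m \<in> space mM"
  then have "m \<in> topspace vague_topology" using hull_sub by (auto simp: space_mM)
  then have s: "sets m = sets borel" by (simp add: topspace_vague regular_sets)
  show "translate 0 m = m" by (rule translate_0[OF s])
  show "translate (g + h) m = translate g (translate h m)" for g h by (rule translate_add[OF s])
qed

section \<open>The isomorphism\<close>

text \<open>Intersects the generic set with the cosets that avoid the null set on which \<open>W\<close> differs from its
periodic version. There the comb and the class in the quotient torus determine each other.
The restriction to a countable union of compact images makes the images
Borel.\<close>

lemma isomorphism_domain:
  obtains A :: "nat \<Rightarrow> ('g \<times> 'h) set" where "\<forall>n. compact (A n)"
    "\<forall>X\<in>(\<Union>n. q ` A n). \<forall>g. act (g, 0) X \<in> (\<Union>n. q ` A n)"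
    "AE X in mX. X \<in> (\<Union>n. q ` A n)"
    "\<forall>n. \<forall>c\<in>compactly_supported. \<exists>f. torus_cont f \<and> (\<forall>X\<in>q ` A n. (\<integral>x. c x \<partial>nW X) = f X)"
    "\<forall>X\<in>(\<Union>n. q ` A n). \<forall>Y\<in>(\<Union>n. q ` A n). nW X = nW Y \<longleftrightarrow> qproj X = qproj Y"
proof -
  obtain Y where Y: "AE X in mX. X \<in> Y" "Y \<subseteq> \<T>" "\<forall>X\<in>Y. \<forall>g. act (g, 0) X \<in> Y"
    "\<forall>X\<in>Y. \<forall>Z\<in>Y. nW X = nW Z \<longrightarrow> (\<exists>d\<in>Per. Z = act (0, d) X)"
    by (rule nuG_determines_coset)
  obtain W' where W': "W' \<in> sets borel" "\<forall>t\<in>Per. \<forall>h. h + t \<in> W' \<longleftrightarrow> h \<in> W'" "AE h in mH. h \<in> W \<longleftrightarrow> h \<in> W'"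
    by (rule periodic_version)
  define N where "N = sym_diff W W'"
  have Nb: "N \<in> sets borel" using W_borel W'(1) by (auto simp: N_def)
  have "AE h in mH. h \<notin> N" using W'(3) by (rule AE_mp) (rule AE_I2, auto simp: N_def)
  then have N0: "emeasure mH N = 0" using AE_iff_measurable[of N mH "\<lambda>h. h \<notin> N"] Nb by (simp add: sets_mH)
  define Y0 where "Y0 = {X\<in>Y. \<forall>y\<in>X. snd y \<notin> N}"
  have Y0: "AE X in mX. X \<in> Y0" using AE_conjI[OF Y(1) AE_misses_null[OF Nb N0]] by (simp add: Y0_def)
  have Y0_inv: "\<forall>X\<in>Y0. \<forall>g. act (g, 0) X \<in> Y0" using Y(3) by (auto simp: Y0_def act_def)
  obtain A :: "nat \<Rightarrow> ('g \<times> 'h) set" where A: "\<forall>n. compact (A n)" "(\<Union>n. q ` A n) \<subseteq> Y0"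
    "\<forall>X\<in>(\<Union>n. q ` A n). \<forall>g. act (g, 0) X \<in> (\<Union>n. q ` A n)"
    "AE X in mX. X \<in> (\<Union>n. q ` A n)"
    "\<forall>n. \<forall>c\<in>compactly_supported. \<exists>f. torus_cont f \<and> (\<forall>X\<in>q ` A n. (\<integral>x. c x \<partial>nW X) = f X)"
    by (rule sigma_compact_core[OF Y0 Y0_inv])
  have key: "nW X = nW Z \<longleftrightarrow> qproj X = qproj Z" if X: "X \<in> Y0" and Z: "Z \<in> Y0" for X Z
  proof -
    have XT: "X \<in> \<T>" and ZT: "Z \<in> \<T>" using X Z Y(2) by (auto simp: Y0_def)
    show ?thesis
    proof
      assume "nW X = nW Z"
      then have "\<exists>d\<in>Per. Z = act (0, d) X" using Y(4) X Z by (simp add: Y0_def)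
      then show "qproj X = qproj Z" unfolding qproj_eq[OF XT ZT] .
    next
      assume "qproj X = qproj Z"
      then obtain t where t: "t \<in> Per" "Z = act (0, t) X" unfolding qproj_eq[OF XT ZT] by blast
      show "nW X = nW Z"
      proof (rule regular_measure_eqI[OF lcG])
        show "regular_borel_measure euclidean (nW X)" "regular_borel_measure euclidean (nW Z)"
          by (rule regular_nuG[OF W_compact XT], rule regular_nuG[OF W_compact ZT])
        fix c :: "'g \<Rightarrow> real" assume c: "c \<in> compactly_supported"
        have "periodise (tensor c W) X = periodise (\<lambda>y. tensor c W ((0, t) + y)) X"
        proof (rule periodise_cong)
          fix y assume y: "y \<in> X"
          have "(0, t) + y \<in> Z" unfolding t(2) act_def using y by (rule imageI)
          then have "snd ((0, t) + y) \<notin> N" using Z unfolding Y0_def by blast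
          then have 1: "snd y + t \<in> W \<longleftrightarrow> snd y + t \<in> W'" by (auto simp: N_def add.commute)
          have "snd y \<notin> N" using X y unfolding Y0_def by blast
          then have 2: "snd y \<in> W \<longleftrightarrow> snd y \<in> W'" by (auto simp: N_def)
          have "snd y + t \<in> W' \<longleftrightarrow> snd y \<in> W'" using W'(2) t(1) by blast
          then have "snd y + t \<in> W \<longleftrightarrow> snd y \<in> W" using 1 2 by simp
          then show "tensor c W y = tensor c W ((0, t) + y)" by (simp add: tensor_def indicator_def add.commute)
        qed
        then show "(\<integral>x. c x \<partial>nW X) = (\<integral>x. c x \<partial>nW Z)"
          unfolding integral_nW[OF c XT] integral_nW[OF c ZT] by (simp add: t(2) periodise_act)
      qed
    qed
  qed
  show ?thesis
  proof (rule that[of A])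
    show "\<forall>X\<in>(\<Union>n. q ` A n). \<forall>Y\<in>(\<Union>n. q ` A n). nW X = nW Y \<longleftrightarrow> qproj X = qproj Y"
      by (intro ballI key) (rule subsetD[OF A(2)], assumption)+
  qed (rule A)+
qed

text \<open>On the set \<open>Z\<close> of \<open>isomorphism_domain\<close>, the combs and the classes in the quotient torus are two
images of \<open>Z\<close> with the same fibres. Images of compact subsets of the pieces are closed on both
sides, which gives measurability of the bijection and of its inverse; both image measures come
from \<open>mX\<close>.\<close>

lemma isomorphism: "isomorphic_systems mM translate mX' quotient_torus_action"
proof -
  interpret P: prob_space mX by (rule prob_mX)
  obtain A :: "nat \<Rightarrow> ('g \<times> 'h) set" where A: "\<forall>n. compact (A n)"
    "\<forall>X\<in>(\<Union>n. q ` A n). \<forall>g. act (g, 0) X \<in> (\<Union>n. q ` A n)"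
    "AE X in mX. X \<in> (\<Union>n. q ` A n)"
    "\<forall>n. \<forall>c\<in>compactly_supported. \<exists>f. torus_cont f \<and> (\<forall>X\<in>q ` A n. (\<integral>x. c x \<partial>nW X) = f X)"
    "\<forall>X\<in>(\<Union>n. q ` A n). \<forall>Y\<in>(\<Union>n. q ` A n). nW X = nW Y \<longleftrightarrow> qproj X = qproj Y"
    by (rule isomorphism_domain)
  define Z where "Z = (\<Union>n. q ` A n)"
  have ZT: "Z \<subseteq> \<T>" by (auto simp: Z_def)
  have Zact: "act (g, 0) X \<in> Z" if "X \<in> Z" for g X using A(2) that unfolding Z_def by blast
  have ZAE: "AE X in mX. X \<in> Z" using A(3) unfolding Z_def .
  have key: "nW X = nW Y \<longleftrightarrow> qproj X = qproj Y" if "X \<in> Z" "Y \<in> Z" for X Y using A(5) that unfolding Z_def by blast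
  have Zq: "X \<in> Z \<longleftrightarrow> (\<exists>n. \<exists>a\<in>A n. X = q a)" for X unfolding Z_def by blast

  have cont: "continuous_map (top_of_set (A n)) vague_topology (\<lambda>x. nW (q x))" for n
  proof (rule continuous_map_into_vague)
    show "regular_borel_measure euclidean (nW (q x))" for x by (rule regular_nuG[OF W_compact q_in_torus])
    fix c :: "'g \<Rightarrow> real" assume "c \<in> compactly_supported"
    then obtain f where f: "torus_cont f" "\<forall>X\<in>q ` A n. (\<integral>x. c x \<partial>nW X) = f X" using A(4) by blast
    have "continuous_on (A n) (\<lambda>x. f (q x))" by (rule continuous_on_subset[OF f(1)[unfolded torus_cont_def] subset_UNIV])
    then have "continuous_map (top_of_set (A n)) euclideanreal (\<lambda>x. f (q x))" by simp
    then show "continuous_map (top_of_set (A n)) euclideanreal (\<lambda>x. \<integral>y. c y \<partial>nW (q x))"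
      by (rule continuous_map_eq) (use f(2) in simp)
  qed
  have closed_HT: "closedin HT (nW ` q ` K)" if K: "compact K" "K \<subseteq> A n" for K n
  proof -
    have "compactin (top_of_set (A n)) K" using K by (simp add: compactin_subtopology)
    then have "compactin vague_topology ((\<lambda>x. nW (q x)) ` K)" by (rule image_compactin[OF _ cont])
    then have "closedin vague_topology ((\<lambda>x. nW (q x)) ` K)" by (rule compactin_imp_closedin[OF Hausdorff_vague[OF lcG]])
    moreover have "(\<lambda>x. nW (q x)) ` K \<subseteq> extended_hull L W" using nW_hull by auto
    ultimately have "closedin HT ((\<lambda>x. nW (q x)) ` K)" unfolding hull_topology_def by (rule closedin_subset_topspace)
    then show ?thesis by (simp add: image_image)
  qed
  have mM_set: "(\<Union>n. nW ` q ` K n) \<in> sets mM" if "\<And>n. compact (K n)" "\<And>n. K n \<subseteq> A n" for K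
  proof (intro sets.countable_UN image_subsetI)
    fix n show "nW ` q ` K n \<in> sets mM" unfolding sets_mM by (rule closedin_borel_of[OF closed_HT[OF that]])
  qed
  have mX'_set: "(\<Union>n. qproj ` q ` K n) \<in> sets mX'" if "\<And>n. compact (K n)" for K :: "nat \<Rightarrow> ('g \<times> 'h) set"
  proof (intro sets.countable_UN image_subsetI)
    fix n show "qproj ` q ` K n \<in> sets mX'" unfolding sets_mX' by (rule closedin_borel_of[OF qproj_compact_closed[OF that]])
  qed
  define AA where "AA = nW ` Z"
  define BB where "BB = qproj ` Z"
  have AA_eq: "AA = (\<Union>n. nW ` q ` A n)" and BB_eq: "BB = (\<Union>n. qproj ` q ` A n)"
    by (simp_all add: AA_def BB_def Z_def image_UN)
  have AAs: "AA \<in> sets mM" unfolding AA_eq using A(1) by (intro mM_set) auto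
  have BBs: "BB \<in> sets mX'" unfolding BB_eq using A(1) by (intro mX'_set) auto
  \<comment> \<open>Any coset in \<open>Z\<close> with the given comb will do, since all of them have the same class.\<close>
  define \<phi> where "\<phi> m = qproj (SOME X. X \<in> Z \<and> nW X = m)" for m
  have phi: "\<phi> (nW X) = qproj X" if X: "X \<in> Z" for X
  proof -
    have "(SOME Y. Y \<in> Z \<and> nW Y = nW X) \<in> Z \<and> nW (SOME Y. Y \<in> Z \<and> nW Y = nW X) = nW X"
      by (rule someI[of "\<lambda>Y. Y \<in> Z \<and> nW Y = nW X" X]) (use X in simp)
    then show ?thesis unfolding \<phi>_def using key X by blast
  qed
  have inj: "inj_on \<phi> AA"
  proof (rule inj_onI)
    fix m m' assume "m \<in> AA" "m' \<in> AA" and eq: "\<phi> m = \<phi> m'"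
    then obtain X Y where XY: "X \<in> Z" "Y \<in> Z" "m = nW X" "m' = nW Y" unfolding AA_def by blast
    then have "qproj X = qproj Y" using eq phi by simp
    then show "m = m'" using key XY by simp
  qed
  have img: "\<phi> ` AA = BB" unfolding AA_def BB_def image_image using phi by simp
  have bij: "bij_betw \<phi> AA BB" using inj img by (simp add: bij_betw_def)
  have inv: "inv_into AA \<phi> (qproj X) = nW X" if X: "X \<in> Z" for X
    using inv_into_f_f[OF inj, of "nW X"] phi[OF X] X by (simp add: AA_def)
  have sAA: "space (restrict_space mM AA) = AA" using sets.sets_into_space[OF AAs] by (simp add: space_restrict_space Int_absorb2)
  have sBB: "space (restrict_space mX' BB) = BB" using sets.sets_into_space[OF BBs] by (simp add: space_restrict_space Int_absorb2)
  have rAA: "S \<in> sets (restrict_space mM AA) \<longleftrightarrow> S \<subseteq> AA \<and> S \<in> sets mM" for S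
    by (rule sets_restrict_space_iff[OF sets.Int[OF AAs sets.top]])
  have rBB: "S \<in> sets (restrict_space mX' BB) \<longleftrightarrow> S \<subseteq> BB \<and> S \<in> sets mX'" for S
    by (rule sets_restrict_space_iff[OF sets.Int[OF BBs sets.top]])

  \<comment> \<open>The part of \<open>AA\<close> that \<open>\<phi>\<close> maps outside an open set is a countable union of images of compact sets, hence
    Borel; the inverse is treated in the same way.\<close>
  have "\<phi> \<in> restrict_space mM AA \<rightarrow>\<^sub>M borel_of QT"
  proof (rule measurable_borel_of)
    show "\<phi> \<in> space (restrict_space mM AA) \<rightarrow> topspace QT"
      unfolding sAA topspace_QT using img ZT unfolding BB_def by blast
    fix U assume U: "openin QT U"
    define K where "K n = A n \<inter> - {x. qproj (q x) \<in> U}" for n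
    have K: "compact (K n)" "K n \<subseteq> A n" for n
      unfolding K_def using A(1) open_preimage_QT[OF U] by (auto intro!: compact_Int_closed)
    have "\<phi> -` U \<inter> AA = AA - (\<Union>n. nW ` q ` K n)"
    proof (intro equalityI subsetI)
      fix m assume m: "m \<in> \<phi> -` U \<inter> AA"
      have "m \<notin> nW ` q ` K n" for n
      proof
        assume "m \<in> nW ` q ` K n"
        then obtain x where x: "x \<in> K n" "m = nW (q x)" by blast
        then have "q x \<in> Z" unfolding Zq using K(2) by blast
        then have "\<phi> m = qproj (q x)" using phi x(2) by simp
        then show False using m x(1) by (simp add: K_def)
      qed
      then show "m \<in> AA - (\<Union>n. nW ` q ` K n)" using m by blast
    next
      fix m assume m: "m \<in> AA - (\<Union>n. nW ` q ` K n)"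
      then obtain n x where x: "x \<in> A n" "m = nW (q x)" unfolding AA_eq by blast
      then have "x \<notin> K n" using m by blast
      then have "qproj (q x) \<in> U" using x(1) by (simp add: K_def)
      moreover have "q x \<in> Z" unfolding Zq using x(1) by blast
      ultimately show "m \<in> \<phi> -` U \<inter> AA" using m phi x(2) by simp
    qed
    then show "\<phi> -` U \<inter> space (restrict_space mM AA) \<in> sets (restrict_space mM AA)"
      unfolding sAA rAA using AAs mM_set[OF K] by auto
  qed
  then have "\<phi> \<in> restrict_space mM AA \<rightarrow>\<^sub>M mX'" using measurable_cong_sets[OF refl sets_mX'] by blast
  then have phi_m: "\<phi> \<in> restrict_space mM AA \<rightarrow>\<^sub>M restrict_space mX' BB"
    by (intro measurable_restrict_space2) (use img sAA in auto)
  have "inv_into AA \<phi> \<in> restrict_space mX' BB \<rightarrow>\<^sub>M borel_of HT"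
  proof (rule measurable_borel_of)
    show "inv_into AA \<phi> \<in> space (restrict_space mX' BB) \<rightarrow> topspace HT"
      unfolding sBB topspace_HT using inv nW_hull ZT by (auto simp: BB_def)
    fix U assume U: "openin HT U"
    then obtain V where V: "openin vague_topology V" "U = V \<inter> extended_hull L W"
      unfolding hull_topology_def openin_subtopology by blast
    have UV: "nW (q x) \<in> U \<longleftrightarrow> nW (q x) \<in> V" for x using V(2) nW_hull by simp
    define K where "K n = {x \<in> A n. nW (q x) \<notin> V}" for n
    have K: "compact (K n)" for n
    proof -
      have "closedin vague_topology (topspace vague_topology - V)" using V(1) by (simp add: closedin_diff)
      then have "closedin (top_of_set (A n)) {x \<in> topspace (top_of_set (A n)). nW (q x) \<in> topspace vague_topology - V}"
        by (rule closedin_continuous_map_preimage[OF cont])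
      moreover have "{x \<in> topspace (top_of_set (A n)). nW (q x) \<in> topspace vague_topology - V} = K n"
        using nW_vague by (auto simp: K_def)
      ultimately show ?thesis using closedin_compact A(1) by metis
    qed
    have "inv_into AA \<phi> -` U \<inter> BB = BB - (\<Union>n. qproj ` q ` K n)"
    proof (intro equalityI subsetI)
      fix C assume C: "C \<in> inv_into AA \<phi> -` U \<inter> BB"
      have "C \<notin> qproj ` q ` K n" for n
      proof
        assume "C \<in> qproj ` q ` K n"
        then obtain x where x: "x \<in> K n" "C = qproj (q x)" by blast
        then have "q x \<in> Z" unfolding Zq K_def by blast
        then have "inv_into AA \<phi> C = nW (q x)" using inv x(2) by simp
        then show False using C x(1) UV by (simp add: K_def)
      qed
      then show "C \<in> BB - (\<Union>n. qproj ` q ` K n)" using C by blast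
    next
      fix C assume C: "C \<in> BB - (\<Union>n. qproj ` q ` K n)"
      then obtain n x where x: "x \<in> A n" "C = qproj (q x)" unfolding BB_eq by blast
      then have "x \<notin> K n" using C by blast
      then have "nW (q x) \<in> U" using x(1) UV by (simp add: K_def)
      moreover have "q x \<in> Z" unfolding Zq using x(1) by blast
      ultimately show "C \<in> inv_into AA \<phi> -` U \<inter> BB" using C inv x(2) by simp
    qed
    then show "inv_into AA \<phi> -` U \<inter> space (restrict_space mX' BB) \<in> sets (restrict_space mX' BB)"
      unfolding sBB rBB using BBs mX'_set[OF K] by auto
  qed
  then have "inv_into AA \<phi> \<in> restrict_space mX' BB \<rightarrow>\<^sub>M mM" using measurable_cong_sets[OF refl sets_mM] by blast
  moreover have "inv_into AA \<phi> \<in> space (restrict_space mX' BB) \<rightarrow> AA" unfolding sBB using inv_into_into[of _ \<phi> AA] img by blast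
  ultimately have inv_m: "inv_into AA \<phi> \<in> restrict_space mX' BB \<rightarrow>\<^sub>M restrict_space mM AA"
    by (intro measurable_restrict_space2)

  have mX'_eq: "emeasure mX' S = emeasure mX (qproj -` S \<inter> \<T>)" if "S \<in> sets mX'" for S
    using emeasure_distr[OF qproj_measurable' that] by (simp add: distr_qproj)
  have pre: "emeasure mM (\<phi> -` S \<inter> AA) = emeasure mX' S" if S: "S \<subseteq> BB" "S \<in> sets mX'" for S
  proof -
    have "S \<in> sets (restrict_space mX' BB)" using S rBB by simp
    from measurable_sets[OF phi_m this] have s: "\<phi> -` S \<inter> AA \<in> sets mM" unfolding sAA rAA by simp
    have "emeasure mM (\<phi> -` S \<inter> AA) = emeasure mX (nW -` (\<phi> -` S \<inter> AA) \<inter> \<T>)" by (rule emeasure_mM[OF s])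
    also have "\<dots> = emeasure mX (qproj -` S \<inter> \<T>)"
    proof (rule emeasure_eq_AE)
      show "AE X in mX. X \<in> nW -` (\<phi> -` S \<inter> AA) \<inter> \<T> \<longleftrightarrow> X \<in> qproj -` S \<inter> \<T>"
        using ZAE by (rule AE_mp) (rule AE_I2, use phi in \<open>auto simp: AA_def\<close>)
      show "nW -` (\<phi> -` S \<inter> AA) \<inter> \<T> \<in> sets mX"
        using measurable_sets[OF nW_measurable, of "\<phi> -` S \<inter> AA"] s unfolding sets_mM by simp
      show "qproj -` S \<inter> \<T> \<in> sets mX" using measurable_sets[OF qproj_measurable' S(2)] by simp
    qed
    also have "\<dots> = emeasure mX' S" by (rule mX'_eq[OF S(2), symmetric])
    finally show ?thesis .
  qed
  have BB1: "emeasure mX' BB = 1"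
  proof -
    have "emeasure mX (qproj -` BB \<inter> \<T>) = emeasure mX \<T>"
    proof (rule emeasure_eq_AE)
      show "AE X in mX. X \<in> qproj -` BB \<inter> \<T> \<longleftrightarrow> X \<in> \<T>"
        using ZAE by (rule AE_mp) (rule AE_I2, auto simp: BB_def)
      show "qproj -` BB \<inter> \<T> \<in> sets mX" using measurable_sets[OF qproj_measurable' BBs] by simp
      show "\<T> \<in> sets mX" using sets.top[of mX] by simp
    qed
    then show ?thesis using mX'_eq[OF BBs] mX_1 by simp
  qed
  have AA1: "emeasure mM AA = 1"
  proof -
    have "\<phi> -` BB \<inter> AA = AA" using img by blast
    then show ?thesis using pre[OF subset_refl BBs] BB1 by simp
  qed
  have distr: "distr (restrict_space mM AA) (restrict_space mX' BB) \<phi> = restrict_space mX' BB"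
  proof (rule measure_eqI)
    fix S assume "S \<in> sets (distr (restrict_space mM AA) (restrict_space mX' BB) \<phi>)"
    then have Sr: "S \<in> sets (restrict_space mX' BB)" by simp
    then have S: "S \<subseteq> BB" "S \<in> sets mX'" using rBB by simp_all
    have "emeasure (distr (restrict_space mM AA) (restrict_space mX' BB) \<phi>) S = emeasure (restrict_space mM AA) (\<phi> -` S \<inter> AA)"
      using emeasure_distr[OF phi_m Sr] unfolding sAA .
    also have "\<dots> = emeasure mM (\<phi> -` S \<inter> AA)" by (rule emeasure_restrict_space[OF sets.Int[OF AAs sets.top] Int_lower2])
    also have "\<dots> = emeasure mX' S" by (rule pre[OF S])
    also have "\<dots> = emeasure (restrict_space mX' BB) S" by (rule emeasure_restrict_space[OF sets.Int[OF BBs sets.top] S(1), symmetric])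
    finally show "emeasure (distr (restrict_space mM AA) (restrict_space mX' BB) \<phi>) S = emeasure (restrict_space mX' BB) S" .
  qed simp

  have tr: "translate g (nW X) = nW (act (g, 0) X)" if "X \<in> Z" for g X using translate_nW that ZT by blast
  have qt: "quotient_torus_action g (qproj X) = qproj (act (g, 0) X)" if "X \<in> Z" for g X using quotient_torus_action_qproj that ZT by blast
  have Zact_image: "(\<lambda>X. act (g, 0) X) ` Z = Z" for g
  proof (intro equalityI subsetI)
    fix X assume X: "X \<in> Z"
    have "act (g, 0) (act (- g, 0) X) = X" by (simp add: act_act zero_prod_def[symmetric])
    then show "X \<in> (\<lambda>X. act (g, 0) X) ` Z" using Zact[OF X, of "- g"] by (metis imageI)
  qed (use Zact in blast)
  have AA_inv: "translate g ` AA = AA" for g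
  proof -
    have "translate g ` AA = nW ` (\<lambda>X. act (g, 0) X) ` Z" unfolding AA_def image_image using tr by (intro image_cong) auto
    then show ?thesis unfolding Zact_image AA_def .
  qed
  have BB_inv: "quotient_torus_action g ` BB = BB" for g
  proof -
    have "quotient_torus_action g ` BB = qproj ` (\<lambda>X. act (g, 0) X) ` Z" unfolding BB_def image_image using qt by (intro image_cong) auto
    then show ?thesis unfolding Zact_image BB_def .
  qed
  have equiv: "\<phi> (translate g m) = quotient_torus_action g (\<phi> m)" if m: "m \<in> AA" for g m
  proof -
    obtain X where X: "X \<in> Z" "m = nW X" using m unfolding AA_def by blast
    show ?thesis unfolding X(2) tr[OF X(1)] phi[OF X(1)] phi[OF Zact[OF X(1)]] qt[OF X(1)] ..
  qed
  show ?thesis unfolding isomorphic_systems_def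
    by (intro conjI pp_mirsky pp_quotient bexI[OF _ AAs] bexI[OF _ BBs] exI[of _ \<phi>] allI ballI)
      (fact AA1 AA_inv BB1 BB_inv bij phi_m inv_m distr equiv)+
qed

end

theorem theorem1:
  fixes L :: "('g::{topological_ab_group_add, second_countable_topology, t2_space} \<times>
               'h::{topological_ab_group_add, second_countable_topology, t2_space}) set"
    and W :: "'h set"
    and mH :: "'h measure"
    and mX :: "('g \<times> 'h) set measure"
    and mX' :: "('g \<times> 'h) set set measure"
  assumes "cut_and_project_scheme L"
    and "haar_measure additive_group euclidean mH"
    and "normalised_haar_measure (torus L) (torus_topology L) mX"
    and "W \<in> sets borel" and "compact (closure W)" and "emeasure mH W > 0"
    and "normalised_haar_measure (quotient_torus L mH W) (quotient_torus_topology L mH W) mX'"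
  shows "isomorphic_systems (mirsky_measure L W mX) translate mX' quotient_torus_action"
proof -
  interpret full_scheme L mX mH W mX'
    by unfold_locales (rule assms)+
  show ?thesis by (rule isomorphism)
qed

end
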